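(* Let $p$ be a prime, $q$ a power of $p$, $n\ge1$, let $\overline{T}$ be a maximal $\sigma$-invariant torus of $\overline{G}=\mathrm{PSp}_{2n}(\overline{\mathbb F}_p)$, and let $T=\overline{T}\cap G$ be the corresponding maximal torus of $G=\mathrm{PSp}_{2n}(q)$, of type $(\overline{n_1})\ldots(\overline{n_k})(n_{k+1})\ldots(n_m)$. Let $N=N_{\overline{G}}(\overline{T})\cap G$. Then $T$ has a complement in $N$ if and only if one of the following conditions holds: (1) $p=2$; (2) $m=1$; (3) $m=2$, $k=2$, the numbers $n_1,n_2$ are odd, and $q\equiv 3\pmod 4$; (4) $m=2$, $k=1$, $n_1$ is odd, $n_2$ is even, and $q\equiv 3\pmod 4$; (5) $m=2$, $k=0$, the numbers $n_1,n_2$ are even, and $q\equiv 3\pmod 4$; (6) $m=2$, $k=0$, and $q\equiv 1\pmod 4$.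
   Context: Rows and columns of $2n\times 2n$ matrices are indexed in the order $1,\dots,n,-1,\dots,-n$. $\mathrm{Sp}_{2n}(\overline{\mathbb F}_p)=\{A\in \mathrm{GL}_{2n}(\overline{\mathbb F}_p): A^{tr}QA=Q\}$ with $Q=\begin{pmatrix}0&I_n\\-I_n&0\end{pmatrix}$, and $\mathrm{PSp}_{2n}(\overline{\mathbb F}_p)$ is its quotient by its center. $\sigma$ is the endomorphism induced by $(a_{ij})\mapsto(a_{ij}^q)$ on $\mathrm{Sp}_{2n}(\overline{\mathbb F}_p)$ and on $\mathrm{PSp}_{2n}(\overline{\mathbb F}_p)$. $\mathrm{Sp}_{2n}(q)$ is the group of $\sigma$-fixed points of $\mathrm{Sp}_{2n}(\overline{\mathbb F}_p)$, and $\mathrm{PSp}_{2n}(q)$ is its image in $\mathrm{PSp}_{2n}(\overline{\mathbb F}_p)$ (equal to $O^{p'}(\mathrm{PSp}_{2n}(\overline{\mathbb F}_p)_\sigma)$). Type of a torus. Let $\overline{T}_0$ be the image in $\overline{G}$ of the group of all matrices $\mathrm{diag}(D,D^{-1})$ in $\mathrm{Sp}_{2n}(\overline{\mathbb F}_p)$, $D$ an invertible diagonal $n\times n$ matrix. Let $W=N_{\overline{G}}(\overline{T}_0)/\overline{T}_0$ with natural map $\pi:N_{\overline{G}}(\overline{T}_0)\to W$. Elements of $N_{\overline{G}}(\overline{T}_0)$ are represented by monomial matrices, and via the induced permutations of the indices $W$ is identified with the group $\mathrm{Sl}_n$ of permutations $\varphi$ of $\{1,\dots,n,-1,\dots,-n\}$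 with $\varphi(-i)=-\varphi(i)$; $\sigma$ acts trivially on $W$. Forgetting signs gives a homomorphism $\mathrm{Sl}_n\to\mathrm{Sym}_n$. If $\varphi\in\mathrm{Sl}_n$ maps to a cycle $(i_1 i_2\ldots i_l)$ and fixes all elements other than $\pm i_1,\dots,\pm i_l$, then, choosing signs of the $i_j$ so that $\varphi(i_j)=i_{j+1}$ for $j<l$, it is called a positive cycle of length $l$ if $\varphi(i_l)=i_1$ and a negative cycle of length $l$ if $\varphi(i_l)=-i_1$ (length 1 included: $\pm i$ fixed, resp. interchanged). Each $\varphi\in \mathrm{Sl}_n$ is uniquely a product of independent positive and negative cycles; $\varphi$ has cyclic type $(\overline{n_1})\ldots(\overline{n_k})(n_{k+1})\ldots(n_m)$, where $0\le k\le m$, $n_i\geq 1$ and $n_1+\dots+n_m=n$, if its negative cycles have lengths $n_1,\dots,n_k$ and its positive cycles have lengths $n_{k+1},\dots,n_m$. Every $\sigma$-invariant maximal torus is $\overline{T}=\overline{T}_0^{\,g}=g^{-1}\overline{T}_0g$ for some $g\in\overline{G}$ with $g^\sigma g^{-1}\in N_{\overline{G}}(\overline{T}_0)$; the corresponding torus $T=\overline{T}\cap G$ is said to have type $(\overline{n_1})\ldots(\overline{n_k})(n_{k+1})\ldots(n_m)$ if $\pi(g^\sigma g^{-1})$ has this cyclic type. For subgroups $T\trianglelefteq N$, "$T$ has a complement in $N$" means that there is a subgroup $H$ with $N=T\rtimes H$. *)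

theory Defs
  imports
    "HOL-Computational_Algebra.Computational_Algebra"
    "HOL-Algebra.Group_Action"
    "Jordan_Normal_Form.Determinant"
begin

section \<open>The ground field\<close>

text \<open>
  The field \<open>'a\<close> is an algebraic closure of the prime field with \<open>p\<close> elements: it is algebraically
  closed by its type class, has characteristic \<open>p\<close>, and is algebraic over its prime subfield
  \<open>range of_nat\<close>.
\<close>
definition alg_closure_of_Fp :: "'a::alg_closed_field itself \<Rightarrow> nat \<Rightarrow> bool" where
  "alg_closure_of_Fp _ p \<longleftrightarrow>
     CHAR('a) = p \<and>
     (\<forall>x::'a. \<exists>f. f \<noteq> 0 \<and> (\<forall>i. Polynomial.coeff f i \<in> range of_nat) \<and> poly f x = 0)"

section \<open>Linear and symplectic groups\<close>

definition GL :: "nat \<Rightarrow> 'a::field mat monoid" where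
  "GL r = \<lparr>carrier = {A \<in> carrier_mat r r. invertible_mat A}, mult = (*), one = 1\<^sub>m r\<rparr>"

text \<open>
  Rows and columns of \<open>2n \<times> 2n\<close> matrices are in the order \<open>1,\<dots>,n,-1,\<dots>,-n\<close>; \<open>mat_pos n i\<close> is the
  (zero-based) position of the index \<open>i\<close>.
\<close>
definition signed_indices :: "nat \<Rightarrow> int set" where
  "signed_indices n = {i. i \<noteq> 0 \<and> \<bar>i\<bar> \<le> int n}"

definition mat_pos :: "nat \<Rightarrow> int \<Rightarrow> nat" where
  "mat_pos n i = (if i > 0 then nat i - 1 else n + nat (- i) - 1)"

definition symp_form :: "nat \<Rightarrow> 'a::field mat" where
  "symp_form n = four_block_mat (0\<^sub>m n n) (1\<^sub>m n) (- 1\<^sub>m n) (0\<^sub>m n n)"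

definition Sp :: "nat \<Rightarrow> 'a::field mat monoid" where
  "Sp n = (GL (2 * n))\<lparr>carrier :=
     {A \<in> carrier (GL (2 * n)). transpose_mat A * symp_form n * A = symp_form n}\<rparr>"

definition group_center :: "('a, 'b) monoid_scheme \<Rightarrow> 'a set" where
  "group_center G = {z \<in> carrier G. \<forall>x \<in> carrier G. z \<otimes>\<^bsub>G\<^esub> x = x \<otimes>\<^bsub>G\<^esub> z}"

definition PSp :: "nat \<Rightarrow> 'a::field mat set monoid" where
  "PSp n = Sp n Mod group_center (Sp n)"

definition PSp_proj :: "nat \<Rightarrow> 'a::field mat \<Rightarrow> 'a mat set" where
  "PSp_proj n A = group_center (Sp n) #>\<^bsub>Sp n\<^esub> A"

definition frob :: "nat \<Rightarrow> 'a::field mat \<Rightarrow> 'a mat" where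
  "frob q = map_mat (\<lambda>x. x ^ q)"

text \<open>
  The induced endomorphism of the quotient is \<open>C \<mapsto> frob q ` C\<close>: the Frobenius map is bijective on
  the symplectic group and on its center, so it carries cosets of the center onto such cosets.
\<close>
definition PSp_frob :: "nat \<Rightarrow> 'a::field mat set \<Rightarrow> 'a mat set" where
  "PSp_frob q C = frob q ` C"

definition Sp_fin :: "nat \<Rightarrow> nat \<Rightarrow> 'a::field mat set" where
  "Sp_fin n q = {A \<in> carrier (Sp n). frob q A = A}"

definition PSp_fin :: "nat \<Rightarrow> nat \<Rightarrow> 'a::field mat set set" where
  "PSp_fin n q = PSp_proj n ` Sp_fin n q"

section \<open>Maximal tori\<close>

text \<open>
  The coordinate ring of \<open>GL r\<close>, as functions: generated by the matrix entries and the
  inverse of the determinant.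
\<close>
inductive_set regular_GL :: "nat \<Rightarrow> ('a::field mat \<Rightarrow> 'a) set" for r :: nat where
  const: "(\<lambda>_. c) \<in> regular_GL r"
| entry: "i < r \<Longrightarrow> j < r \<Longrightarrow> (\<lambda>A. A $$ (i, j)) \<in> regular_GL r"
| inv_det: "(\<lambda>A. inverse (det A)) \<in> regular_GL r"
| add: "f \<in> regular_GL r \<Longrightarrow> h \<in> regular_GL r \<Longrightarrow> (\<lambda>A. f A + h A) \<in> regular_GL r"
| mult: "f \<in> regular_GL r \<Longrightarrow> h \<in> regular_GL r \<Longrightarrow> (\<lambda>A. f A * h A) \<in> regular_GL r"

text \<open>
  On a closed subset of an affine variety the regular functions are the restrictions of the regular
  functions on the whole. Functions are total here; only their values on \<open>X\<close> are relevant.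
\<close>
definition regular_restrict :: "('x \<Rightarrow> 'a) set \<Rightarrow> 'x set \<Rightarrow> ('x \<Rightarrow> 'a) set" where
  "regular_restrict R X = {f. \<exists>h \<in> R. \<forall>x \<in> X. f x = h x}"

text \<open>
  The quotient of \<open>Sp n\<close> by its center is the affine variety whose regular functions are those which
  become regular on \<open>Sp n\<close> after composition with the projection.
\<close>
definition regular_PSp :: "nat \<Rightarrow> ('a::field mat set \<Rightarrow> 'a) set" where
  "regular_PSp n =
     {f. (\<lambda>A. f (PSp_proj n A)) \<in> regular_restrict (regular_GL (2 * n)) (carrier (Sp n))}"

definition zariski_closed :: "('x \<Rightarrow> 'a::field) set \<Rightarrow> 'x set \<Rightarrow> 'x set \<Rightarrow> bool" where
  "zariski_closed R X S \<longleftrightarrow> (\<exists>F \<subseteq> R. S = {x \<in> X. \<forall>f \<in> F. f x = 0})"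

definition diag_group :: "nat \<Rightarrow> 'a::field mat monoid" where
  "diag_group r = (GL r)\<lparr>carrier := {A \<in> carrier (GL r). diagonal_mat A}\<rparr>"

text \<open>
  Let \<open>G\<close> be an affine algebraic group with set \<open>R\<close> of regular functions. A torus is a closed
  subgroup that is isomorphic, as an algebraic group, to the group of invertible diagonal \<open>r \<times> r\<close>
  matrices for some \<open>r\<close>; an isomorphism of affine varieties is a bijection which identifies the
  regular functions.
\<close>
definition is_torus ::
    "('x, 'b) monoid_scheme \<Rightarrow> ('x \<Rightarrow> 'a::field) set \<Rightarrow> 'x set \<Rightarrow> bool" where
  "is_torus G R S \<longleftrightarrow>
     subgroup S G \<and> zariski_closed R (carrier G) S \<and>
     (\<exists>r \<theta>. \<theta> \<in> iso (diag_group r :: 'a mat monoid) (G\<lparr>carrier := S\<rparr>) \<and>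
       (\<forall>f. f \<in> regular_restrict R S \<longleftrightarrow>
            f \<circ> \<theta> \<in> regular_restrict (regular_GL r) (carrier (diag_group r))))"

definition is_maximal_torus ::
    "('x, 'b) monoid_scheme \<Rightarrow> ('x \<Rightarrow> 'a::field) set \<Rightarrow> 'x set \<Rightarrow> bool" where
  "is_maximal_torus G R S \<longleftrightarrow>
     is_torus G R S \<and> (\<forall>S'. is_torus G R S' \<and> S \<subseteq> S' \<longrightarrow> S' = S)"

section \<open>Signed permutations and their cyclic types\<close>

definition Sl :: "nat \<Rightarrow> (int \<Rightarrow> int) set" where
  "Sl n = {\<phi>. \<phi> permutes signed_indices n \<and> (\<forall>i \<in> signed_indices n. \<phi> (- i) = - \<phi> i)}"

text \<open>
  \<open>\<phi>\<close> is a positive (\<open>neg = False\<close>) or negative (\<open>neg = True\<close>) cycle on the sequence \<open>is\<close> of indices,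
  whose signs are chosen such that each entry but the last is mapped to its successor.
\<close>
definition signed_cycle :: "nat \<Rightarrow> bool \<Rightarrow> int list \<Rightarrow> (int \<Rightarrow> int) \<Rightarrow> bool" where
  "signed_cycle n neg is \<phi> \<longleftrightarrow>
     \<phi> \<in> Sl n \<and> is \<noteq> [] \<and> set is \<subseteq> signed_indices n \<and> distinct (map abs is) \<and>
     (\<forall>j. Suc j < length is \<longrightarrow> \<phi> (is ! j) = is ! Suc j) \<and>
     \<phi> (last is) = (if neg then - hd is else hd is) \<and>
     (\<forall>i \<in> signed_indices n. \<bar>i\<bar> \<notin> abs ` set is \<longrightarrow> \<phi> i = i)"

text \<open>
  The cyclic type with \<open>k\<close> negative cycles of lengths \<open>ns 1, \<dots>, ns k\<close> and \<open>m - k\<close> positive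
  cycles of lengths \<open>ns (k + 1), \<dots>, ns m\<close>. A positive cycle of length 1 is the identity, so the
  index sequences \<open>iss 1, \<dots>, iss m\<close> are needed to count the cycles; because the lengths add up to \<open>n\<close>,
  the entries of these sequences are all indices, up to sign.
\<close>
definition has_cyclic_type ::
    "nat \<Rightarrow> nat \<Rightarrow> nat \<Rightarrow> (nat \<Rightarrow> nat) \<Rightarrow> (int \<Rightarrow> int) \<Rightarrow> bool" where
  "has_cyclic_type n k m ns \<phi> \<longleftrightarrow>
     k \<le> m \<and> (\<forall>j \<in> {1..m}. ns j \<ge> 1) \<and> (\<Sum>j = 1..m. ns j) = n \<and>
     (\<exists>iss \<psi>.
        (\<forall>j \<in> {1..m}. length (iss j) = ns j \<and> signed_cycle n (j \<le> k) (iss j) (\<psi> j)) \<and>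
        (\<forall>j \<in> {1..m}. \<forall>j' \<in> {1..m}. j \<noteq> j' \<longrightarrow> abs ` set (iss j) \<inter> abs ` set (iss j') = {}) \<and>
        \<phi> = foldr (\<lambda>j \<chi>. \<psi> j \<circ> \<chi>) [1..<Suc m] id)"

section \<open>Types of tori and complements\<close>

definition T0 :: "nat \<Rightarrow> 'a::field mat set set" where
  "T0 n = PSp_proj n `
     {four_block_mat (mat_diag n d) (0\<^sub>m n n) (0\<^sub>m n n) (mat_diag n (\<lambda>i. inverse (d i))) | d.
        \<forall>i < n. d i \<noteq> 0}"

text \<open>
  The composition of the map \<open>\<pi>\<close> from the normalizer of \<open>T0 n\<close> to the Weyl group with the
  identification of the latter with \<open>Sl n\<close>, as a relation: \<open>x\<close> is represented by a monomial matrix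
  whose nonzero entry in each row \<open>i\<close> is in column \<open>\<phi> i\<close>. Using columns instead would replace
  \<open>\<phi>\<close> by its inverse, which has the same cyclic types.
\<close>
definition induces_perm :: "nat \<Rightarrow> 'a::field mat set \<Rightarrow> (int \<Rightarrow> int) \<Rightarrow> bool" where
  "induces_perm n x \<phi> \<longleftrightarrow>
     \<phi> \<in> Sl n \<and>
     (\<exists>A \<in> carrier (Sp n). x = PSp_proj n A \<and>
        (\<forall>i \<in> signed_indices n. \<forall>j \<in> signed_indices n.
           A $$ (mat_pos n i, mat_pos n j) \<noteq> 0 \<longleftrightarrow> j = \<phi> i))"

definition torus_has_type ::
    "nat \<Rightarrow> nat \<Rightarrow> 'a::field mat set set \<Rightarrow> nat \<Rightarrow> nat \<Rightarrow> (nat \<Rightarrow> nat) \<Rightarrow> bool" where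
  "torus_has_type n q Tbar k m ns \<longleftrightarrow>
     (\<exists>g \<in> carrier (PSp n).
        Tbar = inv\<^bsub>PSp n\<^esub> g <#\<^bsub>PSp n\<^esub> T0 n #>\<^bsub>PSp n\<^esub> g \<and>
        PSp_frob q g \<otimes>\<^bsub>PSp n\<^esub> inv\<^bsub>PSp n\<^esub> g \<in> normalizer (PSp n) (T0 n) \<and>
        (\<exists>\<phi>. induces_perm n (PSp_frob q g \<otimes>\<^bsub>PSp n\<^esub> inv\<^bsub>PSp n\<^esub> g) \<phi> \<and>
             has_cyclic_type n k m ns \<phi>))"

text \<open>\<open>N\<close> is the internal semidirect product of its normal subgroup \<open>T\<close> and some subgroup \<open>H\<close>.\<close>
definition has_complement :: "('x, 'b) monoid_scheme \<Rightarrow> 'x set \<Rightarrow> 'x set \<Rightarrow> bool" where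
  "has_complement G T N \<longleftrightarrow>
     T \<lhd> G\<lparr>carrier := N\<rparr> \<and>
     (\<exists>H. subgroup H (G\<lparr>carrier := N\<rparr>) \<and> T \<inter> H = {\<one>\<^bsub>G\<^esub>} \<and> T <#>\<^bsub>G\<^esub> H = N)"

end

theory Submission
  imports Defs "HOL-Combinatorics.Cycles"
begin

text \<open>
  Let \<open>g\<close> be the image of the matrix \<open>\<gamma>\<close>. Conjugation by \<open>\<gamma>\<close> turns the torus into the diagonal one, and
  the Frobenius map \<open>frob q\<close> into \<open>frob q\<close> followed by conjugation with a monomial matrix \<open>M\<close> that induces
  the permutation \<open>\<phi>\<close>. So \<open>N\<close> consists, modulo the center \<open>{1, -1}\<close>, of the monomial symplectic matrices \<open>X\<close>
  with \<open>frob q X * M = M * X\<close>. By Lang's theorem for a torus, a diagonal change of basis removes the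
  coefficients of \<open>M\<close>. What remains are pairs of a signed permutation \<open>v\<close> that commutes with \<open>\<phi>\<close> and
  coefficients \<open>c\<close> with \<open>c (\<phi> i) = c i ^ q\<close> and \<open>c i * c (- i) = \<beta> i / \<beta> (v i)\<close>, where \<open>\<beta>\<close> is any function
  with \<open>\<beta> (- i) = - \<beta> i\<close> and \<open>\<beta> (\<phi> i) = \<beta> i ^ q\<close>. The torus consists of the pairs with \<open>v = id\<close>, and the
  question is whether some subgroup meets it in \<open>{1, -1}\<close> and projects onto all permutations \<open>v\<close> that
  occur (\<open>complement_iff_torus_complemented\<close>).

  For \<open>p = 2\<close> one may take \<open>\<beta> = 1\<close>, and the pairs with \<open>c = 1\<close> form such a subgroup.

  Let \<open>p\<close> be odd and let there be at least two cycles. The negation of the indices of one cycle commutes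
  with \<open>\<phi>\<close>. The square of any lift is \<open>-1\<close> on this cycle, so a complement forces it to be \<open>-1\<close> on all cycles:
  on each other cycle, the lift is given by a square root of \<open>-1\<close> in the corresponding factor of the
  torus. That factor is cyclic of order \<open>q ^ ns i - 1\<close> for a positive and \<open>q ^ ns i + 1\<close> for a negative
  cycle, so this order is divisible by 4. Two such lifts, for different cycles, have the commutator \<open>-1\<close>
  on these two cycles and 1 on all others, so there is no third cycle (\<open>complement_necessary\<close>). For two
  cycles, divisibility by 4 amounts to the conditions of the theorem (\<open>type_arithmetic\<close>).

  Conversely, let there be a single cycle, or two cycles with these divisibilities. A complement is
  generated by lifts of the negation and of the rotation of each cycle, together with the exchange of
  the cycles if they have the same length and sign. The lifts are multiplied by square roots of \<open>-1\<close> on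
  the other cycle so that they commute up to a global sign. On their own cycle, their coefficients are
  found with norm equations and Hilbert 90 (\<open>generator_coefficients\<close>). If the generators are added one
  at a time, the intersection with the torus does not grow, because the order of each of them modulo
  the previous ones is the order of its permutation (\<open>adjoin_inter\<close>, \<open>complement_sufficient\<close>).
\<close>

section \<open>Complements and homomorphisms\<close>

text \<open>
  The kernel of \<open>\<Phi>\<close> lies in \<open>T\<close>, so complements of \<open>\<Phi> ` T\<close> correspond to their preimages. This
  replaces cosets of the center by matrices: a complement becomes a subgroup which meets the torus
  in the kernel.
\<close>
lemma complement_via_hom:
  assumes hom: "group_hom M G \<Phi>" and T: "T \<lhd> M" and ker: "kernel M G \<Phi> \<subseteq> T"
  shows "has_complement G (\<Phi> ` T) (\<Phi> ` carrier M) \<longleftrightarrow>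
    (\<exists>H. subgroup H M \<and> H \<inter> T = kernel M G \<Phi> \<and>
         (\<forall>x\<in>carrier M. \<exists>t\<in>T. \<exists>h\<in>H. x = t \<otimes>\<^bsub>M\<^esub> h))"
    (is "?C \<longleftrightarrow> (\<exists>H. ?P H)")
proof -
  interpret group_hom M G \<Phi> by fact
  interpret T: normal T M by fact
  let ?N = "\<Phi> ` carrier M"
  have subN: "subgroup ?N G" by (rule img_is_subgroup)
  interpret N: group "G\<lparr>carrier := ?N\<rparr>" by (rule subgroup.subgroup_is_group[OF subN]) simp
  have \<Phi>N: "group_hom M (G\<lparr>carrier := ?N\<rparr>) \<Phi>"
    by unfold_locales (auto simp: hom_def)
  have invN: "inv\<^bsub>G\<lparr>carrier := ?N\<rparr>\<^esub> y = inv\<^bsub>G\<^esub> y" if "y \<in> ?N" for y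
    by (rule H.m_inv_consistent[OF subN that])
  have img_sub: "subgroup (\<Phi> ` K) (G\<lparr>carrier := ?N\<rparr>)" if "subgroup K M" for K
    by (rule group_hom.subgroup_img_is_subgroup[OF \<Phi>N that])
  have normT: "\<Phi> ` T \<lhd> G\<lparr>carrier := ?N\<rparr>"
  proof (rule N.normal_invI)
    show "subgroup (\<Phi> ` T) (G\<lparr>carrier := ?N\<rparr>)" by (rule img_sub) (rule T.subgroup_axioms)
    fix x h assume x: "x \<in> carrier (G\<lparr>carrier := ?N\<rparr>)" and h: "h \<in> \<Phi> ` T"
    then obtain a t where a: "a \<in> carrier M" "x = \<Phi> a" and t: "t \<in> T" "h = \<Phi> t" by auto
    have **: "a \<otimes>\<^bsub>M\<^esub> t \<otimes>\<^bsub>M\<^esub> inv\<^bsub>M\<^esub> a \<in> T" using a t T.inv_op_closed2 by auto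
    have *: "\<Phi> (a \<otimes>\<^bsub>M\<^esub> t \<otimes>\<^bsub>M\<^esub> inv\<^bsub>M\<^esub> a) = \<Phi> a \<otimes>\<^bsub>G\<^esub> \<Phi> t \<otimes>\<^bsub>G\<^esub> inv\<^bsub>G\<^esub> \<Phi> a"
      using a t T.mem_carrier by simp
    have invx: "inv\<^bsub>G\<lparr>carrier := ?N\<rparr>\<^esub> x = inv\<^bsub>G\<^esub> x" using x by (intro invN) simp
    from *[symmetric] ** have "\<Phi> a \<otimes>\<^bsub>G\<^esub> \<Phi> t \<otimes>\<^bsub>G\<^esub> inv\<^bsub>G\<^esub> \<Phi> a \<in> \<Phi> ` T"
      by auto
    then show "x \<otimes>\<^bsub>G\<lparr>carrier := ?N\<rparr>\<^esub> h \<otimes>\<^bsub>G\<lparr>carrier := ?N\<rparr>\<^esub> inv\<^bsub>G\<lparr>carrier := ?N\<rparr>\<^esub> x \<in> \<Phi> ` T"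
      using invx a(2) t(2) by simp
  qed
  have ker_iff: "x \<in> kernel M G \<Phi> \<longleftrightarrow> x \<in> carrier M \<and> \<Phi> x = \<one>\<^bsub>G\<^esub>" for x
    by (auto simp: kernel_def)
  show ?thesis
  proof
    assume ?C
    then obtain H' where H': "subgroup H' (G\<lparr>carrier := ?N\<rparr>)" "\<Phi> ` T \<inter> H' = {\<one>\<^bsub>G\<^esub>}"
        "\<Phi> ` T <#>\<^bsub>G\<^esub> H' = ?N"
      by (auto simp: has_complement_def)
    interpret H': subgroup H' "G\<lparr>carrier := ?N\<rparr>" by fact
    define H where "H = {x \<in> carrier M. \<Phi> x \<in> H'}"
    have subH: "subgroup H M"
    proof (rule G.subgroupI)
      show "H \<subseteq> carrier M" by (auto simp: H_def)
      show "H \<noteq> {}" using H'.one_closed by (auto simp: H_def intro!: exI[of _ "\<one>\<^bsub>M\<^esub>"])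
    next
      fix x assume x: "x \<in> H"
      then have "inv\<^bsub>G\<lparr>carrier := ?N\<rparr>\<^esub> (\<Phi> x) \<in> H'" by (auto simp: H_def)
      then show "inv\<^bsub>M\<^esub> x \<in> H" using x invN by (auto simp: H_def)
    next
      fix x y assume "x \<in> H" "y \<in> H"
      then show "x \<otimes>\<^bsub>M\<^esub> y \<in> H" using H'.m_closed by (auto simp: H_def)
    qed
    moreover have "H \<inter> T = kernel M G \<Phi>"
    proof
      show "H \<inter> T \<subseteq> kernel M G \<Phi>" using H'(2) by (auto simp: H_def ker_iff)
      show "kernel M G \<Phi> \<subseteq> H \<inter> T" using ker H'.one_closed by (auto simp: H_def ker_iff)
    qed
    moreover have "\<exists>t\<in>T. \<exists>h\<in>H. x = t \<otimes>\<^bsub>M\<^esub> h" if x: "x \<in> carrier M" for x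
    proof -
      have "\<Phi> x \<in> \<Phi> ` T <#>\<^bsub>G\<^esub> H'" using x H'(3) by auto
      then obtain t h' where t: "t \<in> T" and h': "h' \<in> H'" and eq: "\<Phi> x = \<Phi> t \<otimes>\<^bsub>G\<^esub> h'"
        by (auto simp: set_mult_def)
      have tM: "t \<in> carrier M" using t T.mem_carrier by auto
      let ?h = "inv\<^bsub>M\<^esub> t \<otimes>\<^bsub>M\<^esub> x"
      have "h' \<in> carrier G" using H'.mem_carrier[OF h'] by auto
      then have "\<Phi> ?h = h'" using tM x eq by (simp add: H.m_assoc[symmetric])
      then have "?h \<in> H" using h' tM x by (auto simp: H_def)
      moreover have "x = t \<otimes>\<^bsub>M\<^esub> ?h" using tM x by (simp add: G.m_assoc[symmetric])
      ultimately show ?thesis using t by blast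
    qed
    ultimately show "\<exists>H. ?P H" by blast
  next
    assume "\<exists>H. ?P H"
    then obtain H where H: "subgroup H M" "H \<inter> T = kernel M G \<Phi>"
        and prod: "\<And>x. x \<in> carrier M \<Longrightarrow> \<exists>t\<in>T. \<exists>h\<in>H. x = t \<otimes>\<^bsub>M\<^esub> h" by blast
    interpret H0: subgroup H M by fact
    have "\<Phi> ` T \<inter> \<Phi> ` H \<subseteq> {\<one>\<^bsub>G\<^esub>}"
    proof clarify
      fix t h assume t: "t \<in> T" and h: "h \<in> H" and eq: "\<Phi> t = \<Phi> h"
      have c: "t \<in> carrier M" "h \<in> carrier M" using t h T.mem_carrier H0.mem_carrier by auto
      have "h \<otimes>\<^bsub>M\<^esub> inv\<^bsub>M\<^esub> t \<in> kernel M G \<Phi>" using c eq by (simp add: ker_iff)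
      then have "h \<otimes>\<^bsub>M\<^esub> inv\<^bsub>M\<^esub> t \<otimes>\<^bsub>M\<^esub> t \<in> T" using ker t by auto
      then have "h \<in> T" using c by (simp add: G.m_assoc)
      then have "h \<in> kernel M G \<Phi>" using h H(2) by auto
      then show "\<Phi> t = \<one>\<^bsub>G\<^esub>" using eq by (simp add: ker_iff)
    qed
    moreover have "\<one>\<^bsub>G\<^esub> \<in> \<Phi> ` T \<inter> \<Phi> ` H"
      using T.one_closed H0.one_closed hom_one by (metis IntI image_eqI)
    moreover have "\<Phi> ` T <#>\<^bsub>G\<^esub> \<Phi> ` H = ?N"
    proof
      show "\<Phi> ` T <#>\<^bsub>G\<^esub> \<Phi> ` H \<subseteq> ?N"
      proof
        fix y assume "y \<in> \<Phi> ` T <#>\<^bsub>G\<^esub> \<Phi> ` H"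
        then obtain t h where th: "t \<in> T" "h \<in> H" "y = \<Phi> t \<otimes>\<^bsub>G\<^esub> \<Phi> h" by (auto simp: set_mult_def)
        then have "y = \<Phi> (t \<otimes>\<^bsub>M\<^esub> h)" using T.mem_carrier H0.mem_carrier by simp
        moreover have "t \<otimes>\<^bsub>M\<^esub> h \<in> carrier M" using th T.mem_carrier H0.mem_carrier by simp
        ultimately show "y \<in> ?N" by (rule image_eqI)
      qed
      show "?N \<subseteq> \<Phi> ` T <#>\<^bsub>G\<^esub> \<Phi> ` H"
      proof clarify
        fix x assume "x \<in> carrier M"
        then obtain t h where th: "t \<in> T" "h \<in> H" "x = t \<otimes>\<^bsub>M\<^esub> h" using prod by blast
        then have "\<Phi> x = \<Phi> t \<otimes>\<^bsub>G\<^esub> \<Phi> h" using T.mem_carrier H0.mem_carrier by simp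
        then show "\<Phi> x \<in> \<Phi> ` T <#>\<^bsub>G\<^esub> \<Phi> ` H" using th by (auto simp: set_mult_def)
      qed
    qed
    ultimately show ?C
      using normT img_sub[OF H(1)] by (auto simp: has_complement_def intro!: exI[of _ "\<Phi> ` H"])
  qed
qed

section \<open>Adjoining an element to a subgroup\<close>

definition adjoin :: "('x, 'b) monoid_scheme \<Rightarrow> 'x set \<Rightarrow> 'x \<Rightarrow> 'x set" where
  "adjoin G A y = {a \<otimes>\<^bsub>G\<^esub> y [^]\<^bsub>G\<^esub> (e::nat) | a e. a \<in> A}"

context group begin

lemma adjoin_incl:
  assumes "subgroup A G" "y \<in> carrier G"
  shows "A \<subseteq> adjoin G A y" and "y \<in> adjoin G A y"
proof -
  interpret A: subgroup A G by fact
  show "A \<subseteq> adjoin G A y"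
  proof
    fix a assume "a \<in> A"
    then have "a = a \<otimes> y [^] (0::nat)" using A.mem_carrier by simp
    then show "a \<in> adjoin G A y" using \<open>a \<in> A\<close> unfolding adjoin_def by blast
  qed
  have "y = \<one> \<otimes> y [^] (1::nat)" using assms by simp
  then show "y \<in> adjoin G A y" using A.one_closed unfolding adjoin_def by blast
qed

lemma inv_cancel [simp]:
  assumes "s \<in> carrier G" "x \<in> carrier G"
  shows "inv s \<otimes> (s \<otimes> x) = x" and "s \<otimes> (inv s \<otimes> x) = x"
  using assms by (simp_all add: m_assoc[symmetric])

lemma conj_pow:
  assumes "s \<in> carrier G" "y \<in> carrier G"
  shows "s \<otimes> y [^] (e::nat) \<otimes> inv s = (s \<otimes> y \<otimes> inv s) [^] e"
proof (induction e)
  case 0 then show ?case using assms by simp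
next
  case (Suc e)
  have "s \<otimes> y [^] Suc e \<otimes> inv s = (s \<otimes> y [^] e \<otimes> inv s) \<otimes> (s \<otimes> y \<otimes> inv s)"
    using assms by (simp add: m_assoc)
  then show ?case using Suc assms by simp
qed

lemma subgroup_pow_closed:
  assumes "subgroup A G" "y \<in> A"
  shows "y [^] (e::nat) \<in> A"
proof -
  interpret A: subgroup A G by fact
  show ?thesis using assms(2) by (induction e) auto
qed

lemma conj_adjoin:
  assumes s: "s \<in> carrier G" and A: "A \<subseteq> carrier G" and y: "y \<in> carrier G" and B: "subgroup B G"
    and conjA: "\<And>a. a \<in> A \<Longrightarrow> s \<otimes> a \<otimes> inv s \<in> B" and conjy: "s \<otimes> y \<otimes> inv s \<in> B"
    and b: "b \<in> adjoin G A y"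
  shows "s \<otimes> b \<otimes> inv s \<in> B"
proof -
  from b obtain a e where ae: "a \<in> A" "b = a \<otimes> y [^] (e::nat)" by (auto simp: adjoin_def)
  then have "s \<otimes> b \<otimes> inv s = (s \<otimes> a \<otimes> inv s) \<otimes> (s \<otimes> y [^] e \<otimes> inv s)"
    using s y A by (simp add: m_assoc subsetD)
  also have "\<dots> \<in> B"
    using conjA[OF ae(1)] subgroup_pow_closed[OF B conjy] conj_pow[OF s y] subgroup.m_closed[OF B] by simp
  finally show ?thesis .
qed

text \<open>
  Since \<open>y\<close> normalizes \<open>A\<close>, a power of \<open>y\<close> can be moved past an element of \<open>A\<close>. Exponents are natural
  numbers, which makes all elements explicit; inverses exist because some power of \<open>y\<close> is in \<open>A\<close>.
\<close>
lemma subgroup_adjoin: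
  assumes A: "subgroup A G" and y: "y \<in> carrier G"
    and conj: "\<And>a. a \<in> A \<Longrightarrow> y \<otimes> a \<otimes> inv y \<in> A"
    and d: "d > 0" and pow: "y [^] (d::nat) \<in> A"
  shows "subgroup (adjoin G A y) G"
proof -
  interpret A: subgroup A G by fact
  have conj_pow_mem: "y [^] (e::nat) \<otimes> a \<otimes> inv (y [^] e) \<in> A" if "a \<in> A" for a e
  proof (induction e)
    case 0 then show ?case using that A.mem_carrier by simp
  next
    case (Suc e)
    have *: "y [^] Suc e = y \<otimes> y [^] e" using y by (rule nat_pow_Suc2)
    have "y [^] Suc e \<otimes> a \<otimes> inv (y [^] Suc e) = y \<otimes> (y [^] e \<otimes> a \<otimes> inv (y [^] e)) \<otimes> inv y"
      unfolding * using y that A.mem_carrier by (simp add: m_assoc inv_mult_group)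
    then show ?case using conj[OF Suc] by simp
  qed
  have mult: "b \<otimes> c \<in> adjoin G A y" if b: "b \<in> adjoin G A y" and c: "c \<in> adjoin G A y" for b c
  proof -
    from b c obtain a e a' e' where *: "a \<in> A" "b = a \<otimes> y [^] (e::nat)" "a' \<in> A" "c = a' \<otimes> y [^] (e'::nat)"
      by (auto simp: adjoin_def)
    have "b \<otimes> c = (a \<otimes> (y [^] e \<otimes> a' \<otimes> inv (y [^] e))) \<otimes> y [^] (e + e')"
      using * y A.mem_carrier by (simp add: m_assoc nat_pow_mult[symmetric])
    then show ?thesis using * conj_pow_mem unfolding adjoin_def by blast
  qed
  have incl: "A \<subseteq> adjoin G A y" "y \<in> adjoin G A y" using adjoin_incl[OF A y] by auto
  have pow_adj: "y [^] (e::nat) \<in> adjoin G A y" for e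
  proof -
    have "y [^] e = \<one> \<otimes> y [^] e" using y by simp
    then show ?thesis using A.one_closed unfolding adjoin_def by blast
  qed
  show ?thesis
  proof (rule subgroupI)
    show sub: "adjoin G A y \<subseteq> carrier G" using A.mem_carrier y by (auto simp: adjoin_def)
    show "adjoin G A y \<noteq> {}" using incl by blast
    fix b assume "b \<in> adjoin G A y"
    then obtain a e where *: "a \<in> A" "b = a \<otimes> y [^] (e::nat)" by (auto simp: adjoin_def)
    \<comment> \<open>\<open>e \<le> d * e\<close>, so \<open>y [^] (d * e)\<close>, a power of an element of \<open>A\<close>, is a multiple of \<open>y [^] e\<close>\<close>
    have "y [^] (d * e - e) \<otimes> y [^] e = (y [^] d) [^] e"
      using d y by (simp add: nat_pow_mult nat_pow_pow)
    then have "inv ((y [^] d) [^] e) \<otimes> y [^] (d * e - e) \<otimes> y [^] e = \<one>"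
      using y by (simp add: m_assoc)
    then have eq: "inv (y [^] e) = inv ((y [^] d) [^] e) \<otimes> y [^] (d * e - e)"
      using y by (intro inv_equality) auto
    have "inv ((y [^] d) [^] e) \<in> A" using subgroup_pow_closed[OF A pow] by (rule A.m_inv_closed)
    then have "inv ((y [^] d) [^] e) \<in> adjoin G A y" using incl(1) by blast
    then have "inv (y [^] e) \<in> adjoin G A y" unfolding eq by (rule mult[OF _ pow_adj])
    moreover have "inv a \<in> adjoin G A y" using * incl(1) by auto
    ultimately have "inv (y [^] e) \<otimes> inv a \<in> adjoin G A y" by (rule mult)
    then show "inv b \<in> adjoin G A y" using * y A.mem_carrier by (simp add: inv_mult_group)
  next
    fix b c assume "b \<in> adjoin G A y" "c \<in> adjoin G A y"
    then show "b \<otimes> c \<in> adjoin G A y" by (rule mult)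
  qed
qed

text \<open>
  The step by which a complement grows. If \<open>a \<otimes> y [^] e\<close> lies in \<open>T\<close>, then \<open>e\<close> is a multiple of \<open>d\<close>, so
  the element was in \<open>A\<close> before.
\<close>
lemma adjoin_inter:
  assumes A: "subgroup A G" and pow: "y [^] (d::nat) \<in> A" and y: "y \<in> carrier G"
    and AT: "A \<inter> T \<subseteq> Z"
    and indep: "\<And>a e::nat. a \<in> A \<Longrightarrow> a \<otimes> y [^] e \<in> T \<Longrightarrow> d dvd e"
  shows "adjoin G A y \<inter> T \<subseteq> Z"
proof
  fix b assume b: "b \<in> adjoin G A y \<inter> T"
  then obtain a e where *: "a \<in> A" "b = a \<otimes> y [^] (e::nat)" by (auto simp: adjoin_def)
  with b have "d dvd e" using indep by blast
  then obtain k where "e = d * k" by blast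
  then have "y [^] e = (y [^] d) [^] k" using y by (simp add: nat_pow_pow)
  then have "y [^] e \<in> A" using subgroup_pow_closed[OF A pow] by simp
  then have "b \<in> A" using * subgroup.m_closed[OF A] by simp
  then show "b \<in> Z" using b AT by blast
qed

end

section \<open>Equivariant monomial matrices\<close>

text \<open>
  The pair \<open>(v, c)\<close> stands for the monomial matrix whose entry in row \<open>i\<close> is \<open>c i\<close>, in column \<open>v i\<close>. The
  equations say that the matrix is fixed by a Frobenius map which permutes the basis vectors by \<open>w\<close>, and
  that, acting on row vectors, it preserves the alternating form with the value \<open>\<beta> i\<close> on the basis
  vectors of indices \<open>i\<close> and \<open>- i\<close>. Outside \<open>I\<close> both components are trivial, so that equality of pairs is
  equality of matrices.
\<close>
definition twisted_monomials ::
    "int set \<Rightarrow> (int \<Rightarrow> int) \<Rightarrow> nat \<Rightarrow> (int \<Rightarrow> 'a::field) \<Rightarrow> ((int \<Rightarrow> int) \<times> (int \<Rightarrow> 'a)) monoid" where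
  "twisted_monomials I w q \<beta> =
     \<lparr>carrier = {(v, c). v permutes I \<and> (\<forall>i. i \<notin> I \<longrightarrow> c i = 1) \<and>
        (\<forall>i\<in>I. v (- i) = - v i \<and> v (w i) = w (v i) \<and>
           c i \<noteq> 0 \<and> c (w i) = c i ^ q \<and> c i * c (- i) = \<beta> i / \<beta> (v i))},
      mult = (\<lambda>(v, c) (u, d). (u \<circ> v, \<lambda>i. c i * d (v i))),
      one = (id, \<lambda>_. 1)\<rparr>"

locale signed_permutation =
  fixes I :: "int set" and w :: "int \<Rightarrow> int"
  assumes zero_notin: "0 \<notin> I" and neg_closed: "i \<in> I \<Longrightarrow> - i \<in> I"
    and w_permutes: "w permutes I" and w_neg: "i \<in> I \<Longrightarrow> w (- i) = - w i"
begin

lemma w_closed [simp]: "w i \<in> I \<longleftrightarrow> i \<in> I"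
  using w_permutes by (rule permutes_in_image)

end

locale frobenius_twist = signed_permutation I w
  for I :: "int set" and w :: "int \<Rightarrow> int" +
  fixes q :: nat and \<beta> :: "int \<Rightarrow> 'a::field"
  assumes \<beta>_nonzero: "i \<in> I \<Longrightarrow> \<beta> i \<noteq> 0" and \<beta>_neg: "i \<in> I \<Longrightarrow> \<beta> (- i) = - \<beta> i"
    and \<beta>_w: "i \<in> I \<Longrightarrow> \<beta> (w i) = \<beta> i ^ q"
    and minus_one_pow: "(- 1 :: 'a) ^ q = - 1"
begin

abbreviation GM where "GM \<equiv> twisted_monomials I w q \<beta>"

abbreviation GM_mult (infixl "\<odot>" 70) where "x \<odot> y \<equiv> x \<otimes>\<^bsub>GM\<^esub> y"

definition torus where "torus = {x \<in> carrier GM. fst x = id}"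

definition signs :: "((int \<Rightarrow> int) \<times> (int \<Rightarrow> 'a)) set" where
  "signs = {(id, \<lambda>_. 1), (id, \<lambda>i. if i \<in> I then - 1 else 1)}"

lemma carrier_iff:
  "(v, c) \<in> carrier GM \<longleftrightarrow> v permutes I \<and> (\<forall>i. i \<notin> I \<longrightarrow> c i = 1) \<and>
        (\<forall>i\<in>I. v (- i) = - v i \<and> v (w i) = w (v i) \<and>
           c i \<noteq> 0 \<and> c (w i) = c i ^ q \<and> c i * c (- i) = \<beta> i / \<beta> (v i))"
  by (simp add: twisted_monomials_def)

lemma mult_eq [simp]: "(v, c) \<odot> (u, d) = (u \<circ> v, \<lambda>i. c i * d (v i))"
  by (simp add: twisted_monomials_def)

lemma one_eq: "\<one>\<^bsub>GM\<^esub> = (id, \<lambda>_. 1)"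
  by (simp add: twisted_monomials_def)

lemma group_GM: "group GM"
proof (rule groupI)
  fix x y assume "x \<in> carrier GM" "y \<in> carrier GM"
  then obtain v c u d where x: "x = (v, c)" "(v, c) \<in> carrier GM" and y: "y = (u, d)" "(u, d) \<in> carrier GM"
    by (cases x; cases y) auto
  have v: "v i \<in> I \<longleftrightarrow> i \<in> I" for i using x by (simp add: carrier_iff permutes_in_image)
  have "c i * d (v i) * (c (- i) * d (v (- i))) = \<beta> i / \<beta> (u (v i))" if i: "i \<in> I" for i
  proof -
    have "v (- i) = - v i" using x i by (simp add: carrier_iff)
    then have "c i * d (v i) * (c (- i) * d (v (- i))) = (c i * c (- i)) * (d (v i) * d (- v i))"
      by (simp only: mult_ac)
    also have "\<dots> = \<beta> i / \<beta> (v i) * (\<beta> (v i) / \<beta> (u (v i)))"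
      using x y i v by (simp add: carrier_iff)
    also have "\<dots> = \<beta> i / \<beta> (u (v i))" using \<beta>_nonzero i v by simp
    finally show ?thesis .
  qed
  then show "x \<odot> y \<in> carrier GM"
    using x y v by (auto simp: carrier_iff permutes_compose power_mult_distrib)
next
  show "\<one>\<^bsub>GM\<^esub> \<in> carrier GM"
    using \<beta>_nonzero by (auto simp: one_eq carrier_iff permutes_id)
next
  fix x y z assume "x \<in> carrier GM" "y \<in> carrier GM" "z \<in> carrier GM"
  then show "x \<odot> y \<odot> z = x \<odot> (y \<odot> z)"
    by (cases x; cases y; cases z) (auto simp: mult_ac)
next
  fix x assume "x \<in> carrier GM"
  then show "\<one>\<^bsub>GM\<^esub> \<odot> x = x" by (cases x) (auto simp: one_eq)
next
  fix x assume "x \<in> carrier GM"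
  then obtain v c where x: "x = (v, c)" "(v, c) \<in> carrier GM" by (cases x) auto
  then have v: "v permutes I" by (simp add: carrier_iff)
  define u where "u = inv_into UNIV v"
  have uv: "u (v i) = i" "v (u i) = i" for i
    using v by (auto simp: u_def permutes_inverses)
  have u: "u permutes I" unfolding u_def using v by (rule permutes_inv)
  have uI: "u i \<in> I \<longleftrightarrow> i \<in> I" for i using u by (rule permutes_in_image)
  define d where "d = (\<lambda>i. inverse (c (u i)))"
  have uneg: "u (- i) = - u i" if "i \<in> I" for i
  proof -
    have "v (- u i) = - i" using x that uI uv by (simp add: carrier_iff)
    then show ?thesis by (metis uv(1))
  qed
  have uw: "u (w i) = w (u i)" if "i \<in> I" for i
  proof -
    have "v (w (u i)) = w i" using x that uI uv by (simp add: carrier_iff)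
    then show ?thesis by (metis uv(1))
  qed
  have "(u, d) \<in> carrier GM"
    unfolding carrier_iff
  proof (intro conjI ballI allI impI)
    show "u permutes I" by fact
    show "d i = 1" if "i \<notin> I" for i using that x uI by (simp add: d_def carrier_iff)
    fix i assume i: "i \<in> I"
    show "u (- i) = - u i" "u (w i) = w (u i)" using i uneg uw by auto
    show "d i \<noteq> 0" using i x uI by (simp add: d_def carrier_iff)
    show "d (w i) = d i ^ q" using i x uI uw by (simp add: d_def carrier_iff power_inverse)
    have "c (u i) * c (- u i) = \<beta> (u i) / \<beta> i" using i x uI uv by (simp add: carrier_iff)
    then show "d i * d (- i) = \<beta> i / \<beta> (u i)"
      using i uneg by (simp add: d_def flip: inverse_mult_distrib)
  qed
  moreover have "(u, d) \<odot> x = \<one>\<^bsub>GM\<^esub>"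
  proof -
    have "c (u i) \<noteq> 0" for i using x uI by (cases "i \<in> I") (auto simp: carrier_iff)
    then show ?thesis using x uv by (simp add: one_eq d_def fun_eq_iff)
  qed
  ultimately show "\<exists>y\<in>carrier GM. y \<odot> x = \<one>\<^bsub>GM\<^esub>" by blast
qed

sublocale GM: group GM by (rule group_GM)

lemma fst_mult [simp]: "fst (x \<odot> y) = fst y \<circ> fst x"
  by (cases x; cases y) simp

lemma fst_permutes: "x \<in> carrier GM \<Longrightarrow> fst x permutes I"
  by (cases x) (simp add: carrier_iff)

lemma fst_inv: assumes "x \<in> carrier GM" shows "fst (inv\<^bsub>GM\<^esub> x) \<circ> fst x = id"
    and "fst x \<circ> fst (inv\<^bsub>GM\<^esub> x) = id"
proof -
  have "fst (x \<odot> inv\<^bsub>GM\<^esub> x) = id" "fst (inv\<^bsub>GM\<^esub> x \<odot> x) = id"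
    using assms by (simp_all add: one_eq del: fst_mult)
  then show "fst (inv\<^bsub>GM\<^esub> x) \<circ> fst x = id" "fst x \<circ> fst (inv\<^bsub>GM\<^esub> x) = id" by auto
qed

lemma torus_normal: "torus \<lhd> GM"
proof (rule GM.normal_invI)
  show "subgroup torus GM"
  proof (rule GM.subgroupI)
    show "torus \<subseteq> carrier GM" "torus \<noteq> {}"
      using GM.one_closed by (auto simp: torus_def one_eq)
    show "inv\<^bsub>GM\<^esub> x \<in> torus" if "x \<in> torus" for x
      using that fst_inv(1)[of x] by (auto simp: torus_def)
    show "x \<odot> y \<in> torus" if "x \<in> torus" "y \<in> torus" for x y
      using that by (auto simp: torus_def)
  qed
  show "x \<odot> h \<odot> inv\<^bsub>GM\<^esub> x \<in> torus" if "x \<in> carrier GM" "h \<in> torus" for x h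
    using that fst_inv[of x] by (auto simp: torus_def)
qed

lemma signs_subgroup: "subgroup signs GM"
proof (rule GM.subgroupI)
  have "(id, \<lambda>i. if i \<in> I then - 1 else 1) \<in> carrier GM"
    using neg_closed \<beta>_nonzero minus_one_pow by (auto simp: carrier_iff permutes_id)
  then show *: "signs \<subseteq> carrier GM" using GM.one_closed by (auto simp: signs_def one_eq)
  show "signs \<noteq> {}" by (auto simp: signs_def)
  show mult: "x \<odot> y \<in> signs" if "x \<in> signs" "y \<in> signs" for x y
    using that by (auto simp: signs_def fun_eq_iff)
  show "inv\<^bsub>GM\<^esub> x \<in> signs" if x: "x \<in> signs" for x
  proof -
    have "x \<odot> x = \<one>\<^bsub>GM\<^esub>" using x by (auto simp: signs_def one_eq fun_eq_iff)
    then have "inv\<^bsub>GM\<^esub> x = x" using x * by (intro GM.inv_equality) auto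
    then show ?thesis using x by simp
  qed
qed

lemma signs_subset_torus: "signs \<subseteq> torus"
  using subgroup.subset[OF signs_subgroup] by (auto simp: torus_def signs_def)

text \<open>
  The existence of a complement of the torus modulo \<open>signs\<close>, which is the center \<open>{1, -1}\<close>.
\<close>
definition torus_complemented :: bool where
  "torus_complemented \<longleftrightarrow> (\<exists>H. subgroup H GM \<and> H \<inter> torus = signs \<and>
     (\<forall>x\<in>carrier GM. \<exists>t\<in>torus. \<exists>h\<in>H. x = t \<odot> h))"

lemma torus_complementedI:
  assumes H: "subgroup H GM" and inter: "H \<inter> torus \<subseteq> signs" and signs: "signs \<subseteq> H"
    and lift: "\<And>x. x \<in> carrier GM \<Longrightarrow> \<exists>h\<in>H. fst h = fst x"
  shows torus_complemented
  unfolding torus_complemented_def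
proof (intro exI conjI ballI)
  show "subgroup H GM" "H \<inter> torus = signs" using assms signs_subset_torus by auto
  fix x assume x: "x \<in> carrier GM"
  obtain h where h: "h \<in> H" "fst h = fst x" using lift[OF x] by blast
  have hc: "h \<in> carrier GM" using subgroup.mem_carrier[OF H h(1)] .
  have "x \<odot> inv\<^bsub>GM\<^esub> h \<in> torus"
    using x hc h fst_inv[of h] by (auto simp: torus_def)
  moreover have "x = (x \<odot> inv\<^bsub>GM\<^esub> h) \<odot> h" using x hc by (simp add: GM.m_assoc)
  ultimately show "\<exists>t\<in>torus. \<exists>h\<in>H. x = t \<odot> h" using h(1) by blast
qed

lemma torus_complementedE:
  assumes torus_complemented
  obtains H where "subgroup H GM" "H \<inter> torus = signs" "\<And>x. x \<in> carrier GM \<Longrightarrow> \<exists>h\<in>H. fst h = fst x"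
proof -
  obtain H where H: "subgroup H GM" "H \<inter> torus = signs"
    and prod: "\<And>x. x \<in> carrier GM \<Longrightarrow> \<exists>t\<in>torus. \<exists>h\<in>H. x = t \<odot> h"
    using assms unfolding torus_complemented_def by blast
  have "\<exists>h\<in>H. fst h = fst x" if x: "x \<in> carrier GM" for x
  proof -
    obtain t h where "t \<in> torus" "h \<in> H" "x = t \<odot> h" using prod[OF x] by blast
    then show ?thesis by (intro bexI[of _ h]) (auto simp: torus_def)
  qed
  then show thesis using that H by blast
qed

end

section \<open>Blocks of a signed permutation\<close>

locale signed_cycles = signed_permutation I w
  for I :: "int set" and w :: "int \<Rightarrow> int" +
  fixes k m :: nat and ns :: "nat \<Rightarrow> nat" and b :: "nat \<Rightarrow> int" and blk :: "int \<Rightarrow> nat"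
  assumes blk_range: "i \<in> I \<Longrightarrow> blk i \<in> {1..m}"
    and blk_neg: "i \<in> I \<Longrightarrow> blk (- i) = blk i" and blk_w: "i \<in> I \<Longrightarrow> blk (w i) = blk i"
    and base: "j \<in> {1..m} \<Longrightarrow> b j \<in> I" and blk_base: "j \<in> {1..m} \<Longrightarrow> blk (b j) = j"
    and reach: "i \<in> I \<Longrightarrow> \<exists>s. i = (w ^^ s) (b (blk i)) \<or> i = - (w ^^ s) (b (blk i))"
    and ns_pos: "j \<in> {1..m} \<Longrightarrow> ns j \<ge> 1"
    and closing: "j \<in> {1..m} \<Longrightarrow> (w ^^ ns j) (b j) = (if j \<le> k then - b j else b j)"
    and free: "j \<in> {1..m} \<Longrightarrow> 0 < s \<Longrightarrow> s < ns j \<Longrightarrow> \<bar>(w ^^ s) (b j)\<bar> \<noteq> \<bar>b j\<bar>"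
begin

text \<open>
  The \<open>ns j\<close>-th power of \<open>w\<close> acts on the \<open>j\<close>-th block as multiplication by this sign.
\<close>
definition cycle_sign :: "nat \<Rightarrow> int" where "cycle_sign j = (if j \<le> k then - 1 else 1)"

lemma w_pow_closed [simp]: "(w ^^ s) i \<in> I \<longleftrightarrow> i \<in> I"
  by (induction s) auto

lemma w_pow_neg: "i \<in> I \<Longrightarrow> (w ^^ s) (- i) = - (w ^^ s) i"
  by (induction s) (auto simp: w_neg)

lemma sign_cases: "\<bar>\<alpha>::int\<bar> = 1 \<Longrightarrow> (\<alpha> = 1 \<Longrightarrow> P) \<Longrightarrow> (\<alpha> = - 1 \<Longrightarrow> P) \<Longrightarrow> P"
  by linarith

lemma sign_closed: "\<bar>\<alpha>\<bar> = 1 \<Longrightarrow> i \<in> I \<Longrightarrow> \<alpha> * i \<in> I"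
  by (erule sign_cases) (auto simp: neg_closed)

lemma w_pow_sign: "\<bar>\<alpha>\<bar> = 1 \<Longrightarrow> i \<in> I \<Longrightarrow> (w ^^ s) (\<alpha> * i) = \<alpha> * (w ^^ s) i"
  by (erule sign_cases) (auto simp: w_pow_neg)

lemma abs_cycle_sign [simp]: "\<bar>cycle_sign j\<bar> = 1" "\<bar>cycle_sign j ^ r\<bar> = 1" "cycle_sign j * cycle_sign j = 1"
  by (auto simp: cycle_sign_def power_abs)

lemma w_pow_ns: "j \<in> {1..m} \<Longrightarrow> (w ^^ (ns j * r)) (b j) = cycle_sign j ^ r * b j"
proof (induction r)
  case (Suc r)
  have "(w ^^ (ns j * Suc r)) (b j) = (w ^^ ns j) ((w ^^ (ns j * r)) (b j))"
    by (simp add: funpow_add)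
  also have "\<dots> = cycle_sign j ^ r * (w ^^ ns j) (b j)" using Suc by (simp add: w_pow_sign base)
  also have "\<dots> = cycle_sign j ^ Suc r * b j" using closing Suc by (simp add: cycle_sign_def)
  finally show ?case .
qed simp

lemma base_nonzero: "j \<in> {1..m} \<Longrightarrow> b j \<noteq> 0"
  using base zero_notin by metis

lemma period:
  assumes j: "j \<in> {1..m}" and \<alpha>: "\<bar>\<alpha>\<bar> = 1" and eq: "(w ^^ s) (b j) = \<alpha> * b j"
  obtains r where "s = ns j * r" "\<alpha> = cycle_sign j ^ r"
proof -
  define r d where "r = s div ns j" and "d = s mod ns j"
  have s: "s = d + ns j * r" by (simp add: r_def d_def)
  have d: "d < ns j" using ns_pos[OF j] by (simp add: d_def)
  have "(w ^^ s) (b j) = cycle_sign j ^ r * (w ^^ d) (b j)"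
    unfolding s funpow_add using j by (simp add: w_pow_ns w_pow_sign base)
  then have "\<bar>(w ^^ d) (b j)\<bar> = \<bar>b j\<bar>" using eq \<alpha> by (metis abs_mult abs_cycle_sign(2) mult_1)
  then have "d = 0" using free[OF j _ d] by blast
  then have s': "s = ns j * r" using s by simp
  then have "cycle_sign j ^ r * b j = \<alpha> * b j" using eq w_pow_ns[OF j] by simp
  then have "\<alpha> = cycle_sign j ^ r" using base_nonzero[OF j] by simp
  with s' show thesis by (rule that)
qed

lemma reach_sign:
  assumes "i \<in> I" obtains \<alpha> s where "\<bar>\<alpha>\<bar> = 1" "i = \<alpha> * (w ^^ s) (b (blk i))"
  using reach[OF assms] by (metis abs_1 abs_neg_one mult_1 mult_minus1)

lemma block_induct [consumes 1, case_names start step]: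
  assumes i: "i \<in> I" and base': "\<And>j \<alpha>. j \<in> {1..m} \<Longrightarrow> \<bar>\<alpha>\<bar> = 1 \<Longrightarrow> P (\<alpha> * b j)"
    and step: "\<And>i. i \<in> I \<Longrightarrow> P i \<Longrightarrow> P (w i)"
  shows "P i"
proof -
  obtain \<alpha> s where \<alpha>: "\<bar>\<alpha>\<bar> = 1" "i = \<alpha> * (w ^^ s) (b (blk i))" using reach_sign[OF i] .
  have j: "blk i \<in> {1..m}" using blk_range[OF i] .
  have "P (\<alpha> * (w ^^ t) (b (blk i)))" for t
  proof (induction t)
    case 0 then show ?case using base' \<alpha> j by simp
  next
    case (Suc t)
    have "\<alpha> * (w ^^ t) (b (blk i)) \<in> I" using \<alpha>(1) j by (simp add: sign_closed base)
    moreover have "w (\<alpha> * (w ^^ t) (b (blk i))) = \<alpha> * (w ^^ Suc t) (b (blk i))"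
      using w_pow_sign[of \<alpha> "(w ^^ t) (b (blk i))" 1] \<alpha>(1) j by (simp add: base)
    ultimately show ?case using step Suc by metis
  qed
  then show ?thesis using \<alpha>(2) by metis
qed

lemma blk_w_pow: "i \<in> I \<Longrightarrow> blk ((w ^^ s) i) = blk i"
  by (induction s) (auto simp: blk_w)

lemma blk_sign: "\<bar>\<alpha>\<bar> = 1 \<Longrightarrow> i \<in> I \<Longrightarrow> blk (\<alpha> * i) = blk i"
  by (erule sign_cases) (auto simp: blk_neg)

text \<open>
  The elements of a block are \<open>\<alpha> * (w ^^ s) (b j)\<close> with a sign \<open>\<alpha>\<close>, and the only coincidences between
  them come from \<open>(w ^^ ns j) (b j) = cycle_sign j * b j\<close>. So an equivariant function is determined by
  its values at \<open>b j\<close> and \<open>- b j\<close>, and the hypothesis on \<open>V\<close> is all that these have to satisfy. Used with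
  the Frobenius map for coefficients, and with \<open>w\<close> itself for the exchange of two blocks.
\<close>
lemma extend_from_bases:
  fixes act :: "'b \<Rightarrow> 'b" and V :: "nat \<Rightarrow> int \<Rightarrow> 'b"
  assumes V: "\<And>j \<alpha>. j \<in> {1..m} \<Longrightarrow> \<bar>\<alpha>\<bar> = 1 \<Longrightarrow> (act ^^ ns j) (V j (cycle_sign j * \<alpha>)) = V j \<alpha>"
  obtains f where "\<And>j \<alpha>. j \<in> {1..m} \<Longrightarrow> \<bar>\<alpha>\<bar> = 1 \<Longrightarrow> f (\<alpha> * b j) = V j \<alpha>"
    and "\<And>i. i \<in> I \<Longrightarrow> f (w i) = act (f i)"
proof -
  have iter: "(act ^^ (ns j * r)) (V j \<alpha>) = V j (cycle_sign j ^ r * \<alpha>)" if "j \<in> {1..m}" "\<bar>\<alpha>\<bar> = 1" for j \<alpha> r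
  proof (induction r)
    case (Suc r)
    have "(act ^^ (ns j * Suc r)) (V j \<alpha>) = (act ^^ ns j) (V j (cycle_sign j * (cycle_sign j ^ Suc r * \<alpha>)))"
      using Suc by (simp add: funpow_add mult.assoc[symmetric])
    also have "\<dots> = V j (cycle_sign j ^ Suc r * \<alpha>)"
      using that by (intro V) (auto simp: abs_mult simp del: power_Suc)
    finally show ?case .
  qed simp
  have le: "(act ^^ s) (V j \<alpha>) = (act ^^ s') (V j \<alpha>')"
    if j: "j \<in> {1..m}" and \<alpha>: "\<bar>\<alpha>\<bar> = 1" "\<bar>\<alpha>'\<bar> = 1" and eq: "\<alpha> * (w ^^ s) (b j) = \<alpha>' * (w ^^ s') (b j)"
      and "s \<le> s'" for j \<alpha> s \<alpha>' s'
  proof -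
    obtain d where d: "s' = s + d" using \<open>s \<le> s'\<close> le_Suc_ex by blast
    have aa: "\<alpha>' * \<alpha>' = 1" using \<alpha>(2) by (metis abs_mult_self_eq mult_1)
    have "(w ^^ s) (\<alpha> * b j) = (w ^^ s) (\<alpha>' * (w ^^ d) (b j))"
      using eq j \<alpha> by (simp add: w_pow_sign base d funpow_add)
    then have "\<alpha> * b j = \<alpha>' * (w ^^ d) (b j)"
      using permutes_inj[OF w_permutes] by (metis inj_fn injD)
    then have "(w ^^ d) (b j) = (\<alpha>' * \<alpha>) * b j" using aa by (metis mult.assoc mult_1)
    then obtain r where r: "d = ns j * r" "\<alpha>' * \<alpha> = cycle_sign j ^ r"
      using period[OF j, of "\<alpha>' * \<alpha>" d] \<alpha> by (auto simp: abs_mult)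
    have "(act ^^ d) (V j \<alpha>') = V j (cycle_sign j ^ r * \<alpha>')" using iter[OF j \<alpha>(2)] r by simp
    moreover have "cycle_sign j ^ r * \<alpha>' = \<alpha>" using r(2) aa by (metis mult.assoc mult.commute mult_1)
    ultimately show ?thesis by (simp add: d funpow_add)
  qed
  have uniq: "(act ^^ s) (V j \<alpha>) = (act ^^ s') (V j \<alpha>')"
    if "j \<in> {1..m}" "\<bar>\<alpha>\<bar> = 1" "\<bar>\<alpha>'\<bar> = 1" "\<alpha> * (w ^^ s) (b j) = \<alpha>' * (w ^^ s') (b j)" for j \<alpha> s \<alpha>' s'
    using le[of j \<alpha> \<alpha>' s s'] le[of j \<alpha>' \<alpha> s' s] that by (cases "s \<le> s'") auto
  define P where "P = (\<lambda>i (\<alpha>, s). \<bar>\<alpha>\<bar> = 1 \<and> i = \<alpha> * (w ^^ s) (b (blk i)))"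
  define f where "f = (\<lambda>i. case (SOME x. P i x) of (\<alpha>, s) \<Rightarrow> (act ^^ s) (V (blk i) \<alpha>))"
  have f: "f (\<alpha> * (w ^^ s) (b j)) = (act ^^ s) (V j \<alpha>)" if j: "j \<in> {1..m}" and \<alpha>: "\<bar>\<alpha>\<bar> = 1" for j \<alpha> s
  proof -
    let ?i = "\<alpha> * (w ^^ s) (b j)"
    have blk: "blk ?i = j" using j \<alpha> by (simp add: blk_sign base blk_w_pow blk_base)
    then have "P ?i (\<alpha>, s)" using \<alpha> by (simp add: P_def)
    then have P: "P ?i (SOME x. P ?i x)" by (rule someI)
    obtain \<alpha>' s' where x: "(SOME x. P ?i x) = (\<alpha>', s')" by (cases "SOME x. P ?i x") auto
    then have "\<bar>\<alpha>'\<bar> = 1" "?i = \<alpha>' * (w ^^ s') (b j)" using P blk by (auto simp: P_def)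
    then show ?thesis using uniq[of j \<alpha> \<alpha>' s s'] j \<alpha> x blk by (simp add: f_def)
  qed
  show thesis
  proof (rule that)
    show "f (\<alpha> * b j) = V j \<alpha>" if "j \<in> {1..m}" "\<bar>\<alpha>\<bar> = 1" for j \<alpha>
      using f[of j \<alpha> 0] that by simp
    fix i assume i: "i \<in> I"
    obtain \<alpha> s where \<alpha>: "\<bar>\<alpha>\<bar> = 1" "i = \<alpha> * (w ^^ s) (b (blk i))" using reach_sign[OF i] .
    have j: "blk i \<in> {1..m}" using blk_range[OF i] .
    have "w i = w (\<alpha> * (w ^^ s) (b (blk i)))" using \<alpha>(2) by simp
    also have "\<dots> = \<alpha> * (w ^^ Suc s) (b (blk i))"
      using w_pow_sign[of \<alpha> "(w ^^ s) (b (blk i))" 1] \<alpha>(1) j by (simp add: base)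
    finally have "f (w i) = (act ^^ Suc s) (V (blk i) \<alpha>)" using f[OF j \<alpha>(1), of "Suc s"] by simp
    also have "\<dots> = act (f i)" using f[OF j \<alpha>(1), of s] \<alpha>(2) by simp
    finally show "f (w i) = act (f i)" .
  qed
qed

end
locale signed_blocks = frobenius_twist I w q \<beta> + signed_cycles I w k m ns b blk
  for I :: "int set" and w :: "int \<Rightarrow> int" and q :: nat and \<beta> :: "int \<Rightarrow> 'a::alg_closed_field"
    and k m :: nat and ns :: "nat \<Rightarrow> nat" and b :: "nat \<Rightarrow> int" and blk :: "int \<Rightarrow> nat"

section \<open>Non-existence of complements\<close>

lemma involution_permutes:
  assumes "\<And>i. v (v i) = i" "\<And>i. i \<notin> I \<Longrightarrow> v i = i"
  shows "v permutes I"
  unfolding permutes_def using assms by metis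

lemma funpow_power: "((\<lambda>x. x ^ q) ^^ s) (x::'a::monoid_mult) = x ^ (q ^ s)"
  by (induction s) (auto simp: power_mult[symmetric] mult.commute)

context signed_blocks begin

lemma frob_w_pow:
  fixes f :: "int \<Rightarrow> 'a"
  assumes "\<And>i. i \<in> I \<Longrightarrow> f (w i) = f i ^ q" "i \<in> I"
  shows "f ((w ^^ s) i) = f i ^ (q ^ s)"
proof (induction s)
  case (Suc s)
  have "f ((w ^^ Suc s) i) = f ((w ^^ s) i) ^ q" using assms by simp
  also have "\<dots> = f i ^ (q ^ s * q)" using Suc by (simp add: power_mult)
  also have "\<dots> = f i ^ (q ^ Suc s)" by (simp add: mult.commute)
  finally show ?case .
qed simp

text \<open>
  Prescribing \<open>f i * f (- i)\<close> leaves one free value \<open>t j\<close> per block. On a positive cycle it has to lie in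
  the field with \<open>q ^ ns j\<close> elements, on a negative one it satisfies a norm equation; both are solvable
  in an algebraically closed field.
\<close>
lemma extend_field:
  fixes \<kappa> :: "int \<Rightarrow> 'a" and t :: "nat \<Rightarrow> 'a"
  assumes \<kappa>: "\<And>i. i \<in> I \<Longrightarrow> \<kappa> i \<noteq> 0" "\<And>i. i \<in> I \<Longrightarrow> \<kappa> (- i) = \<kappa> i"
      "\<And>i. i \<in> I \<Longrightarrow> \<kappa> (w i) = \<kappa> i ^ q"
    and t0: "\<And>j. j \<in> {1..m} \<Longrightarrow> t j \<noteq> 0"
    and t: "\<And>j. j \<in> {1..m} \<Longrightarrow> t j ^ (q ^ ns j) = (if j \<le> k then \<kappa> (b j) / t j else t j)"
  obtains f where "\<And>j. j \<in> {1..m} \<Longrightarrow> f (b j) = t j"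
    and "\<And>i. i \<in> I \<Longrightarrow> f i \<noteq> 0" and "\<And>i. i \<in> I \<Longrightarrow> f (w i) = f i ^ q"
    and "\<And>i. i \<in> I \<Longrightarrow> f i * f (- i) = \<kappa> i"
proof -
  define V where "V = (\<lambda>j (\<alpha>::int). if \<alpha> = 1 then t j else \<kappa> (b j) / t j)"
  have \<kappa>b: "\<kappa> (b j) ^ (q ^ ns j) = \<kappa> (b j)" if j: "j \<in> {1..m}" for j
  proof -
    have "\<kappa> (b j) ^ (q ^ ns j) = \<kappa> ((w ^^ ns j) (b j))"
      using frob_w_pow[of \<kappa>, OF \<kappa>(3) base[OF j]] by simp
    then show ?thesis using j by (simp add: closing \<kappa>(2) base)
  qed
  have V: "((\<lambda>x. x ^ q) ^^ ns j) (V j (cycle_sign j * \<alpha>)) = V j \<alpha>"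
    if j: "j \<in> {1..m}" and \<alpha>: "\<bar>\<alpha>\<bar> = 1" for j \<alpha>
    using \<alpha> j t[OF j] t0[OF j] \<kappa>b[OF j] \<kappa>(1)[OF base[OF j]]
    by (elim sign_cases) (auto simp: V_def cycle_sign_def funpow_power power_divide)
  obtain f where f: "\<And>j \<alpha>. j \<in> {1..m} \<Longrightarrow> \<bar>\<alpha>\<bar> = 1 \<Longrightarrow> f (\<alpha> * b j) = V j \<alpha>"
    "\<And>i. i \<in> I \<Longrightarrow> f (w i) = f i ^ q"
    using extend_from_bases[of "\<lambda>x. x ^ q" V, OF V] by blast
  show thesis
  proof (rule that)
    show "f (b j) = t j" if "j \<in> {1..m}" for j using f(1)[OF that, of 1] by (simp add: V_def)
    show "f (w i) = f i ^ q" if "i \<in> I" for i using f(2) that .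
    show "f i \<noteq> 0" if "i \<in> I" for i
      using that
    proof (induction rule: block_induct)
      case (start j \<alpha>)
      then show ?case using f(1) t0 \<kappa>(1) base by (auto simp: V_def)
    next
      case (step i) then show ?case using f(2) by simp
    qed
    show "f i * f (- i) = \<kappa> i" if "i \<in> I" for i
      using that
    proof (induction rule: block_induct)
      case (start j \<alpha>)
      have bj: "b j \<in> I" using base[OF start(1)] .
      have "f (\<alpha> * b j) = V j \<alpha>" "f (- (\<alpha> * b j)) = V j (- \<alpha>)"
        using f(1)[OF start(1), of \<alpha>] f(1)[OF start(1), of "- \<alpha>"] start(2) by auto
      then show ?case using start(2) t0[OF start(1)] \<kappa>(1,2)[OF bj]
        by (elim sign_cases) (auto simp: V_def)
    next
      case (step i)
      have "f (w i) * f (- w i) = f (w i) * f (w (- i))" using w_neg step by simp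
      also have "\<dots> = (f i * f (- i)) ^ q" using f(2) step neg_closed by (simp flip: power_mult_distrib)
      finally show ?case using step \<kappa>(3) by simp
    qed
  qed
qed

definition block_neg :: "nat \<Rightarrow> int \<Rightarrow> int" where
  "block_neg j = (\<lambda>i. if i \<in> I \<and> blk i = j then - i else i)"

lemma block_neg_permutes: "block_neg j permutes I"
  by (rule involution_permutes) (auto simp: block_neg_def neg_closed blk_neg)

text \<open>
  The negation of a single block commutes with \<open>w\<close>; as its lift has entries with product \<open>-1\<close> at \<open>i\<close> and
  \<open>- i\<close>, its square is \<open>-1\<close> on that block.
\<close>
lemma block_neg_lift:
  assumes j: "j \<in> {1..m}"
  obtains c where "(block_neg j, c) \<in> carrier GM"
proof -
  define \<kappa> :: "int \<Rightarrow> 'a" where "\<kappa> = (\<lambda>i. if blk i = j then - 1 else 1)"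
  have "\<exists>x::'a. x ^ (q ^ ns l + 1) = \<kappa> (b l)" for l by (rule nth_root_exists) simp
  then obtain r where r: "\<And>l. r l ^ (q ^ ns l + 1) = \<kappa> (b l)" by metis
  have \<kappa>0: "\<kappa> i \<noteq> 0" for i by (simp add: \<kappa>_def)
  have r0: "r l \<noteq> 0" for l using r[of l] \<kappa>0[of "b l"] by auto
  define t where "t = (\<lambda>l. if l \<le> k then r l else 1)"
  have tq: "t l ^ (q ^ ns l) = (if l \<le> k then \<kappa> (b l) / t l else t l)" for l
    using r[of l] r0[of l] by (simp add: t_def field_simps)
  obtain f where f: "\<And>i. i \<in> I \<Longrightarrow> f i \<noteq> 0" "\<And>i. i \<in> I \<Longrightarrow> f (w i) = f i ^ q"
    "\<And>i. i \<in> I \<Longrightarrow> f i * f (- i) = \<kappa> i"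
    by (rule extend_field[of \<kappa> t]) (use \<kappa>0 tq r0 minus_one_pow in \<open>auto simp: \<kappa>_def blk_neg blk_w t_def\<close>)
  have "(block_neg j, \<lambda>i. if i \<in> I then f i else 1) \<in> carrier GM"
    using f block_neg_permutes neg_closed \<beta>_nonzero \<beta>_neg
    by (auto simp: carrier_iff block_neg_def w_neg blk_neg blk_w \<kappa>_def)
  then show thesis by (rule that)
qed

lemma square_root_pow_mod_4:
  fixes x :: "'a"
  assumes "x\<^sup>2 = - 1" "odd n"
  shows "x ^ n = (if n mod 4 = 1 then x else - x)"
proof -
  have x4: "x ^ 4 = 1" using assms(1) by (metis mult_2 numeral_Bit0 power2_eq_square power_add power_minus1_even power_one_right minus_mult_minus mult_1)
  have "n = n mod 4 + 4 * (n div 4)" by simp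
  then have "x ^ n = x ^ (n mod 4)" using x4 by (metis mult_1_right power_add power_mult power_one)
  moreover have "n mod 4 = 1 \<or> n mod 4 = 3" using assms(2) by presburger
  moreover have "x ^ 3 = - x" using assms(1) by (simp add: power3_eq_cube power2_eq_square)
  ultimately show ?thesis by auto
qed

lemma commute_mod_signs:
  assumes H: "subgroup H GM" "H \<inter> torus = signs" and xy: "x \<in> H" "y \<in> H"
    and comm: "fst y \<circ> fst x = fst x \<circ> fst y"
  shows "\<exists>s\<in>signs. x \<odot> y = s \<odot> (y \<odot> x)"
proof
  interpret H: subgroup H GM by fact
  define v where "v = y \<odot> x"
  define z where "z = x \<odot> y \<odot> inv\<^bsub>GM\<^esub> v"
  have vH: "v \<in> H" unfolding v_def using xy by (rule H.m_closed[OF _ _, rotated])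
  have zH: "z \<in> H" unfolding z_def by (intro H.m_closed H.m_inv_closed vH xy)
  have "fst z = fst (inv\<^bsub>GM\<^esub> v) \<circ> (fst y \<circ> fst x)" by (simp add: z_def)
  also have "\<dots> = fst (inv\<^bsub>GM\<^esub> v) \<circ> fst v" using comm by (simp add: v_def)
  also have "\<dots> = id" by (rule fst_inv(1)) (rule H.mem_carrier[OF vH])
  finally have "z \<in> torus" unfolding torus_def using H.mem_carrier[OF zH] by simp
  then show "z \<in> signs" using H(2) zH by blast
  have "x \<odot> y = z \<odot> v"
    unfolding z_def using H.mem_carrier[OF vH] H.mem_carrier[OF xy(1)] H.mem_carrier[OF xy(2)]
    by (simp only: GM.m_assoc GM.l_inv GM.inv_closed GM.m_closed GM.r_one)
  then show "x \<odot> y = z \<odot> (y \<odot> x)" by (simp only: v_def)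
qed

text \<open>
  Lift the negation of block \<open>j\<close> to the complement, with coefficients \<open>c j\<close>. Its square lies in the torus,
  hence in \<open>{1, -1}\<close>, and is \<open>-1\<close> on block \<open>j\<close>. So it is \<open>-1\<close> everywhere, and on every other block \<open>c j\<close> is a
  square root of \<open>-1\<close>. Equivariance then determines \<open>q ^ ns i\<close> modulo 4. Two such lifts commute up to a
  global sign; but the commutator is \<open>-1\<close> on their own two blocks and 1 on any third one.
\<close>
theorem complement_necessary:
  assumes odd_char: "(1::'a) \<noteq> - 1" and q: "odd q" and m2: "m \<ge> 2" and compl: torus_complemented
  shows "m = 2 \<and> (\<forall>j\<in>{1..m}. q ^ ns j mod 4 = 1 \<longleftrightarrow> k < j)"
proof -
  obtain H where H: "subgroup H GM" "H \<inter> torus = signs"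
    and lift: "\<And>x. x \<in> carrier GM \<Longrightarrow> \<exists>h\<in>H. fst h = fst x"
    by (rule torus_complementedE[OF compl]) blast
  interpret H: subgroup H GM by fact
  have "\<exists>c. (block_neg j, c) \<in> H" if j: "j \<in> {1..m}" for j
  proof -
    obtain c where "(block_neg j, c) \<in> carrier GM" using block_neg_lift[OF j] .
    then show ?thesis using lift by (metis fst_conv prod.collapse)
  qed
  then obtain c where cH: "\<And>j. j \<in> {1..m} \<Longrightarrow> (block_neg j, c j) \<in> H" by metis
  have cG: "(block_neg j, c j) \<in> carrier GM" if "j \<in> {1..m}" for j using cH[OF that] by (rule H.mem_carrier)
  have neg_neg: "block_neg j \<circ> block_neg l = block_neg l \<circ> block_neg j" for j l
    by (auto simp: block_neg_def fun_eq_iff blk_neg neg_closed)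
  have square: "c j i * c j i = - 1" "c j (- i) = - c j i"
    if j: "j \<in> {1..m}" and i: "i \<in> I" "blk i \<noteq> j" for j i
  proof -
    let ?x = "(block_neg j, c j)"
    have "?x \<odot> ?x \<in> H \<inter> torus"
      using cH[OF j] cG[OF j] by (auto simp: torus_def block_neg_def fun_eq_iff blk_neg neg_closed simp del: mult_eq)
    then have "?x \<odot> ?x \<in> signs" using H(2) by blast
    then consider "\<And>i. c j i * c j (block_neg j i) = 1"
      | "\<And>i. c j i * c j (block_neg j i) = (if i \<in> I then - 1 else 1)"
      by (auto simp: signs_def fun_eq_iff)
    moreover have "c j (b j) * c j (- b j) = - 1"
      using cG[OF j] base[OF j] \<beta>_neg \<beta>_nonzero j by (auto simp: carrier_iff block_neg_def blk_base)
    then have "c j (b j) * c j (block_neg j (b j)) \<noteq> 1"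
      using odd_char base[OF j] blk_base[OF j] by (simp add: block_neg_def)
    ultimately have "c j i * c j (block_neg j i) = - 1" using i(1) by metis
    then show sq: "c j i * c j i = - 1" using i by (simp add: block_neg_def)
    have "c j i * c j (- i) = 1"
      using cG[OF j] i \<beta>_nonzero by (auto simp: carrier_iff block_neg_def)
    then have "c j i * (c j (- i) + c j i) = 0" using sq by (simp add: distrib_left)
    moreover have "c j i \<noteq> 0" using cG[OF j] i by (auto simp: carrier_iff)
    ultimately show "c j (- i) = - c j i" by (simp add: eq_neg_iff_add_eq_0)
  qed
  have "m = 2"
  proof (rule ccontr)
    assume "m \<noteq> 2"
    then have j: "1 \<in> {1..m}" "2 \<in> {1..m}" "3 \<in> {1..m}" using m2 by auto
    let ?x = "(block_neg 1, c 1)" and ?y = "(block_neg 2, c 2)"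
    have "\<exists>s\<in>signs. ?x \<odot> ?y = s \<odot> (?y \<odot> ?x)"
      by (rule commute_mod_signs[OF H cH[OF j(1)] cH[OF j(2)]]) (simp only: fst_conv neg_neg[of 1 2])
    then consider "\<And>i. c 1 i * c 2 (block_neg 1 i) = c 2 i * c 1 (block_neg 2 i)"
      | "\<And>i. c 1 i * c 2 (block_neg 1 i) = (if i \<in> I then - 1 else 1) * (c 2 i * c 1 (block_neg 2 i))"
      unfolding signs_def by (auto simp: fun_eq_iff)
    then show False
    proof cases
      case 1
      from 1[of "b 1"] have "c 1 (b 1) * - c 2 (b 1) = c 2 (b 1) * c 1 (b 1)"
        using square(2)[of 2 "b 1"] j base blk_base by (auto simp: block_neg_def)
      moreover have "c 1 (b 1) \<noteq> 0" "c 2 (b 1) \<noteq> 0" using cG base j by (auto simp: carrier_iff)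
      ultimately have "(1::'a) = - 1" by (simp add: mult.commute)
      then show False using odd_char by simp
    next
      case 2
      from 2[of "b 3"] have "c 1 (b 3) * c 2 (b 3) = - (c 2 (b 3) * c 1 (b 3))"
        using j base blk_base by (auto simp: block_neg_def)
      moreover have "c 1 (b 3) \<noteq> 0" "c 2 (b 3) \<noteq> 0" using cG base j by (auto simp: carrier_iff)
      ultimately have "(1::'a) = - 1" by (simp add: mult.commute)
      then show False using odd_char by simp
    qed
  qed
  moreover have "q ^ ns j mod 4 = 1 \<longleftrightarrow> k < j" if j: "j \<in> {1..m}" for j
  proof -
    obtain l where l: "l \<in> {1..m}" "l \<noteq> j" using m2 j by (metis atLeastAtMost_iff le_trans one_le_numeral order_refl le_numeral_extra(4) numeral_eq_one_iff semiring_norm(85))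
    let ?x = "c l (b j)"
    have x: "?x\<^sup>2 = - 1" "c l (- b j) = - ?x"
      using square[OF l(1) base[OF j]] l blk_base[OF j] by (auto simp: power2_eq_square)
    have "?x ^ (q ^ ns j) = c l ((w ^^ ns j) (b j))"
      using frob_w_pow[of "c l" "b j" "ns j"] cG[OF l(1)] base[OF j] by (auto simp: carrier_iff)
    also have "\<dots> = (if k < j then ?x else - ?x)" using closing[OF j] x(2) by simp
    finally have "(if q ^ ns j mod 4 = 1 then ?x else - ?x) = (if k < j then ?x else - ?x)"
      using square_root_pow_mod_4[OF x(1), of "q ^ ns j"] q by simp
    moreover have "?x \<noteq> - ?x"
    proof
      assume "?x = - ?x"
      then have "?x * ?x = - (?x * ?x)" by (metis mult_minus_left)
      then show False using x(1) odd_char by (simp add: power2_eq_square)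
    qed
    ultimately show ?thesis by (auto split: if_splits)
  qed
  ultimately show ?thesis by blast
qed

end

section \<open>Norms and the coefficients of the generators\<close>

text \<open>
  The exponent of the norm from the field with \<open>q ^ n\<close> elements to the field with \<open>q\<close> elements.
\<close>
definition geom :: "nat \<Rightarrow> nat \<Rightarrow> nat" where
  "geom q n = (\<Sum>s<n. q ^ s)"

lemma geom_simps [simp]: "geom q 0 = 0" "geom q (Suc n) = geom q n + q ^ n"
  by (simp_all add: geom_def)

lemma geom_mult: "q * geom q n + 1 = geom q n + q ^ n"
  by (induction n) (auto simp: algebra_simps)

lemma geom_pos: "n \<ge> 1 \<Longrightarrow> q > 0 \<Longrightarrow> geom q n > 0"
  by (cases n) auto

lemma geom_pred: assumes "q \<ge> 1" shows "(q - 1) * geom q n + 1 = q ^ n"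
proof -
  have "q * geom q n = (q - 1) * geom q n + geom q n" using assms by (metis add_mult_distrib le_add_diff_inverse2 mult_1)
  then show ?thesis using geom_mult[of q n] by linarith
qed

context signed_blocks begin

lemma w_pow_commute: "(w ^^ s) ((w ^^ t) i) = (w ^^ t) ((w ^^ s) i)"
  by (metis add.commute comp_apply funpow_add)

lemma w_pow_block: assumes i: "i \<in> I" shows "(w ^^ ns (blk i)) i = cycle_sign (blk i) * i"
proof -
  obtain \<alpha> s where \<alpha>: "\<bar>\<alpha>\<bar> = 1" "i = \<alpha> * (w ^^ s) (b (blk i))" using reach_sign[OF i] .
  let ?j = "blk i"
  have j: "?j \<in> {1..m}" using blk_range[OF i] .
  have "(w ^^ ns ?j) (\<alpha> * (w ^^ s) (b ?j)) = \<alpha> * (w ^^ s) ((w ^^ ns ?j) (b ?j))"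
    using \<alpha>(1) base[OF j] by (simp add: w_pow_sign w_pow_commute[of "ns (blk i)"])
  also have "\<dots> = cycle_sign ?j * (\<alpha> * (w ^^ s) (b ?j))"
    using w_pow_ns[OF j, of 1] base[OF j] by (simp add: w_pow_sign)
  finally show ?thesis using \<alpha>(2) by simp
qed

lemma frob_block:
  fixes f :: "int \<Rightarrow> 'a"
  assumes "\<And>i. i \<in> I \<Longrightarrow> f (w i) = f i ^ q" "i \<in> I"
  shows "f i ^ (q ^ ns (blk i)) = f (cycle_sign (blk i) * i)"
  using frob_w_pow[of f i "ns (blk i)", OF assms] w_pow_block[OF assms(2)] by simp

text \<open>
  A lift of \<open>w\<close> has coefficients \<open>r\<close> with \<open>r i * r (- i) = cocycle i\<close>. The norm of this number is the
  sign of the cycle, since \<open>\<beta> i ^ (q ^ ns j) = \<beta> (cycle_sign j * i)\<close>.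
\<close>
definition cocycle :: "int \<Rightarrow> 'a" where "cocycle i = \<beta> i / \<beta> (w i)"

lemma cocycle_props:
  assumes "i \<in> I"
  shows "cocycle i \<noteq> 0" "cocycle (- i) = cocycle i" "cocycle (w i) = cocycle i ^ q"
    "cocycle i ^ geom q (ns (blk i)) = of_int (cycle_sign (blk i))"
proof -
  let ?n = "ns (blk i)"
  show "cocycle i \<noteq> 0" "cocycle (- i) = cocycle i" "cocycle (w i) = cocycle i ^ q"
    using assms by (auto simp: cocycle_def \<beta>_nonzero \<beta>_neg w_neg neg_closed \<beta>_w power_divide)
  have "cocycle i ^ geom q ?n = \<beta> i ^ geom q ?n / \<beta> i ^ (q * geom q ?n)"
    using assms by (simp add: cocycle_def \<beta>_w power_divide power_mult)
  also have "\<dots> = \<beta> i * \<beta> i ^ geom q ?n / \<beta> i ^ (q * geom q ?n + 1)"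
    using assms by (simp add: \<beta>_nonzero)
  also have "\<dots> = \<beta> i / \<beta> i ^ (q ^ ?n)"
    unfolding geom_mult using assms by (simp add: power_add \<beta>_nonzero)
  also have "\<dots> = \<beta> i / \<beta> (cycle_sign (blk i) * i)" using frob_block[of \<beta>] assms \<beta>_w by simp
  also have "\<dots> = of_int (cycle_sign (blk i))" using assms by (simp add: cycle_sign_def \<beta>_neg \<beta>_nonzero)
  finally show "cocycle i ^ geom q ?n = of_int (cycle_sign (blk i))" .
qed

text \<open>
  With \<open>a = 1\<close> this is the sign in \<open>\<delta> ^ n = (- 1) ^ (n div 2) * (if odd n then \<delta> else 1)\<close> for \<open>\<delta>\<^sup>2 = - 1\<close>.
\<close>
definition norm_sign :: "nat \<Rightarrow> nat \<Rightarrow> 'a" where "norm_sign a n = (- 1) ^ (a * (n div 2))"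

lemma norm_sign_props: "norm_sign a n * norm_sign a n = 1" "norm_sign a n \<noteq> 0" "odd e \<Longrightarrow> norm_sign a n ^ e = norm_sign a n"
    "even e \<Longrightarrow> norm_sign a n ^ e = 1" "1 / norm_sign a n = norm_sign a n"
proof -
  have "norm_sign a n = 1 \<or> norm_sign a n = - 1" by (cases "even (a * (n div 2))") (auto simp: norm_sign_def)
  then show "norm_sign a n * norm_sign a n = 1" "norm_sign a n \<noteq> 0" "odd e \<Longrightarrow> norm_sign a n ^ e = norm_sign a n"
    "even e \<Longrightarrow> norm_sign a n ^ e = 1" "1 / norm_sign a n = norm_sign a n" by auto
qed

text \<open>
  The coefficients of the lifts of \<open>w\<close> (\<open>r\<close>) and of the negation (\<open>u\<close>) on each block. The lifts commute,
  and the \<open>ns j\<close>-th power of the first is the sign \<open>norm_sign\<close> times 1 or, on a negative cycle, times the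
  second lift. For a positive cycle, \<open>r\<close> has this sign as its norm, and the solution of
  \<open>u i ^ (q - 1) = r (- i) / r i\<close> lies in the field with \<open>q ^ ns j\<close> elements because the right hand side
  has norm 1 (Hilbert 90). For a negative cycle, \<open>u\<close> is defined as
  the power of \<open>r\<close>, and the relation \<open>u i * u (- i) = - 1\<close> follows from the norm of \<open>cocycle\<close>. The values
  at the base points depend only on the length, the sign of the cycle and the value of \<open>\<beta>\<close>, which makes
  the coefficients invariant under the exchange of two blocks of the same kind.
\<close>
lemma generator_coefficients:
  assumes q: "odd q" "q > 1"
  obtains r u where
    "\<And>i. i \<in> I \<Longrightarrow> r i \<noteq> 0" "\<And>i. i \<in> I \<Longrightarrow> r (w i) = r i ^ q" "\<And>i. i \<in> I \<Longrightarrow> r i * r (- i) = cocycle i"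
    "\<And>i. i \<in> I \<Longrightarrow> u i \<noteq> 0" "\<And>i. i \<in> I \<Longrightarrow> u (w i) = u i ^ q" "\<And>i. i \<in> I \<Longrightarrow> u i * u (- i) = - 1"
    "\<And>i. i \<in> I \<Longrightarrow> r i * u (w i) = u i * r (- i)"
    "\<And>i. i \<in> I \<Longrightarrow> r i ^ geom q (ns (blk i)) = norm_sign a (ns (blk i)) * (if blk i \<le> k then u i else 1)"
    "\<And>j l. ns j = ns l \<Longrightarrow> (j \<le> k \<longleftrightarrow> l \<le> k) \<Longrightarrow> \<beta> (b j) = \<beta> (b l) \<Longrightarrow> j \<in> {1..m} \<Longrightarrow> l \<in> {1..m} \<Longrightarrow>
       r (b j) = r (b l) \<and> u (b j) = u (b l)"
proof -
  have "\<exists>x::'a. x ^ (q ^ n + 1) = y" for n y by (rule nth_root_exists) simp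
  then obtain R1 :: "nat \<Rightarrow> 'a \<Rightarrow> 'a" where R1: "\<And>n y. R1 n y ^ (q ^ n + 1) = y" by metis
  have "\<exists>x::'a. n \<ge> 1 \<longrightarrow> x ^ geom q n = norm_sign a n" for n
    using nth_root_exists[of "geom q n" "norm_sign a n"] geom_pos[of n q] q by (cases "n \<ge> 1") auto
  then obtain R2 :: "nat \<Rightarrow> 'a" where R2: "\<And>n. n \<ge> 1 \<Longrightarrow> R2 n ^ geom q n = norm_sign a n" by metis
  define R where "R = (\<lambda>n neg y. if neg then R1 n (y / y ^ q) else R2 n)"
  have R: "\<And>n y. R n True y ^ (q ^ n + 1) = y / y ^ q" "\<And>n y. n \<ge> 1 \<Longrightarrow> R n False y ^ geom q n = norm_sign a n"
    unfolding R_def if_True if_False using R1 R2 by blast+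
  define t where "t = (\<lambda>j. R (ns j) (j \<le> k) (\<beta> (b j)))"
  have t_neg: "t j ^ (q ^ ns j + 1) = cocycle (b j)" if "j \<in> {1..m}" "j \<le> k" for j
    using R(1) that by (simp add: t_def cocycle_def \<beta>_w base del: power_Suc)
  have t_pos: "t j ^ geom q (ns j) = norm_sign a (ns j)" if "j \<in> {1..m}" "\<not> j \<le> k" for j
    using R(2) that ns_pos by (simp add: t_def)
  have t0: "t j \<noteq> 0" if j: "j \<in> {1..m}" for j
  proof (cases "j \<le> k")
    case True
    then show ?thesis using t_neg[OF j] cocycle_props(1)[OF base[OF j]] by auto
  next
    case False
    moreover have "geom q (ns j) > 0" using geom_pos ns_pos[OF j] q by simp
    ultimately show ?thesis using t_pos[OF j] norm_sign_props(2) by (metis power_0_left less_irrefl)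
  qed
  have qpow: "x ^ (q ^ n) = x * (x ^ (q - 1)) ^ geom q n" for x :: 'a and n
  proof -
    have "q ^ n = (q - 1) * geom q n + 1" using geom_pred[of q n] q by simp
    then have "x ^ (q ^ n) = x ^ ((q - 1) * geom q n) * x" by (simp only: power_add power_one_right)
    also have "x ^ ((q - 1) * geom q n) = (x ^ (q - 1)) ^ geom q n" by (rule power_mult)
    finally show ?thesis by (simp only: mult.commute)
  qed
  have tq: "t j ^ (q ^ ns j) = (if j \<le> k then cocycle (b j) / t j else t j)" if j: "j \<in> {1..m}" for j
  proof (cases "j \<le> k")
    case True
    then show ?thesis using t_neg[OF j] t0[OF j] by (simp add: field_simps)
  next
    case False
    have "t j ^ (q ^ ns j) = t j * (t j ^ geom q (ns j)) ^ (q - 1)"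
      using qpow[of "t j" "ns j"] by (simp add: power_mult[symmetric] mult.commute)
    also have "\<dots> = t j" using t_pos[OF j False] norm_sign_props(4) q by simp
    finally show ?thesis using False by simp
  qed
  obtain r where r: "\<And>j. j \<in> {1..m} \<Longrightarrow> r (b j) = t j" "\<And>i. i \<in> I \<Longrightarrow> r i \<noteq> 0"
    "\<And>i. i \<in> I \<Longrightarrow> r (w i) = r i ^ q" "\<And>i. i \<in> I \<Longrightarrow> r i * r (- i) = cocycle i"
    by (rule extend_field[of cocycle t]) (use cocycle_props t0 tq in auto)
  have r_neg: "r (- i) = cocycle i / r i" if "i \<in> I" for i
    using r(2,4)[OF that] by (simp add: field_simps)
  have r_pos: "r i ^ geom q (ns (blk i)) = norm_sign a (ns (blk i))" if i: "i \<in> I" and bi: "\<not> blk i \<le> k" for i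
  proof -
    have "\<not> blk i \<le> k \<longrightarrow> r i ^ geom q (ns (blk i)) = norm_sign a (ns (blk i))"
      using i
    proof (induction rule: block_induct)
      case (start j \<alpha>)
      have bj: "b j \<in> I" using base[OF start(1)] .
      have blk: "blk (b j) = j" "blk (\<alpha> * b j) = j" using start bj by (simp_all add: blk_base blk_sign)
      have p: "r (b j) ^ geom q (ns j) = norm_sign a (ns j)" if "\<not> j \<le> k"
        using r(1) t_pos start that by simp
      have "r (- b j) ^ geom q (ns j) = norm_sign a (ns j)" if "\<not> j \<le> k"
        using cocycle_props(4)[OF bj] p[OF that] that blk
        by (simp add: r_neg bj power_divide cycle_sign_def norm_sign_props)
      then show ?case using start(2) p blk by (elim sign_cases) auto
    next
      case (step i)
      show ?case
      proof
        assume "\<not> blk (w i) \<le> k"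
        then have "(r i ^ geom q (ns (blk i))) ^ q = norm_sign a (ns (blk i)) ^ q" using step by (simp add: blk_w)
        then show "r (w i) ^ geom q (ns (blk (w i))) = norm_sign a (ns (blk (w i)))"
          using r(3) step q by (simp add: blk_w norm_sign_props power_mult[symmetric] mult.commute)
      qed
    qed
    then show ?thesis using bi by blast
  qed
  have r_negative: "r i ^ geom q (ns (blk i)) * r (- i) ^ geom q (ns (blk i)) = - 1" if "i \<in> I" "blk i \<le> k" for i
    using cocycle_props(4)[OF that(1)] r(4)[OF that(1)] that by (simp add: cycle_sign_def flip: power_mult_distrib)
  have "\<exists>x::'a. x ^ (q - 1) = y" for y by (rule nth_root_exists) (use q in simp)
  then obtain L :: "'a \<Rightarrow> 'a" where L: "\<And>y. L y ^ (q - 1) = y" by metis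
  define t' where "t' = (\<lambda>j. if j \<le> k then norm_sign a (ns j) * r (b j) ^ geom q (ns j) else L (r (- b j) / r (b j)))"
  have rb: "r (b j) \<noteq> 0" "r (- b j) \<noteq> 0" if "j \<in> {1..m}" for j
    using r(2) base[OF that] neg_closed by auto
  have t'0: "t' j \<noteq> 0" if j: "j \<in> {1..m}" for j
  proof (cases "j \<le> k")
    case True then show ?thesis using rb[OF j] by (simp add: t'_def norm_sign_props)
  next
    case False
    have "q - 1 > 0" using q by simp
    then have "L (r (- b j) / r (b j)) \<noteq> 0" using L[of "r (- b j) / r (b j)"] rb[OF j] by (metis divide_eq_0_iff power_0_left less_irrefl)
    then show ?thesis using False by (simp add: t'_def)
  qed
  have t'q: "t' j ^ (q ^ ns j) = (if j \<le> k then - 1 / t' j else t' j)" if j: "j \<in> {1..m}" for j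
  proof (cases "j \<le> k")
    case True
    have "(r (b j) ^ geom q (ns j)) ^ (q ^ ns j) = (r (b j) ^ (q ^ ns j)) ^ geom q (ns j)"
      by (simp add: power_mult[symmetric] mult.commute)
    also have "\<dots> = r (- b j) ^ geom q (ns j)"
      using frob_block[of r "b j"] r(3) base[OF j] j True by (simp add: blk_base cycle_sign_def)
    finally have "t' j ^ (q ^ ns j) = norm_sign a (ns j) * r (- b j) ^ geom q (ns j)"
      using True q by (simp add: t'_def power_mult_distrib norm_sign_props)
    moreover have "t' j * (norm_sign a (ns j) * r (- b j) ^ geom q (ns j)) = - 1"
    proof -
      have "t' j * (norm_sign a (ns j) * r (- b j) ^ geom q (ns j)) =
        (norm_sign a (ns j) * norm_sign a (ns j)) * (r (b j) ^ geom q (ns j) * r (- b j) ^ geom q (ns j))"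
        using t'_def True by (simp only: if_True mult_ac)
      moreover have "r (b j) ^ geom q (ns j) * r (- b j) ^ geom q (ns j) = - 1"
        using r_negative[OF base[OF j]] j True by (simp add: blk_base)
      ultimately show ?thesis by (simp only: norm_sign_props(1) mult_1)
    qed
    ultimately show ?thesis using True t'0[OF j] by (simp add: field_simps)
  next
    case False
    have "t' j ^ (q ^ ns j) = t' j * (r (- b j) / r (b j)) ^ geom q (ns j)"
      using qpow[of "t' j"] L False by (simp add: t'_def)
    also have "\<dots> = t' j"
      using r_pos[OF base[OF j]] r_pos[OF neg_closed[OF base[OF j]]] False j base[OF j]
      by (simp add: blk_base blk_neg power_divide norm_sign_props)
    finally show ?thesis using False by simp
  qed
  obtain u where u: "\<And>j. j \<in> {1..m} \<Longrightarrow> u (b j) = t' j" "\<And>i. i \<in> I \<Longrightarrow> u i \<noteq> 0"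
    "\<And>i. i \<in> I \<Longrightarrow> u (w i) = u i ^ q" "\<And>i. i \<in> I \<Longrightarrow> u i * u (- i) = - 1"
    by (rule extend_field[of "\<lambda>_. - 1" t']) (use minus_one_pow t'0 t'q in auto)
  have u_neg: "u (- i) = - 1 / u i" if "i \<in> I" for i
    using u(2,4)[OF that] by (simp add: field_simps)
  have u_negative: "u i = norm_sign a (ns (blk i)) * r i ^ geom q (ns (blk i))" if i: "i \<in> I" and bi: "blk i \<le> k" for i
  proof -
    have "blk i \<le> k \<longrightarrow> u i = norm_sign a (ns (blk i)) * r i ^ geom q (ns (blk i))"
      using i
    proof (induction rule: block_induct)
      case (start j \<alpha>)
      have bj: "b j \<in> I" using base[OF start(1)] .
      have blk: "blk (b j) = j" "blk (\<alpha> * b j) = j" using start bj by (simp_all add: blk_base blk_sign)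
      have p: "u (b j) = norm_sign a (ns j) * r (b j) ^ geom q (ns j)" if "j \<le> k"
        using u(1) start that by (simp add: t'_def)
      have "u (- b j) = norm_sign a (ns j) * r (- b j) ^ geom q (ns j)" if "j \<le> k"
      proof -
        have "r (- b j) ^ geom q (ns j) = - 1 / r (b j) ^ geom q (ns j)"
          using r_negative[OF bj] rb[OF start(1)] blk that by (simp add: field_simps)
        moreover have "u (- b j) = - (1 / norm_sign a (ns j)) / r (b j) ^ geom q (ns j)"
          using u_neg[OF bj] p[OF that] by simp
        ultimately show ?thesis by (simp add: norm_sign_props(5))
      qed
      then show ?case using start(2) p blk by (elim sign_cases) auto
    next
      case (step i)
      show ?case
      proof
        assume "blk (w i) \<le> k"
        then have "u (w i) = (norm_sign a (ns (blk i)) * r i ^ geom q (ns (blk i))) ^ q" using step u(3) by (simp add: blk_w)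
        also have "\<dots> = norm_sign a (ns (blk i)) * r (w i) ^ geom q (ns (blk i))"
          using r(3) step q by (simp add: power_mult_distrib norm_sign_props power_mult[symmetric] mult.commute)
        finally show "u (w i) = norm_sign a (ns (blk (w i))) * r (w i) ^ geom q (ns (blk (w i)))"
          using step by (simp add: blk_w)
      qed
    qed
    then show ?thesis using bi by blast
  qed
  have ru: "r i * u (w i) = u i * r (- i)" if i: "i \<in> I" for i
  proof (cases "blk i \<le> k")
    case True
    let ?n = "ns (blk i)"
    have "r i * u (w i) = norm_sign a ?n * (r i ^ (q * geom q ?n + 1))"
      using u(3)[OF i] u_negative[OF i True] q
      by (simp add: power_mult_distrib norm_sign_props power_mult[symmetric] mult_ac)
    also have "\<dots> = norm_sign a ?n * r i ^ geom q ?n * r i ^ (q ^ ?n)"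
      unfolding geom_mult by (simp add: power_add)
    also have "r i ^ (q ^ ?n) = r (- i)" using frob_block[of r i] r(3) i True by (simp add: cycle_sign_def)
    finally show ?thesis using u_negative[OF i True] by simp
  next
    case False
    have "\<not> blk i \<le> k \<longrightarrow> r i * u (w i) = u i * r (- i)"
      using i
    proof (induction rule: block_induct)
      case (start j \<alpha>)
      have bj: "b j \<in> I" using base[OF start(1)] .
      have blk: "blk (b j) = j" "blk (\<alpha> * b j) = j" using start bj by (simp_all add: blk_base blk_sign)
      have qq: "q = Suc (q - 1)" using q by simp
      have p: "r (b j) * u (b j) ^ q = u (b j) * r (- b j)" if "\<not> j \<le> k"
      proof -
        have "u (b j) ^ q = u (b j) * u (b j) ^ (q - 1)" by (subst qq) simp
        also have "\<dots> = u (b j) * (r (- b j) / r (b j))" using u(1)[OF start(1)] L that by (simp add: t'_def)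
        finally show ?thesis using rb[OF start(1)] by simp
      qed
      have "r (- b j) * u (- b j) ^ q = u (- b j) * r (b j)" if "\<not> j \<le> k"
      proof -
        let ?A = "u (b j)" and ?B = "u (- b j)"
        have AB: "?A * ?B = - 1" using u(4)[OF bj] .
        have "(r (- b j) * ?B ^ q) * (?A * ?A ^ q) = (r (- b j) * ?A) * (?A * ?B) ^ q"
          by (simp only: power_mult_distrib mult_ac)
        also have "\<dots> = - (r (b j) * ?A ^ q)" using p[OF that] minus_one_pow by (simp add: AB mult.commute)
        also have "\<dots> = (?A * ?B) * (r (b j) * ?A ^ q)" by (simp add: AB)
        also have "\<dots> = (?B * r (b j)) * (?A * ?A ^ q)" by (simp only: mult_ac)
        finally show ?thesis using u(2)[OF bj] by simp
      qed
      then show ?case using start(2) p blk bj u(3) neg_closed by (elim sign_cases) auto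
    next
      case (step i)
      show ?case
      proof
        assume "\<not> blk (w i) \<le> k"
        then have "(r i * u (w i)) ^ q = (u i * r (- i)) ^ q" using step by (simp add: blk_w)
        then show "r (w i) * u (w (w i)) = u (w i) * r (- w i)"
          using step u(3) r(3) neg_closed by (simp add: power_mult_distrib flip: w_neg)
      qed
    qed
    then show ?thesis using False by blast
  qed
  have rn: "r i ^ geom q (ns (blk i)) = norm_sign a (ns (blk i)) * (if blk i \<le> k then u i else 1)" if "i \<in> I" for i
    using u_negative[OF that] r_pos[OF that] norm_sign_props(1)[of a "ns (blk i)"] by (auto simp: mult.assoc[symmetric])
  show thesis
  proof (rule that[of r u])
    fix j l assume *: "ns j = ns l" "j \<le> k \<longleftrightarrow> l \<le> k" "\<beta> (b j) = \<beta> (b l)" "j \<in> {1..m}" "l \<in> {1..m}"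
    have "r (b j) = r (b l)" using * r(1) by (simp add: t_def)
    moreover have "r (- b j) = r (- b l)"
      using * r_neg base calculation by (simp add: cocycle_def \<beta>_w)
    ultimately show "r (b j) = r (b l) \<and> u (b j) = u (b l)" using * u(1) by (simp add: t'_def)
  qed (use r u ru rn in auto)
qed

end

section \<open>The subgroup generated by lifts\<close>

context frobenius_twist begin

lemma fst_pow: "fst (x [^]\<^bsub>GM\<^esub> (e::nat)) = fst x ^^ e"
  by (induction e) (simp_all add: one_eq)

definition sign_elem :: "'a \<Rightarrow> (int \<Rightarrow> int) \<times> (int \<Rightarrow> 'a)" where
  "sign_elem \<sigma> = (id, \<lambda>i. if i \<in> I then \<sigma> else 1)"

lemma sign_elem_signs: "\<sigma> = 1 \<or> \<sigma> = - 1 \<Longrightarrow> sign_elem \<sigma> \<in> signs"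
  by (auto simp: sign_elem_def signs_def)

lemma signs_cases: "s \<in> signs \<Longrightarrow> \<exists>\<sigma>. (\<sigma> = 1 \<or> \<sigma> = - 1) \<and> s = sign_elem \<sigma>"
  by (auto simp: sign_elem_def signs_def)

lemma signs_carrier: "s \<in> signs \<Longrightarrow> s \<in> carrier GM"
  using subgroup.mem_carrier[OF signs_subgroup] .

lemma signs_central: assumes "s \<in> signs" "x \<in> carrier GM" shows "x \<odot> s \<odot> inv\<^bsub>GM\<^esub> x = s"
proof -
  have "x \<odot> s = s \<odot> x"
  proof -
    obtain v c where x: "x = (v, c)" by (cases x)
    then have "v i \<in> I \<longleftrightarrow> i \<in> I" for i using fst_permutes[OF assms(2)] permutes_in_image by fastforce
    then show ?thesis using signs_cases[OF assms(1)] x by (auto simp: sign_elem_def fun_eq_iff)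
  qed
  then show ?thesis using assms signs_carrier by (simp add: GM.m_assoc del: mult_eq)
qed

lemma conj_mod_signs:
  assumes "x \<in> carrier GM" "y \<in> carrier GM" "s \<in> signs" "x \<odot> y = s \<odot> (y \<odot> x)"
    and "subgroup A GM" "signs \<subseteq> A" "y \<in> A"
  shows "x \<odot> y \<odot> inv\<^bsub>GM\<^esub> x \<in> A"
proof -
  have "x \<odot> y \<odot> inv\<^bsub>GM\<^esub> x = s \<odot> y"
    using assms(1-3) signs_carrier by (simp add: assms(4) GM.m_assoc del: mult_eq)
  also have "\<dots> \<in> A" using assms(3,6,7) subgroup.m_closed[OF assms(5)] by blast
  finally show ?thesis .
qed

end

lemma permutes_mutual_inverse:
  assumes "\<And>i. v (v' i) = i" "\<And>i. v' (v i) = i" "\<And>i. i \<notin> I \<Longrightarrow> v i = i"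
  shows "v permutes I"
  unfolding permutes_def using assms by metis

context signed_blocks begin

definition block_w :: "nat \<Rightarrow> int \<Rightarrow> int" where
  "block_w j = (\<lambda>i. if i \<in> I \<and> blk i = j then w i else i)"

lemma block_w_permutes: "block_w j permutes I"
proof -
  define w' where "w' = inv_into UNIV w"
  have w': "w (w' i) = i" "w' (w i) = i" for i
    using w_permutes by (auto simp: w'_def permutes_inverses)
  have "w' i \<in> I \<longleftrightarrow> i \<in> I" for i using w_closed[of "w' i"] w' by simp
  moreover have "blk (w' i) = blk i" if "i \<in> I" for i using blk_w[of "w' i"] w' w_closed[of "w' i"] that by simp
  ultimately show ?thesis
    by (intro permutes_mutual_inverse[of _ "\<lambda>i. if i \<in> I \<and> blk i = j then w' i else i"])
      (auto simp: block_w_def w' blk_w)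
qed

lemma block_w_pow: "(block_w j ^^ e) i = (if i \<in> I \<and> blk i = j then (w ^^ e) i else i)"
  by (induction e) (auto simp: block_w_def blk_w_pow)

lemma block_neg_pow: "(block_neg j ^^ e) i = (if i \<in> I \<and> blk i = j then (- 1) ^ e * i else i)"
proof (induction e)
  case (Suc e)
  have "\<bar>(- 1 :: int) ^ e\<bar> = 1" by (simp add: power_abs)
  then show ?case using Suc blk_sign[of "(- 1) ^ e" i] sign_closed[of "(- 1) ^ e" i] by (auto simp: block_neg_def)
qed simp

lemma fst_determined:
  assumes "x \<in> carrier GM" "y \<in> carrier GM" "\<And>j. j \<in> {1..m} \<Longrightarrow> fst x (b j) = fst y (b j)"
  shows "fst x = fst y"
proof
  fix i
  obtain v c where x: "x = (v, c)" by (cases x)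
  obtain u d where y: "y = (u, d)" by (cases y)
  have "v i = u i"
  proof (cases "i \<in> I")
    case True
    then show ?thesis
    proof (induction rule: block_induct)
      case (start j \<alpha>)
      then show ?case using assms(1,2) assms(3)[of j] base[of j] x y
        by (elim sign_cases) (auto simp: carrier_iff)
    next
      case (step i)
      then show ?case using assms(1,2) x y by (auto simp: carrier_iff)
    qed
  next
    case False
    have "v permutes I" "u permutes I" using assms(1,2) x y by (simp_all add: carrier_iff)
    then show ?thesis using False by (simp add: permutes_not_in)
  qed
  then show "fst x i = fst y i" using x y by simp
qed

end

text \<open>
  On its own block, a generator has coefficients \<open>u\<close> or \<open>r\<close>; on the other block it is the diagonal matrix
  of \<open>\<delta>\<close> or \<open>\<delta> ^ a\<close>, where \<open>\<delta>\<close> is an equivariant square root of \<open>-1\<close>. The factor \<open>\<delta>\<close> makes the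
  squares of the lifts of the negation, and all commutators, scalar. The exponent \<open>a\<close> records whether \<open>\<delta>\<close> changes its sign under \<open>w\<close>, that is,
  whether \<open>q mod 4 = 3\<close>; then a lift of \<open>w\<close> on one block has to be corrected on the other one too. With a
  single block there is nothing to correct and \<open>\<delta>\<close> is arbitrary.
\<close>
locale block_generators = signed_blocks I w q \<beta> k m ns b blk
  for I :: "int set" and w :: "int \<Rightarrow> int" and q :: nat and \<beta> :: "int \<Rightarrow> 'a::alg_closed_field"
    and k m :: nat and ns :: "nat \<Rightarrow> nat" and b :: "nat \<Rightarrow> int" and blk :: "int \<Rightarrow> nat" +
  fixes r u \<delta> :: "int \<Rightarrow> 'a" and a :: nat
  assumes r_nonzero: "i \<in> I \<Longrightarrow> r i \<noteq> 0" and r_w: "i \<in> I \<Longrightarrow> r (w i) = r i ^ q"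
    and r_neg: "i \<in> I \<Longrightarrow> r i * r (- i) = cocycle i"
    and u_nonzero: "i \<in> I \<Longrightarrow> u i \<noteq> 0" and u_w: "i \<in> I \<Longrightarrow> u (w i) = u i ^ q"
    and u_neg: "i \<in> I \<Longrightarrow> u i * u (- i) = - 1"
    and r_u: "i \<in> I \<Longrightarrow> r i * u (w i) = u i * r (- i)"
    and r_norm: "i \<in> I \<Longrightarrow> r i ^ geom q (ns (blk i)) = norm_sign a (ns (blk i)) * (if blk i \<le> k then u i else 1)"
    and a_le: "a \<le> 1" and m_le: "m \<le> 2"
    and \<delta>_nonzero: "i \<in> I \<Longrightarrow> \<delta> i \<noteq> 0" and \<delta>_w: "i \<in> I \<Longrightarrow> \<delta> (w i) = \<delta> i ^ q"
    and \<delta>_a: "m = 2 \<Longrightarrow> i \<in> I \<Longrightarrow> \<delta> (w i) = (- 1) ^ a * \<delta> i"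
    and \<delta>_neg: "m = 2 \<Longrightarrow> i \<in> I \<Longrightarrow> \<delta> (- i) = - \<delta> i"
    and \<delta>_square: "m = 2 \<Longrightarrow> i \<in> I \<Longrightarrow> \<delta> i * \<delta> i = - 1"
    and \<delta>_norm: "m = 2 \<Longrightarrow> i \<in> I \<Longrightarrow> j \<in> {1..m} \<Longrightarrow>
      \<delta> i ^ (a * ns j) = norm_sign a (ns j) * (if j \<le> k then \<delta> i else 1)"
begin

lemma two_blocks: "j \<in> {1..m} \<Longrightarrow> i \<in> I \<Longrightarrow> blk i \<noteq> j \<Longrightarrow> m = 2"
  using blk_range[of i] m_le by auto

definition flip_gen where
  "flip_gen j = (block_neg j, \<lambda>i. if i \<in> I then if blk i = j then u i else \<delta> i else 1)"

definition shift_gen where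
  "shift_gen j = (block_w j, \<lambda>i. if i \<in> I then if blk i = j then r i else \<delta> i ^ a else 1)"

lemma \<delta>_unit: "m = 2 \<Longrightarrow> i \<in> I \<Longrightarrow> \<delta> i * \<delta> (- i) = 1"
  using \<delta>_neg \<delta>_square by simp

lemma flip_gen_carrier: "j \<in> {1..m} \<Longrightarrow> flip_gen j \<in> carrier GM"
  unfolding flip_gen_def carrier_iff
  using block_neg_permutes u_nonzero u_w u_neg \<delta>_nonzero \<delta>_w \<delta>_unit two_blocks \<beta>_nonzero \<beta>_neg
  by (auto simp: neg_closed blk_neg blk_w block_neg_def w_neg)

lemma shift_gen_carrier: "j \<in> {1..m} \<Longrightarrow> shift_gen j \<in> carrier GM"
  unfolding shift_gen_def carrier_iff
  using block_w_permutes r_nonzero r_w r_neg \<delta>_nonzero \<delta>_w two_blocks \<beta>_nonzero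
    power_mult_distrib[of "\<delta> _" "\<delta> (- _)" a, symmetric] \<delta>_unit
  by (auto simp: neg_closed blk_neg blk_w block_w_def w_neg cocycle_def mult.commute simp flip: power_mult)

lemma shift_gen_pow:
  "j \<in> {1..m} \<Longrightarrow> shift_gen j [^]\<^bsub>GM\<^esub> (e::nat) =
     (block_w j ^^ e, \<lambda>i. if i \<in> I then if blk i = j then r i ^ geom q e else \<delta> i ^ (a * e) else 1)"
proof (induction e)
  case 0
  then show ?case by (auto simp: one_eq fun_eq_iff)
next
  case (Suc e)
  have "r i ^ geom q e * r ((w ^^ e) i) = r i ^ geom q (Suc e)" if "i \<in> I" for i
    using frob_w_pow[of r, OF r_w that] by (simp add: power_add)
  then show ?case using Suc
    by (auto simp: shift_gen_def fun_eq_iff block_w_pow blk_w_pow power_add[symmetric] add.commute)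
qed

lemma flip_gen_square: assumes "j \<in> {1..m}" shows "flip_gen j [^]\<^bsub>GM\<^esub> (2::nat) \<in> signs"
proof -
  have "flip_gen j [^]\<^bsub>GM\<^esub> (2::nat) = flip_gen j \<odot> flip_gen j"
    using flip_gen_carrier[OF assms] by (simp add: numeral_2_eq_2)
  also have "\<dots> = sign_elem (- 1)"
    using assms u_neg \<delta>_square two_blocks[OF assms]
    by (auto simp: flip_gen_def sign_elem_def fun_eq_iff block_neg_def blk_neg neg_closed)
  finally show ?thesis by (simp add: sign_elem_signs)
qed

lemma norm_sign_cases: "norm_sign a n = 1 \<or> norm_sign a n = - 1"
  by (cases "even (a * (n div 2))") (auto simp: norm_sign_def)

text \<open>
  This is where the sign of \<open>\<delta> ^ (a * ns j)\<close> on the other block has to agree with the norm of \<open>r\<close>.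
\<close>
lemma shift_gen_power_ns:
  assumes j: "j \<in> {1..m}"
  shows "shift_gen j [^]\<^bsub>GM\<^esub> ns j = sign_elem (norm_sign a (ns j)) \<odot> (if j \<le> k then flip_gen j else \<one>\<^bsub>GM\<^esub>)"
proof -
  have "(block_w j ^^ ns j) i = (if j \<le> k then block_neg j else id) i" for i
    using w_pow_block[of i] by (auto simp: block_w_pow block_neg_def cycle_sign_def)
  then have "block_w j ^^ ns j = (if j \<le> k then block_neg j else id)" by (auto simp: fun_eq_iff)
  moreover have "(if blk i = j then r i ^ geom q (ns j) else \<delta> i ^ (a * ns j)) =
      norm_sign a (ns j) * (if j \<le> k then (if blk i = j then u i else \<delta> i) else 1)" if i: "i \<in> I" for i
    using r_norm[OF i] \<delta>_norm[OF _ i j] two_blocks[OF j i] by auto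
  ultimately show ?thesis
    unfolding shift_gen_pow[OF j] by (auto simp: sign_elem_def flip_gen_def one_eq fun_eq_iff)
qed

lemma commute_same: "j \<in> {1..m} \<Longrightarrow> shift_gen j \<odot> flip_gen j = flip_gen j \<odot> shift_gen j"
  using r_u two_blocks
  by (auto simp: flip_gen_def shift_gen_def fun_eq_iff block_neg_def block_w_def blk_neg blk_w neg_closed w_neg mult.commute)

text \<open>
  On each of the two blocks, one factor is a lift of the negation and the other is \<open>\<delta>\<close>, which the negation
  turns into \<open>- \<delta>\<close>. So the sign is the same on both blocks; likewise for the other pairs of generators.
\<close>
lemma commute_xx:
  assumes "j \<in> {1..m}" "l \<in> {1..m}" "j \<noteq> l"
  shows "flip_gen j \<odot> flip_gen l = sign_elem (- 1) \<odot> (flip_gen l \<odot> flip_gen j)"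
proof -
  have m: "m = 2" using assms m_le by auto
  have "blk i = j \<or> blk i = l" if "i \<in> I" for i using blk_range[OF that] assms m by auto
  then show ?thesis using assms \<delta>_neg[OF m]
    by (auto simp: flip_gen_def sign_elem_def fun_eq_iff block_neg_def blk_neg neg_closed)
qed

lemma commute_xp:
  assumes "j \<in> {1..m}" "l \<in> {1..m}" "j \<noteq> l"
  shows "flip_gen j \<odot> shift_gen l = sign_elem ((- 1) ^ a) \<odot> (shift_gen l \<odot> flip_gen j)"
proof -
  have m: "m = 2" using assms m_le by auto
  have *: "blk i = j \<or> blk i = l" if "i \<in> I" for i using blk_range[OF that] assms m by auto
  have "a = 0 \<or> a = 1" using a_le by auto
  then show ?thesis using assms \<delta>_neg[OF m] \<delta>_a[OF m] *
    by (auto simp: flip_gen_def shift_gen_def sign_elem_def fun_eq_iff block_neg_def block_w_def blk_neg blk_w neg_closed)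
qed

lemma commute_pp:
  assumes "j \<in> {1..m}" "l \<in> {1..m}" "j \<noteq> l"
  shows "shift_gen j \<odot> shift_gen l = sign_elem ((- 1) ^ a) \<odot> (shift_gen l \<odot> shift_gen j)"
proof -
  have m: "m = 2" using assms m_le by auto
  have *: "blk i = j \<or> blk i = l" if "i \<in> I" for i using blk_range[OF that] assms m by auto
  have "a = 0 \<or> a = 1" using a_le by auto
  then show ?thesis using assms \<delta>_a[OF m] *
    by (auto simp: shift_gen_def sign_elem_def fun_eq_iff block_w_def blk_w)
qed

text \<open>
  Two steps of \<open>adjoin_inter\<close>. The permutations of the elements of \<open>A\<close> fix block \<open>j\<close>, and on this block
  the negation has order 2, and \<open>w\<close> has order \<open>ns j\<close> modulo signs. These are the orders of the generators
  modulo the previous subgroup.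
\<close>
lemma adjoin_block:
  assumes j: "j \<in> {1..m}" and A: "subgroup A GM" "signs \<subseteq> A" "A \<inter> torus \<subseteq> signs"
    and conjx: "\<And>y. y \<in> A \<Longrightarrow> flip_gen j \<odot> y \<odot> inv\<^bsub>GM\<^esub> flip_gen j \<in> A"
    and conjp: "\<And>y. y \<in> A \<Longrightarrow> shift_gen j \<odot> y \<odot> inv\<^bsub>GM\<^esub> shift_gen j \<in> A"
    and triv: "\<And>y i. y \<in> A \<Longrightarrow> i \<in> I \<Longrightarrow> blk i = j \<Longrightarrow> fst y i = i"
  shows "subgroup (adjoin GM (adjoin GM A (flip_gen j)) (shift_gen j)) GM"
    and "adjoin GM (adjoin GM A (flip_gen j)) (shift_gen j) \<inter> torus \<subseteq> signs"
proof -
  let ?x = "flip_gen j" and ?p = "shift_gen j"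
  let ?B = "adjoin GM A ?x"
  have xG: "?x \<in> carrier GM" and pG: "?p \<in> carrier GM" using j by (rule flip_gen_carrier, rule shift_gen_carrier)
  have bj: "b j \<in> I" "blk (b j) = j" using j base blk_base by auto
  have x2: "?x [^]\<^bsub>GM\<^esub> (2::nat) \<in> A" using flip_gen_square[OF j] A(2) by blast
  have B: "subgroup ?B GM" by (rule GM.subgroup_adjoin[OF A(1) xG conjx _ x2]) auto
  have incl: "A \<subseteq> ?B" "?x \<in> ?B" using GM.adjoin_incl[OF A(1) xG] by auto
  have BT: "?B \<inter> torus \<subseteq> signs"
  proof (rule GM.adjoin_inter[OF A(1) x2 xG A(3)])
    fix y and e :: nat
    assume y: "y \<in> A" and T: "y \<odot> ?x [^]\<^bsub>GM\<^esub> e \<in> torus"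
    then have "(block_neg j ^^ e) (fst y (b j)) = b j"
      by (simp add: torus_def fst_pow flip_gen_def fun_eq_iff)
    then have "(- 1) ^ e * b j = b j" using triv[OF y bj] bj by (simp add: block_neg_pow)
    then show "2 dvd e" using base_nonzero[OF j] by (cases "even e") auto
  qed
  have conjB: "?p \<odot> y \<odot> inv\<^bsub>GM\<^esub> ?p \<in> ?B" if "y \<in> ?B" for y
  proof (rule GM.conj_adjoin[OF pG _ xG B _ _ that])
    show "A \<subseteq> carrier GM" using A(1) by (rule subgroup.subset)
    show "?p \<odot> z \<odot> inv\<^bsub>GM\<^esub> ?p \<in> ?B" if "z \<in> A" for z using conjp[OF that] incl by blast
    have "?p \<odot> ?x \<odot> inv\<^bsub>GM\<^esub> ?p = ?x"
      unfolding commute_same[OF j] using xG pG by (simp only: GM.m_assoc GM.r_inv GM.inv_closed GM.r_one)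
    then show "?p \<odot> ?x \<odot> inv\<^bsub>GM\<^esub> ?p \<in> ?B" using incl by simp
  qed
  have pn: "?p [^]\<^bsub>GM\<^esub> ns j \<in> ?B"
  proof -
    have "sign_elem (norm_sign a (ns j)) \<in> ?B" using sign_elem_signs[OF norm_sign_cases] A(2) incl by blast
    moreover have "(if j \<le> k then ?x else \<one>\<^bsub>GM\<^esub>) \<in> ?B" using incl subgroup.one_closed[OF B] by simp
    ultimately show ?thesis unfolding shift_gen_power_ns[OF j] by (rule subgroup.m_closed[OF B])
  qed
  show "subgroup (adjoin GM ?B ?p) GM"
    by (rule GM.subgroup_adjoin[OF B pG conjB _ pn]) (use ns_pos[OF j] in auto)
  show "adjoin GM ?B ?p \<inter> torus \<subseteq> signs"
  proof (rule GM.adjoin_inter[OF B pn pG BT])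
    fix y and e :: nat
    assume y: "y \<in> ?B" and T: "y \<odot> ?p [^]\<^bsub>GM\<^esub> e \<in> torus"
    obtain y' and e' :: nat where y': "y' \<in> A" "y = y' \<odot> ?x [^]\<^bsub>GM\<^esub> e'"
      using y by (auto simp: adjoin_def)
    have sg: "\<bar>(- 1 :: int) ^ e'\<bar> = 1" by (simp add: power_abs)
    have "fst y (b j) = (block_neg j ^^ e') (fst y' (b j))"
      by (simp add: y' fst_pow flip_gen_def)
    then have fy: "fst y (b j) = (- 1) ^ e' * b j" using triv[OF y'(1) bj] bj by (simp add: block_neg_pow)
    have "(block_w j ^^ e) (fst y (b j)) = b j"
      using T by (simp add: torus_def fst_pow shift_gen_def fun_eq_iff)
    then have "(w ^^ e) ((- 1) ^ e' * b j) = b j"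
      using bj sg by (simp add: fy block_w_pow sign_closed blk_sign)
    then have "(- 1) ^ e' * ((- 1) ^ e' * (w ^^ e) (b j)) = (- 1) ^ e' * b j"
      using bj sg by (simp add: w_pow_sign)
    then have "(w ^^ e) (b j) = (- 1) ^ e' * b j" by (simp add: mult.assoc[symmetric] flip: power_mult_distrib)
    then show "ns j dvd e" using period[OF j sg] by (metis dvd_triv_left)
  qed
qed

definition block_group :: "nat \<Rightarrow> ((int \<Rightarrow> int) \<times> (int \<Rightarrow> 'a)) set" where
  "block_group = rec_nat signs (\<lambda>j A. adjoin GM (adjoin GM A (flip_gen (Suc j))) (shift_gen (Suc j)))"

lemma block_group_simps [simp]:
  "block_group 0 = signs"
  "block_group (Suc j) = adjoin GM (adjoin GM (block_group j) (flip_gen (Suc j))) (shift_gen (Suc j))"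
  by (simp_all add: block_group_def)

lemma fst_gens:
  "fst (flip_gen j) = block_neg j" "fst (shift_gen j) = block_w j"
  by (simp_all add: flip_gen_def shift_gen_def)

lemma block_group_Suc_cases:
  assumes "y \<in> block_group (Suc j)"
  obtains z and e f :: nat where "z \<in> block_group j"
    "y = z \<odot> flip_gen (Suc j) [^]\<^bsub>GM\<^esub> e \<odot> shift_gen (Suc j) [^]\<^bsub>GM\<^esub> f"
  using assms by (auto simp: adjoin_def)

lemma block_group_fst:
  assumes "y \<in> block_group l" "i \<in> I"
  shows "fst y i \<in> I \<and> blk (fst y i) = blk i \<and> (l < blk i \<longrightarrow> fst y i = i)"
  using assms
proof (induction l arbitrary: y i)
  case 0
  then show ?case by (auto simp: signs_def)
next
  case (Suc l)
  obtain z and e f :: nat where z: "z \<in> block_group l"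
    "y = z \<odot> flip_gen (Suc l) [^]\<^bsub>GM\<^esub> e \<odot> shift_gen (Suc l) [^]\<^bsub>GM\<^esub> f"
    using block_group_Suc_cases[OF Suc.prems(1)] .
  have "fst y i = (block_w (Suc l) ^^ f) ((block_neg (Suc l) ^^ e) (fst z i))"
    by (simp add: z(2) fst_pow fst_gens)
  moreover have "\<bar>(- 1 :: int) ^ e\<bar> = 1" by (simp add: power_abs)
  ultimately show ?case using Suc.IH[OF z(1) Suc.prems(2)] Suc.prems(2)
    by (auto simp: block_w_pow block_neg_pow blk_sign sign_closed blk_w_pow)
qed

lemma adjoin_carrier: "A \<subseteq> carrier GM \<Longrightarrow> y \<in> carrier GM \<Longrightarrow> adjoin GM A y \<subseteq> carrier GM"
  by (auto simp: adjoin_def simp del: mult_eq)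

lemma block_group_carrier: "l \<le> m \<Longrightarrow> block_group l \<subseteq> carrier GM"
proof (induction l)
  case 0
  then show ?case using signs_carrier by auto
next
  case (Suc l)
  then show ?case unfolding block_group_simps
    by (intro adjoin_carrier flip_gen_carrier shift_gen_carrier) auto
qed

lemma conj_block_group:
  assumes g: "g \<in> carrier GM" and A: "subgroup A GM" "signs \<subseteq> A" and l: "l \<le> m"
    and gens: "\<And>i. i \<in> {1..l} \<Longrightarrow> g \<odot> flip_gen i \<odot> inv\<^bsub>GM\<^esub> g \<in> A \<and> g \<odot> shift_gen i \<odot> inv\<^bsub>GM\<^esub> g \<in> A"
    and y: "y \<in> block_group l"
  shows "g \<odot> y \<odot> inv\<^bsub>GM\<^esub> g \<in> A"
  using l gens y
proof (induction l arbitrary: y)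
  case 0
  then show ?case using signs_central[OF _ g] A(2) by (auto simp del: mult_eq)
next
  case (Suc i)
  have im: "Suc i \<in> {1..m}" "Suc i \<in> {1..Suc i}" using Suc.prems(1) by auto
  have sub: "block_group i \<subseteq> carrier GM" "adjoin GM (block_group i) (flip_gen (Suc i)) \<subseteq> carrier GM"
    using block_group_carrier[of i] adjoin_carrier flip_gen_carrier[OF im(1)] im by auto
  have IH: "g \<odot> z \<odot> inv\<^bsub>GM\<^esub> g \<in> A" if "z \<in> block_group i" for z
    by (rule Suc.IH) (use Suc.prems(1,2) that in auto)
  show ?case
    by (rule GM.conj_adjoin[OF g sub(2) shift_gen_carrier[OF im(1)] A(1) _ _ Suc.prems(3)[unfolded block_group_simps]],
        rule GM.conj_adjoin[OF g sub(1) flip_gen_carrier[OF im(1)] A(1)])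
      (use IH Suc.prems(2)[OF im(2)] in \<open>auto simp del: mult_eq\<close>)
qed

lemma block_group_subgroup:
  assumes "l \<le> m"
  shows "subgroup (block_group l) GM \<and> signs \<subseteq> block_group l \<and> block_group l \<inter> torus \<subseteq> signs \<and>
    (\<forall>j\<in>{1..l}. flip_gen j \<in> block_group l \<and> shift_gen j \<in> block_group l)"
  using assms
proof (induction l)
  case 0
  then show ?case using signs_subgroup by auto
next
  case (Suc l)
  then have IH: "subgroup (block_group l) GM" "signs \<subseteq> block_group l" "block_group l \<inter> torus \<subseteq> signs"
    "\<And>j. j \<in> {1..l} \<Longrightarrow> flip_gen j \<in> block_group l \<and> shift_gen j \<in> block_group l" by auto
  let ?j = "Suc l"
  have j: "?j \<in> {1..m}" using Suc.prems by simp
  have conj_gen: "g \<odot> y \<odot> inv\<^bsub>GM\<^esub> g \<in> block_group l"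
    if g: "g = flip_gen ?j \<or> g = shift_gen ?j" and y: "y = flip_gen i \<or> y = shift_gen i" and i: "i \<in> {1..l}" for g y i
  proof -
    have im: "i \<in> {1..m}" "i \<noteq> ?j" using i Suc.prems by auto
    have "(- 1 :: 'a) ^ a = 1 \<or> (- 1 :: 'a) ^ a = - 1" by (cases "even a") auto
    then have sg: "sign_elem ((- 1) ^ a) \<in> signs" "sign_elem (- 1) \<in> signs" by (auto intro: sign_elem_signs)
    have inv_sign: "sign_elem \<sigma> \<odot> (sign_elem \<sigma> \<odot> z) = z" if "\<sigma> * \<sigma> = 1" for z and \<sigma> :: 'a
      using that by (cases z) (auto simp: sign_elem_def fun_eq_iff mult.assoc[symmetric])
    have aa: "(- 1 :: 'a) ^ a * (- 1) ^ a = 1" by (cases "even a") auto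
    have "\<exists>s\<in>signs. g \<odot> y = s \<odot> (y \<odot> g)"
      using g y commute_xx[OF j im(1) im(2)[symmetric]] commute_xp[OF j im(1) im(2)[symmetric]]
        commute_pp[OF j im(1) im(2)[symmetric]]
        commute_xp[OF im(1) j im(2)] inv_sign[OF aa, of "shift_gen ?j \<odot> flip_gen i"] sg
      by metis
    moreover have "g \<in> carrier GM" "y \<in> carrier GM" "y \<in> block_group l"
      using g y flip_gen_carrier shift_gen_carrier j im IH(4)[OF i] by auto
    ultimately show ?thesis using conj_mod_signs IH(1,2) by blast
  qed
  have conj: "g \<odot> y \<odot> inv\<^bsub>GM\<^esub> g \<in> block_group l"
    if g: "g = flip_gen ?j \<or> g = shift_gen ?j" and y: "y \<in> block_group l" for g y
  proof (rule conj_block_group[OF _ IH(1,2) _ _ y])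
    show "g \<in> carrier GM" using g flip_gen_carrier shift_gen_carrier j by auto
    show "l \<le> m" using Suc.prems by simp
    show "g \<odot> flip_gen i \<odot> inv\<^bsub>GM\<^esub> g \<in> block_group l \<and> g \<odot> shift_gen i \<odot> inv\<^bsub>GM\<^esub> g \<in> block_group l"
      if "i \<in> {1..l}" for i using conj_gen[OF g _ that] by blast
  qed
  have triv: "fst y i = i" if "y \<in> block_group l" "i \<in> I" "blk i = ?j" for y i
    using block_group_fst[OF that(1,2)] that(3) by simp
  have sub': "subgroup (block_group (Suc l)) GM" "block_group (Suc l) \<inter> torus \<subseteq> signs"
    unfolding block_group_simps
    using adjoin_block[OF j IH(1-3)] conj triv by blast+
  have "subgroup (adjoin GM (block_group l) (flip_gen ?j)) GM"
    by (rule GM.subgroup_adjoin[OF IH(1) flip_gen_carrier[OF j], of 2])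
      (use conj flip_gen_square[OF j] IH(2) in auto)
  then have incl: "block_group l \<subseteq> block_group ?j" "flip_gen ?j \<in> block_group ?j" "shift_gen ?j \<in> block_group ?j"
    using GM.adjoin_incl[OF IH(1) flip_gen_carrier[OF j]] GM.adjoin_incl[OF _ shift_gen_carrier[OF j]] by auto
  have "flip_gen i \<in> block_group ?j \<and> shift_gen i \<in> block_group ?j" if "i \<in> {1..?j}" for i
    using that incl IH(4)[of i] by (cases "i = ?j") auto
  then show ?case using sub' incl IH(2) by blast
qed

end

section \<open>Existence of complements\<close>

context block_generators begin

lemma generator_reaching:
  assumes j: "j \<in> {1..m}" and i: "i \<in> I" "blk i = j"
  obtains e f :: nat where "\<And>y. fst (y \<odot> flip_gen j [^]\<^bsub>GM\<^esub> e \<odot> shift_gen j [^]\<^bsub>GM\<^esub> f) =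
      (block_w j ^^ f) \<circ> (block_neg j ^^ e) \<circ> fst y"
    and "(block_w j ^^ f) ((block_neg j ^^ e) (b j)) = i"
proof -
  obtain \<alpha> s where \<alpha>: "\<bar>\<alpha>\<bar> = 1" "i = \<alpha> * (w ^^ s) (b j)" using reach_sign[OF i(1)] i(2) by blast
  obtain e :: nat where e: "\<alpha> = (- 1) ^ e"
    using \<alpha>(1) by (elim sign_cases) (auto intro: that[of 0] that[of 1])
  have bj: "b j \<in> I" "blk (b j) = j" using j base blk_base by auto
  have "(block_w j ^^ s) ((block_neg j ^^ e) (b j)) = (w ^^ s) (\<alpha> * b j)"
    using bj \<alpha>(1) by (simp add: block_neg_pow block_w_pow e[symmetric] sign_closed blk_sign)
  then have "(block_w j ^^ s) ((block_neg j ^^ e) (b j)) = i" using \<alpha> bj by (simp add: w_pow_sign)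
  then show thesis by (intro that[of e s]) (auto simp: fst_pow fst_gens)
qed

lemma block_group_lift:
  assumes "l \<le> m" "x \<in> carrier GM" "\<And>j. j \<in> {1..l} \<Longrightarrow> blk (fst x (b j)) = j"
  shows "\<exists>y\<in>block_group l. \<forall>j\<in>{1..l}. fst y (b j) = fst x (b j)"
  using assms
proof (induction l)
  case 0
  then show ?case using subgroup.one_closed[OF signs_subgroup] by (intro bexI[of _ "\<one>\<^bsub>GM\<^esub>"]) auto
next
  case (Suc l)
  then obtain y where y: "y \<in> block_group l" "\<forall>j\<in>{1..l}. fst y (b j) = fst x (b j)" by auto
  let ?j = "Suc l"
  have j: "?j \<in> {1..m}" using Suc.prems by simp
  have "fst x (b ?j) \<in> I" using fst_permutes[OF Suc.prems(2)] base[OF j] by (simp add: permutes_in_image)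
  moreover have "blk (fst x (b ?j)) = ?j" using Suc.prems(3)[of ?j] by simp
  ultimately obtain e f :: nat where ef:
    "\<And>y. fst (y \<odot> flip_gen ?j [^]\<^bsub>GM\<^esub> e \<odot> shift_gen ?j [^]\<^bsub>GM\<^esub> f) =
      (block_w ?j ^^ f) \<circ> (block_neg ?j ^^ e) \<circ> fst y"
    "(block_w ?j ^^ f) ((block_neg ?j ^^ e) (b ?j)) = fst x (b ?j)"
    using generator_reaching[OF j] by metis
  define y' where "y' = y \<odot> flip_gen ?j [^]\<^bsub>GM\<^esub> e \<odot> shift_gen ?j [^]\<^bsub>GM\<^esub> f"
  have "y' \<in> block_group ?j" using y(1) unfolding y'_def block_group_simps adjoin_def by blast
  moreover have "fst y' (b i) = fst x (b i)" if i: "i \<in> {1..?j}" for i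
  proof (cases "i = ?j")
    case True
    have "fst y (b ?j) = b ?j" using block_group_fst[OF y(1) base[OF j]] blk_base[OF j] by simp
    then show ?thesis using True ef by (simp add: y'_def)
  next
    case False
    then have il: "i \<in> {1..l}" "i \<in> {1..m}" using i j by auto
    have "fst y (b i) \<in> I \<and> blk (fst y (b i)) = i" using block_group_fst[OF y(1) base[OF il(2)]] blk_base[OF il(2)] by simp
    then have "(block_w ?j ^^ f) ((block_neg ?j ^^ e) (fst y (b i))) = fst y (b i)"
      using False by (simp add: block_w_pow block_neg_pow)
    then show ?thesis using y(2) il ef by (simp add: y'_def)
  qed
  ultimately show ?case by blast
qed

lemma block_group_lift_all:
  assumes "x \<in> carrier GM" "\<And>j. j \<in> {1..m} \<Longrightarrow> blk (fst x (b j)) = j"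
  shows "\<exists>y\<in>block_group m. fst y = fst x"
proof -
  obtain y where y: "y \<in> block_group m" "\<forall>j\<in>{1..m}. fst y (b j) = fst x (b j)"
    using block_group_lift[OF order_refl assms] by blast
  then have "fst y = fst x" using block_group_carrier[of m] assms(1) by (intro fst_determined) auto
  then show ?thesis using y(1) by blast
qed

end

context signed_blocks begin

lemma fst_reflects_blocks:
  assumes x: "x \<in> carrier GM" and i: "i \<in> I" "i' \<in> I" and eq: "blk (fst x i) = blk (fst x i')"
  shows "blk i = blk i'"
proof -
  obtain v c where vc: "x = (v, c)" by (cases x)
  have v: "v permutes I" "\<And>i. i \<in> I \<Longrightarrow> v (- i) = - v i" "\<And>i. i \<in> I \<Longrightarrow> v (w i) = w (v i)"
    using x vc by (auto simp: carrier_iff)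
  have vI: "v i \<in> I \<longleftrightarrow> i \<in> I" for i using v(1) by (rule permutes_in_image)
  have vw: "v ((w ^^ s) i) = (w ^^ s) (v i)" if "i \<in> I" for s i
    using that by (induction s) (auto simp: v(3))
  have vs: "v (\<alpha> * i) = \<alpha> * v i" if "i \<in> I" "\<bar>\<alpha>\<bar> = 1" for \<alpha> i
    using that(2) by (elim sign_cases) (auto simp: v(2) that(1))
  obtain \<alpha> s where \<alpha>: "\<bar>\<alpha>\<bar> = 1" "v i = \<alpha> * (w ^^ s) (b (blk (v i)))" using reach_sign[of "v i"] vI i by blast
  obtain \<alpha>' s' where \<alpha>': "\<bar>\<alpha>'\<bar> = 1" "v i' = \<alpha>' * (w ^^ s') (b (blk (v i')))" using reach_sign[of "v i'"] vI i by blast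
  define B where "B = b (blk (v i))"
  have BI: "B \<in> I" unfolding B_def using blk_range vI i base by metis
  have e1: "v i = \<alpha> * (w ^^ s) B" and e2: "v i' = \<alpha>' * (w ^^ s') B"
    using \<alpha> \<alpha>' eq vc by (simp_all add: B_def)
  have aa: "\<alpha> * \<alpha> = 1" "\<alpha>' * \<alpha>' = 1" using \<alpha>(1) \<alpha>'(1) by (metis abs_mult_self_eq mult_1)+
  have "\<alpha>' * (w ^^ s) (v i') = \<alpha> * (w ^^ s') (v i)"
    using BI \<alpha>(1) \<alpha>'(1) aa by (simp add: e1 e2 w_pow_sign w_pow_commute[of s s'] mult.assoc[symmetric])
  then have "v (\<alpha>' * (w ^^ s) i') = v (\<alpha> * (w ^^ s') i)"
    using i \<alpha>(1) \<alpha>'(1) by (simp add: vw vs)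
  then have "\<alpha>' * (w ^^ s) i' = \<alpha> * (w ^^ s') i" using permutes_inj[OF v(1)] by (simp add: inj_eq)
  then have "blk (\<alpha>' * (w ^^ s) i') = blk (\<alpha> * (w ^^ s') i)" by simp
  then show ?thesis using i \<alpha>(1) \<alpha>'(1) by (simp add: blk_sign blk_w_pow)
qed

text \<open>
  If an element of the group maps block \<open>j\<close> to block \<open>l\<close>, compare the powers of \<open>w\<close> that return to the
  base point up to sign.
\<close>
lemma block_exchange_type:
  assumes x: "x \<in> carrier GM" and j: "j \<in> {1..m}" "l \<in> {1..m}" and eq: "blk (fst x (b j)) = l"
  shows "ns l dvd ns j \<and> (ns j = ns l \<longrightarrow> cycle_sign j = cycle_sign l)"
proof -
  obtain v c where vc: "x = (v, c)" by (cases x)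
  have v: "v permutes I" "\<And>i. i \<in> I \<Longrightarrow> v (- i) = - v i" "\<And>i. i \<in> I \<Longrightarrow> v (w i) = w (v i)"
    using x vc by (auto simp: carrier_iff)
  have vI: "v i \<in> I \<longleftrightarrow> i \<in> I" for i using v(1) by (rule permutes_in_image)
  have vw: "v ((w ^^ s) i) = (w ^^ s) (v i)" if "i \<in> I" for s i
    using that by (induction s) (auto simp: v(3))
  have bj: "b j \<in> I" "b l \<in> I" using base j by auto
  obtain \<alpha> s where \<alpha>: "\<bar>\<alpha>\<bar> = 1" "v (b j) = \<alpha> * (w ^^ s) (b l)"
    using reach_sign[of "v (b j)"] vI bj eq vc by (metis fst_conv)
  have "(w ^^ ns j) (v (b j)) = cycle_sign j * v (b j)"
    using vw[OF bj(1), of "ns j"] w_pow_ns[OF j(1), of 1] v(2)[OF bj(1)] by (auto simp: cycle_sign_def split: if_splits)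
  then have "\<alpha> * (w ^^ s) ((w ^^ ns j) (b l)) = cycle_sign j * (\<alpha> * (w ^^ s) (b l))"
    using \<alpha> bj by (simp add: w_pow_sign w_pow_commute[of "ns j" s])
  then have "(w ^^ s) ((w ^^ ns j) (b l)) = (w ^^ s) (cycle_sign j * b l)"
    using \<alpha>(1) bj by (auto simp: w_pow_sign)
  then have "(w ^^ ns j) (b l) = cycle_sign j * b l"
    using permutes_inj[OF w_permutes] by (metis inj_fn injD)
  then obtain t where t: "ns j = ns l * t" "cycle_sign j = cycle_sign l ^ t" using period[OF j(2), of "cycle_sign j" "ns j"] by auto
  have "cycle_sign j = cycle_sign l" if "ns j = ns l"
  proof -
    have "t = 1" using t(1) that ns_pos[OF j(2)] by simp
    then show ?thesis using t(2) by simp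
  qed
  moreover have "ns l dvd ns j" unfolding t(1) by (rule dvd_triv_left)
  ultimately show ?thesis by blast
qed

lemma swap_exists:
  assumes m: "m = 2" and same: "ns 1 = ns 2" "cycle_sign 1 = cycle_sign 2" and \<beta>12: "\<beta> (b 1) = \<beta> (b 2)"
  obtains S where "(S, \<lambda>_. 1) \<in> carrier GM" "\<And>i. S (S i) = i" "\<And>i. i \<in> I \<Longrightarrow> S i \<in> I"
    "\<And>i. i \<in> I \<Longrightarrow> blk (S i) = 3 - blk i" "\<And>i. i \<in> I \<Longrightarrow> S (- i) = - S i" "\<And>i. i \<in> I \<Longrightarrow> S (w i) = w (S i)"
    "\<And>j \<alpha>. j \<in> {1..m} \<Longrightarrow> \<bar>\<alpha>\<bar> = 1 \<Longrightarrow> S (\<alpha> * b j) = \<alpha> * b (3 - j)"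
proof -
  have j3: "3 - j \<in> {1..m}" "3 - (3 - j) = j" "ns (3 - j) = ns j" "cycle_sign (3 - j) = cycle_sign j" "\<beta> (b (3 - j)) = \<beta> (b j)"
    if "j \<in> {1..m}" for j
  proof -
    have "j = 1 \<or> j = 2" using that m by auto
    then show "3 - j \<in> {1..m}" "3 - (3 - j) = j" "ns (3 - j) = ns j" "cycle_sign (3 - j) = cycle_sign j" "\<beta> (b (3 - j)) = \<beta> (b j)"
      using same \<beta>12 m by auto
  qed
  have V: "(w ^^ ns j) (cycle_sign j * \<alpha> * b (3 - j)) = \<alpha> * b (3 - j)" if "j \<in> {1..m}" "\<bar>\<alpha>\<bar> = 1" for j \<alpha>
  proof -
    have "(w ^^ ns j) (cycle_sign j * \<alpha> * b (3 - j)) = cycle_sign j * \<alpha> * (cycle_sign j * b (3 - j))"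
      using that j3[OF that(1)] base[OF j3(1)] w_pow_ns[of "3 - j" 1] by (simp add: w_pow_sign abs_mult)
    also have "\<dots> = (cycle_sign j * cycle_sign j) * (\<alpha> * b (3 - j))" by (simp only: mult_ac)
    finally show ?thesis by simp
  qed
  obtain S0 where S0: "\<And>j \<alpha>. j \<in> {1..m} \<Longrightarrow> \<bar>\<alpha>\<bar> = 1 \<Longrightarrow> S0 (\<alpha> * b j) = \<alpha> * b (3 - j)"
    "\<And>i. i \<in> I \<Longrightarrow> S0 (w i) = w (S0 i)"
    using extend_from_bases[of w "\<lambda>j \<alpha>. \<alpha> * b (3 - j)", OF V] by blast
  define S where "S = (\<lambda>i. if i \<in> I then S0 i else i)"
  have S_base: "S (\<alpha> * b j) = \<alpha> * b (3 - j)" if "j \<in> {1..m}" "\<bar>\<alpha>\<bar> = 1" for j \<alpha>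
    using S0(1)[OF that] sign_closed[OF that(2) base[OF that(1)]] by (simp add: S_def)
  have S_w: "S (w i) = w (S i)" if "i \<in> I" for i using S0(2) that by (simp add: S_def)
  have S_props: "S i \<in> I \<and> blk (S i) = 3 - blk i \<and> S (S i) = i \<and> S (- i) = - S i \<and> \<beta> (S i) = \<beta> i" if "i \<in> I" for i
    using that
  proof (induction rule: block_induct)
    case (start j \<alpha>)
    have bI: "b j \<in> I" "b (3 - j) \<in> I"
      using base start(1) j3(1) by auto
    have "S (- (\<alpha> * b j)) = - (\<alpha> * b (3 - j))" using S_base[OF start(1), of "- \<alpha>"] start(2) by simp
    moreover have "\<beta> (\<alpha> * b (3 - j)) = \<beta> (\<alpha> * b j)"
      using start(2) j3(5)[OF start(1)] bI by (elim sign_cases) (auto simp: \<beta>_neg)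
    ultimately show ?case
      using start bI S_base[OF start] S_base[OF j3(1)[OF start(1)] start(2)] j3[OF start(1)]
      by (simp add: sign_closed blk_sign blk_base)
  next
    case (step i)
    then show ?case using S_w neg_closed by (auto simp: blk_w \<beta>_w simp flip: w_neg)
  qed
  have SS: "S (S i) = i" for i
  proof (cases "i \<in> I")
    case True
    then show ?thesis using S_props by blast
  qed (simp add: S_def)
  have "S permutes I" by (rule involution_permutes[OF SS]) (auto simp: S_def)
  then have "(S, \<lambda>_. 1) \<in> carrier GM"
    using S_props S_w \<beta>_nonzero by (auto simp: carrier_iff)
  then show thesis using S_props S_w S_base SS by (intro that[of S]) auto
qed

end

context block_generators begin

text \<open>
  The permutations that commute with \<open>w\<close> and preserve the blocks come from \<open>block_group m\<close>. There are
  others only if there are two blocks of equal length and sign; then the exchange of the blocks, which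
  permutes the generators, is adjoined as well.
\<close>
theorem complement_exists:
  assumes m1: "m \<ge> 1"
    and sym: "m = 2 \<Longrightarrow> ns 1 = ns 2 \<Longrightarrow> cycle_sign 1 = cycle_sign 2 \<Longrightarrow>
      \<beta> (b 1) = \<beta> (b 2) \<and> r (b 1) = r (b 2) \<and> u (b 1) = u (b 2) \<and> \<delta> (b 1) = \<delta> (b 2)"
  shows torus_complemented
proof (cases "m = 2 \<and> ns 1 = ns 2 \<and> cycle_sign 1 = cycle_sign 2")
  case False
  show ?thesis
  proof (rule torus_complementedI)
    show "subgroup (block_group m) GM" "block_group m \<inter> torus \<subseteq> signs" "signs \<subseteq> block_group m"
      using block_group_subgroup[OF order_refl] by auto
    fix x assume x: "x \<in> carrier GM"
    have "blk (fst x (b j)) = j" if j: "j \<in> {1..m}" for j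
    proof (rule ccontr)
      assume neq: "blk (fst x (b j)) \<noteq> j"
      have xI: "fst x (b i) \<in> I" if "i \<in> {1..m}" for i
        using fst_permutes[OF x] base[OF that] by (simp add: permutes_in_image)
      have m2: "m = 2" using two_blocks[OF j xI[OF j] neq] .
      let ?l = "3 - j"
      have j12: "j = 1 \<or> j = 2" using j m2 by auto
      have l: "?l \<in> {1..m}" "?l \<noteq> j" using j12 m2 by auto
      have 1: "blk (fst x (b j)) = ?l" using blk_range[OF xI[OF j]] neq j12 m2 by auto
      have "blk (fst x (b ?l)) \<noteq> blk (fst x (b j))"
        using fst_reflects_blocks[OF x base[OF l(1)] base[OF j]] blk_base l j by auto
      then have 2: "blk (fst x (b ?l)) = j" using blk_range[OF xI[OF l(1)]] 1 j12 m2 by auto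
      have "ns j = ns ?l" "cycle_sign j = cycle_sign ?l"
        using block_exchange_type[OF x j l(1) 1] block_exchange_type[OF x l(1) j 2] by (auto intro: dvd_antisym)
      with j12 have "ns 1 = ns 2 \<and> cycle_sign 1 = cycle_sign 2" by auto
      then show False using False m2 by simp
    qed
    then show "\<exists>h\<in>block_group m. fst h = fst x" using block_group_lift_all[OF x] by simp
  qed
next
  case True
  then have m2: "m = 2" and same: "ns 1 = ns 2" "cycle_sign 1 = cycle_sign 2" by auto
  have eqs: "\<beta> (b 1) = \<beta> (b 2)" "r (b 1) = r (b 2)" "u (b 1) = u (b 2)" "\<delta> (b 1) = \<delta> (b 2)" using sym m2 same by auto
  obtain S where S: "(S, \<lambda>_. 1) \<in> carrier GM" "\<And>i. S (S i) = i" "\<And>i. i \<in> I \<Longrightarrow> S i \<in> I"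
    "\<And>i. i \<in> I \<Longrightarrow> blk (S i) = 3 - blk i" "\<And>i. i \<in> I \<Longrightarrow> S (- i) = - S i" "\<And>i. i \<in> I \<Longrightarrow> S (w i) = w (S i)"
    "\<And>j \<alpha>. j \<in> {1..m} \<Longrightarrow> \<bar>\<alpha>\<bar> = 1 \<Longrightarrow> S (\<alpha> * b j) = \<alpha> * b (3 - j)"
    using swap_exists[OF m2 same eqs(1)] by blast
  have S_notin: "S i = i" if "i \<notin> I" for i using S(1) that by (auto simp: carrier_iff permutes_not_in)
  have S_iff: "S i \<in> I \<longleftrightarrow> i \<in> I" for i using S(3) S_notin by metis
  have r_minus: "r (- i) = cocycle i / r i" if "i \<in> I" for i
    using r_neg[OF that] r_nonzero[OF that] by (simp add: field_simps)
  have u_minus: "u (- i) = - 1 / u i" if "i \<in> I" for i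
    using u_neg[OF that] u_nonzero[OF that] by (simp add: field_simps)
  have inv: "r (S i) = r i \<and> u (S i) = u i \<and> \<delta> (S i) = \<delta> i" if "i \<in> I" for i
    using that
  proof (induction rule: block_induct)
    case (start j \<alpha>)
    have bI: "b 1 \<in> I" "b 2 \<in> I" using base m2 by auto
    have "cocycle (b 1) = cocycle (b 2)" using eqs bI by (simp add: cocycle_def \<beta>_w)
    then have "r (- b 1) = r (- b 2)" "u (- b 1) = u (- b 2)" "\<delta> (- b 1) = \<delta> (- b 2)"
      using bI eqs \<delta>_neg[OF m2] by (auto simp: r_minus u_minus)
    moreover have "j = 1 \<or> j = 2" using start m2 by auto
    ultimately show ?case using S(7)[OF start] start(2) eqs by (elim sign_cases) auto
  next
    case (step i)
    then show ?case using S(3,6) r_w u_w \<delta>_w by auto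
  qed
  let ?S = "(S, \<lambda>_. 1 :: 'a)"
  let ?A = "block_group m"
  have A: "subgroup ?A GM" "signs \<subseteq> ?A" "?A \<inter> torus \<subseteq> signs"
    "\<And>j. j \<in> {1..m} \<Longrightarrow> flip_gen j \<in> ?A \<and> shift_gen j \<in> ?A"
    using block_group_subgroup[OF order_refl] by auto
  have S2: "?S \<odot> ?S = \<one>\<^bsub>GM\<^esub>" using S(2) by (auto simp: one_eq fun_eq_iff)
  have S2': "?S [^]\<^bsub>GM\<^esub> (2::nat) \<in> ?A"
    using S2 S(1) subgroup.one_closed[OF A(1)] by (simp add: numeral_2_eq_2 del: mult_eq)
  have conj_gen: "?S \<odot> flip_gen j \<odot> inv\<^bsub>GM\<^esub> ?S = flip_gen (3 - j) \<and>
      ?S \<odot> shift_gen j \<odot> inv\<^bsub>GM\<^esub> ?S = shift_gen (3 - j)" if j: "j \<in> {1..m}" for j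
  proof -
    have j3: "3 - j \<in> {1..m}" using j m2 by auto
    have bl: "blk (S i) = j \<longleftrightarrow> blk i = 3 - j" if "i \<in> I" for i
      using S(4)[OF that] blk_range[OF that] j m2 by auto
    have "?S \<odot> flip_gen j = flip_gen (3 - j) \<odot> ?S"
      using S(5) S_iff S_notin bl inv by (auto simp: flip_gen_def fun_eq_iff block_neg_def)
    moreover have "?S \<odot> shift_gen j = shift_gen (3 - j) \<odot> ?S"
      using S(6) S_iff S_notin bl inv by (auto simp: shift_gen_def fun_eq_iff block_w_def)
    ultimately show ?thesis using S(1) flip_gen_carrier[OF j3] shift_gen_carrier[OF j3]
      by (simp only: GM.m_assoc GM.r_inv GM.inv_closed GM.r_one)
  qed
  have conj: "?S \<odot> y \<odot> inv\<^bsub>GM\<^esub> ?S \<in> ?A" if y: "y \<in> ?A" for y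
  proof (rule conj_block_group[OF S(1) A(1,2) order_refl _ y])
    fix i assume i: "i \<in> {1..m}"
    have "3 - i \<in> {1..m}" using i m2 by auto
    then show "?S \<odot> flip_gen i \<odot> inv\<^bsub>GM\<^esub> ?S \<in> ?A \<and> ?S \<odot> shift_gen i \<odot> inv\<^bsub>GM\<^esub> ?S \<in> ?A"
      using conj_gen[OF i] A(4) by (simp only: simp_thms)
  qed
  let ?H = "adjoin GM ?A ?S"
  have b1: "b 1 \<in> I" "blk (b 1) = 1" using base blk_base m2 by auto
  show ?thesis
  proof (rule torus_complementedI)
    show "subgroup ?H GM" by (rule GM.subgroup_adjoin[OF A(1) S(1) conj _ S2']) auto
    have incl: "?A \<subseteq> ?H" "?S \<in> ?H" using GM.adjoin_incl[OF A(1) S(1)] by auto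
    then show "signs \<subseteq> ?H" using A(2) by blast
    show "?H \<inter> torus \<subseteq> signs"
    proof (rule GM.adjoin_inter[OF A(1) S2' S(1) A(3)])
      fix y and e :: nat
      assume y: "y \<in> ?A" and T: "y \<odot> ?S [^]\<^bsub>GM\<^esub> e \<in> torus"
      have "(S ^^ e) (fst y (b 1)) = b 1" using T by (simp add: torus_def fst_pow fun_eq_iff)
      moreover have "blk ((S ^^ e) i) = (if even e then blk i else 3 - blk i) \<and> (S ^^ e) i \<in> I" if "i \<in> I" for i
        using that by (induction e) (use S(3,4) blk_range[OF that] m2 in auto)
      moreover have "fst y (b 1) \<in> I" "blk (fst y (b 1)) = 1" using block_group_fst[OF y b1(1)] b1(2) by auto
      ultimately show "2 dvd e" using b1(2) by (metis Suc_1 diff_Suc_1 numeral_3_eq_3 diff_Suc_Suc n_not_Suc_n One_nat_def diff_zero)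
    qed
    fix x assume x: "x \<in> carrier GM"
    have xI: "fst x (b i) \<in> I" if "i \<in> {1..m}" for i
      using fst_permutes[OF x] base[OF that] by (simp add: permutes_in_image)
    have b12: "1 \<in> {1..m}" "2 \<in> {1..m}" using m2 by auto
    have cases12: "j = 1 \<or> j = 2" if "j \<in> {1..m}" for j using that m2 by auto
    have neq: "blk (fst x (b 1)) \<noteq> blk (fst x (b 2))"
      using fst_reflects_blocks[OF x base[OF b12(1)] base[OF b12(2)]] blk_base b12 by auto
    have r12: "blk (fst x (b 1)) = 1 \<or> blk (fst x (b 1)) = 2" "blk (fst x (b 2)) = 1 \<or> blk (fst x (b 2)) = 2"
      by (rule cases12[OF blk_range[OF xI[OF b12(1)]]], rule cases12[OF blk_range[OF xI[OF b12(2)]]])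
    show "\<exists>h\<in>?H. fst h = fst x"
    proof (cases "blk (fst x (b 1)) = 1")
      case True
      then have "blk (fst x (b j)) = j" if "j \<in> {1..m}" for j using cases12[OF that] neq r12 by metis
      then have "\<exists>y\<in>?A. fst y = fst x" by (rule block_group_lift_all[OF x])
      then show ?thesis using incl by blast
    next
      case False
      have xS: "x \<odot> ?S \<in> carrier GM" using GM.m_closed[OF x S(1)] .
      have "blk (fst (x \<odot> ?S) (b j)) = j" if "j \<in> {1..m}" for j
        using cases12[OF that] False neq r12 S(4)[OF xI[OF that]] by auto
      then obtain y where y: "y \<in> ?A" "fst y = fst (x \<odot> ?S)" using block_group_lift_all[OF xS] by blast
      have "y \<odot> ?S = y \<odot> ?S [^]\<^bsub>GM\<^esub> (1::nat)" using S(1) by simp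
      then have "y \<odot> ?S \<in> ?H" using y(1) unfolding adjoin_def by blast
      moreover have "fst (y \<odot> ?S) = fst x" using y(2) S(2) by (auto simp: fun_eq_iff)
      ultimately show ?thesis by blast
    qed
  qed
qed

end

text \<open>
  In characteristic 2 permutation matrices are symplectic.
\<close>
lemma (in frobenius_twist) complement_char_2:
  assumes "(1::'a) = - 1" and \<beta>1: "\<And>i. i \<in> I \<Longrightarrow> \<beta> i = 1"
  shows torus_complemented
proof -
  define H where "H = {x \<in> carrier GM. snd x = (\<lambda>_. 1)}"
  have signs1: "signs = {(id, \<lambda>_. 1)}" using assms(1) by (auto simp: signs_def fun_eq_iff)
  have lift: "(fst x, \<lambda>_. 1) \<in> carrier GM" if "x \<in> carrier GM" for x
  proof -
    obtain v c where x: "x = (v, c)" by (cases x)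
    have "v i \<in> I \<longleftrightarrow> i \<in> I" for i using that x by (simp add: carrier_iff permutes_in_image)
    then show ?thesis using that x \<beta>1 by (auto simp: carrier_iff)
  qed
  show ?thesis
  proof (rule torus_complementedI)
    show "subgroup H GM"
    proof (rule GM.subgroupI)
      show "H \<subseteq> carrier GM" "H \<noteq> {}" using GM.one_closed by (auto simp: H_def one_eq)
      fix x y assume x: "x \<in> H" and y: "y \<in> H"
      then show "x \<odot> y \<in> H" using GM.m_closed[of x y] by (cases x; cases y) (auto simp: H_def)
    next
      fix x assume x: "x \<in> H"
      let ?y = "(fst (inv\<^bsub>GM\<^esub> x), \<lambda>_. 1 :: 'a)"
      have xc: "x \<in> carrier GM" using x by (simp add: H_def)
      have y: "?y \<in> H" using lift[of "inv\<^bsub>GM\<^esub> x"] xc by (simp add: H_def)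
      have "?y \<odot> x = \<one>\<^bsub>GM\<^esub>"
        using x fst_inv[OF xc] by (cases x) (auto simp: H_def one_eq)
      then have "inv\<^bsub>GM\<^esub> x = ?y" using y xc by (intro GM.inv_equality) (auto simp: H_def)
      then show "inv\<^bsub>GM\<^esub> x \<in> H" using y by simp
    qed
    show "H \<inter> torus \<subseteq> signs" by (auto simp: H_def torus_def signs1)
    show "signs \<subseteq> H" using signs_carrier by (auto simp: H_def signs1)
    show "\<exists>h\<in>H. fst h = fst x" if "x \<in> carrier GM" for x
      using lift[OF that] by (intro bexI[of _ "(fst x, \<lambda>_. 1)"]) (auto simp: H_def)
  qed
qed

text \<open>
  On a positive cycle \<open>\<beta> = 1\<close> or \<open>\<beta> = - 1\<close> would do; on a negative one \<open>\<beta> (b j)\<close> has to satisfy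
  \<open>x ^ (q ^ ns j) = - x\<close>. The choice depends only on the length and the sign of the cycle.
\<close>
lemma (in signed_cycles) normalized_form:
  assumes q: "odd q" "q > 1"
  shows "\<exists>\<beta> :: int \<Rightarrow> 'a::alg_closed_field.
    (\<forall>i\<in>I. \<beta> i \<noteq> 0 \<and> \<beta> (- i) = - \<beta> i \<and> \<beta> (w i) = \<beta> i ^ q) \<and>
    (\<forall>j\<in>{1..m}. \<forall>l\<in>{1..m}. ns j = ns l \<and> cycle_sign j = cycle_sign l \<longrightarrow> \<beta> (b j) = \<beta> (b l))"
proof -
  have "\<exists>x::'a. n \<ge> 1 \<longrightarrow> x ^ (q ^ n - 1) = of_int e" for n and e :: int
  proof (cases "n \<ge> 1")
    case True
    then have "q ^ n > 1" using one_less_power[of q n] q by simp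
    then show ?thesis using nth_root_exists[of "q ^ n - 1" "of_int e :: 'a"] by auto
  qed auto
  then obtain R :: "nat \<Rightarrow> int \<Rightarrow> 'a" where R: "\<And>n e. n \<ge> 1 \<Longrightarrow> R n e ^ (q ^ n - 1) = of_int e" by metis
  have R0: "R n e \<noteq> 0" if "n \<ge> 1" "\<bar>e\<bar> = 1" for n e
  proof
    assume "R n e = 0"
    moreover have "q ^ n - 1 > 0" using one_less_power[of q n] that q by simp
    ultimately have "(0::'a) = of_int e" using R[OF that(1), of e] by (simp add: power_0_left)
    then show False using that(2) by (elim sign_cases) auto
  qed
  have Rq: "R n e ^ (q ^ n) = of_int e * R n e" if "n \<ge> 1" for n e
  proof -
    have "q ^ n = Suc (q ^ n - 1)" using q by simp
    then have "R n e ^ (q ^ n) = R n e * R n e ^ (q ^ n - 1)" by (metis power_Suc)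
    then show ?thesis using R[OF that] by (simp add: mult.commute)
  qed
  define V where "V = (\<lambda>j \<alpha>. of_int \<alpha> * R (ns j) (cycle_sign j))"
  have odd_pow: "(of_int \<alpha> :: 'a) ^ (q ^ n) = of_int \<alpha>" if "\<bar>\<alpha>\<bar> = 1" for \<alpha> n
    using that q(1) by (elim sign_cases) auto
  have V: "((\<lambda>x. x ^ q) ^^ ns j) (V j (cycle_sign j * \<alpha>)) = V j \<alpha>" if "j \<in> {1..m}" "\<bar>\<alpha>\<bar> = 1" for j \<alpha>
  proof -
    have "((\<lambda>x. x ^ q) ^^ ns j) (V j (cycle_sign j * \<alpha>)) = of_int (cycle_sign j * \<alpha>) * (of_int (cycle_sign j) * R (ns j) (cycle_sign j))"
      using that odd_pow[of "cycle_sign j * \<alpha>" "ns j"] ns_pos[OF that(1)]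
      by (simp add: V_def funpow_power power_mult_distrib Rq abs_mult del: of_int_mult)
    also have "\<dots> = of_int (cycle_sign j * cycle_sign j) * (of_int \<alpha> * R (ns j) (cycle_sign j))" by (simp add: mult_ac del: abs_cycle_sign)
    finally show ?thesis by (simp add: V_def)
  qed
  obtain f where f: "\<And>j \<alpha>. j \<in> {1..m} \<Longrightarrow> \<bar>\<alpha>\<bar> = 1 \<Longrightarrow> f (\<alpha> * b j) = V j \<alpha>"
    "\<And>i. i \<in> I \<Longrightarrow> f (w i) = f i ^ q"
    using extend_from_bases[of "\<lambda>x. x ^ q" V, OF V] by blast
  have fi: "f i \<noteq> 0 \<and> f (- i) = - f i" if "i \<in> I" for i
    using that
  proof (induction rule: block_induct)
    case (start j \<alpha>)
    have "f (- (\<alpha> * b j)) = V j (- \<alpha>)" using f(1)[OF start(1), of "- \<alpha>"] start(2) by simp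
    then show ?case using start f(1)[OF start] R0[OF ns_pos[OF start(1)], of "cycle_sign j"]
      by (elim sign_cases) (auto simp: V_def)
  next
    case (step i)
    then show ?case using f(2) neg_closed q by (auto simp flip: w_neg)
  qed
  have f_base: "f (b j) = f (b l)" if "j \<in> {1..m}" "l \<in> {1..m}" "ns j = ns l" "cycle_sign j = cycle_sign l" for j l
    using f(1)[of j 1] f(1)[of l 1] that by (simp add: V_def)
  show ?thesis
  proof (intro exI[of _ f] conjI ballI impI)
    fix i assume "i \<in> I"
    then show "f i \<noteq> 0" "f (- i) = - f i" "f (w i) = f i ^ q" using f(2) fi by auto
  next
    fix j l assume "j \<in> {1..m}" "l \<in> {1..m}" "ns j = ns l \<and> cycle_sign j = cycle_sign l"
    then show "f (b j) = f (b l)" using f_base by blast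
  qed
qed

lemma odd_power_mod_4:
  fixes q :: nat
  assumes "odd q"
  shows "q ^ e mod 4 = (if q mod 4 = 3 \<and> odd e then 3 else 1)"
proof (induction e)
  case (Suc e)
  have "q mod 4 = 1 \<or> q mod 4 = 3" using assms by presburger
  moreover have "q ^ Suc e mod 4 = ((q mod 4) * (q ^ e mod 4)) mod 4" by (simp add: mod_mult_eq)
  ultimately show ?case using Suc by auto
qed simp

text \<open>
  For two blocks, the congruences say that an equivariant square root \<open>\<delta>\<close> of \<open>-1\<close> exists.
\<close>
theorem (in signed_blocks) complement_sufficient:
  assumes odd_char: "(1::'a) \<noteq> - 1" and q: "odd q" "q > 1"
    and m: "m = 1 \<or> m = 2 \<and> (\<forall>j\<in>{1..m}. q ^ ns j mod 4 = 1 \<longleftrightarrow> k < j)"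
    and sym: "\<And>j l. j \<in> {1..m} \<Longrightarrow> l \<in> {1..m} \<Longrightarrow> ns j = ns l \<Longrightarrow> cycle_sign j = cycle_sign l \<Longrightarrow> \<beta> (b j) = \<beta> (b l)"
  shows torus_complemented
proof -
  define a :: nat where "a = (if m = 2 \<and> q mod 4 = 3 then 1 else 0)"
  obtain r u where ru:
    "\<And>i. i \<in> I \<Longrightarrow> r i \<noteq> 0" "\<And>i. i \<in> I \<Longrightarrow> r (w i) = r i ^ q" "\<And>i. i \<in> I \<Longrightarrow> r i * r (- i) = cocycle i"
    "\<And>i. i \<in> I \<Longrightarrow> u i \<noteq> 0" "\<And>i. i \<in> I \<Longrightarrow> u (w i) = u i ^ q" "\<And>i. i \<in> I \<Longrightarrow> u i * u (- i) = - 1"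
    "\<And>i. i \<in> I \<Longrightarrow> r i * u (w i) = u i * r (- i)"
    "\<And>i. i \<in> I \<Longrightarrow> r i ^ geom q (ns (blk i)) = norm_sign a (ns (blk i)) * (if blk i \<le> k then u i else 1)"
    "\<And>j l. ns j = ns l \<Longrightarrow> (j \<le> k \<longleftrightarrow> l \<le> k) \<Longrightarrow> \<beta> (b j) = \<beta> (b l) \<Longrightarrow> j \<in> {1..m} \<Longrightarrow> l \<in> {1..m} \<Longrightarrow>
       r (b j) = r (b l) \<and> u (b j) = u (b l)"
    using generator_coefficients[OF q, of a] by blast
  obtain \<iota> :: 'a where \<iota>: "\<iota>\<^sup>2 = - 1" using nth_root_exists[of 2 "- 1 :: 'a"] by auto
  have \<iota>0: "\<iota> \<noteq> 0" using \<iota> by auto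
  have \<iota>inv: "1 / \<iota> = - \<iota>" using \<iota> \<iota>0 by (simp add: field_simps power2_eq_square)
  have "\<exists>\<delta> :: int \<Rightarrow> 'a. (\<forall>i\<in>I. \<delta> i \<noteq> 0 \<and> \<delta> (w i) = \<delta> i ^ q) \<and> (\<forall>j\<in>{1..m}. \<delta> (b j) = \<delta> (b 1)) \<and>
    (m = 2 \<longrightarrow> (\<forall>i\<in>I. \<delta> i * \<delta> i = - 1 \<and> \<delta> (- i) = - \<delta> i))"
  proof (cases "m = 2")
    case False
    then show ?thesis by (intro exI[of _ "\<lambda>_. 1 :: 'a"]) auto
  next
    case True
    have \<iota>q: "\<iota> ^ (q ^ ns j) = (if j \<le> k then 1 / \<iota> else \<iota>)" if "j \<in> {1..m}" for j
      using square_root_pow_mod_4[OF \<iota>, of "q ^ ns j"] m True that q by (auto simp: \<iota>inv)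
    obtain \<delta> where \<delta>: "\<And>j. j \<in> {1..m} \<Longrightarrow> \<delta> (b j) = \<iota>" "\<And>i. i \<in> I \<Longrightarrow> \<delta> i \<noteq> 0"
      "\<And>i. i \<in> I \<Longrightarrow> \<delta> (w i) = \<delta> i ^ q" "\<And>i. i \<in> I \<Longrightarrow> \<delta> i * \<delta> (- i) = 1"
      by (rule extend_field[of "\<lambda>_. 1" "\<lambda>_. \<iota>"]) (use \<iota>0 \<iota>q in auto)
    have sq: "\<delta> i * \<delta> i = - 1" if "i \<in> I" for i
      using that
    proof (induction rule: block_induct)
      case (start j \<alpha>)
      have "\<delta> (- b j) = - \<iota>" using \<delta>(4)[OF base[OF start(1)]] \<delta>(1)[OF start(1)] \<iota>0 \<iota>inv by (metis nonzero_eq_divide_eq mult.commute)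
      then show ?case using start(2) \<delta>(1)[OF start(1)] \<iota> by (elim sign_cases) (auto simp: power2_eq_square)
    next
      case (step i)
      then show ?case using \<delta>(3) minus_one_pow by (simp flip: power_mult_distrib)
    qed
    have "\<delta> (- i) = - \<delta> i" if "i \<in> I" for i
    proof -
      have "\<delta> i * (\<delta> (- i) + \<delta> i) = 0" using sq[OF that] \<delta>(4)[OF that] by (simp add: distrib_left)
      then show ?thesis using \<delta>(2)[OF that] by (simp add: eq_neg_iff_add_eq_0)
    qed
    then show ?thesis using \<delta> sq ns_pos True by (intro exI[of _ \<delta>]) auto
  qed
  then obtain \<delta> :: "int \<Rightarrow> 'a" where \<delta>: "\<And>i. i \<in> I \<Longrightarrow> \<delta> i \<noteq> 0" "\<And>i. i \<in> I \<Longrightarrow> \<delta> (w i) = \<delta> i ^ q"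
    "\<And>j. j \<in> {1..m} \<Longrightarrow> \<delta> (b j) = \<delta> (b 1)"
    "\<And>i. m = 2 \<Longrightarrow> i \<in> I \<Longrightarrow> \<delta> i * \<delta> i = - 1" "\<And>i. m = 2 \<Longrightarrow> i \<in> I \<Longrightarrow> \<delta> (- i) = - \<delta> i"
    by blast
  have q4: "q mod 4 = 1 \<or> q mod 4 = 3" using q(1) by presburger
  note pow_mod = odd_power_mod_4[OF q(1)]
  have parity: "j \<le> k \<longleftrightarrow> a = 1 \<and> odd (ns j)" if "m = 2" "j \<in> {1..m}" for j
  proof -
    have "q ^ ns j mod 4 = 1 \<longleftrightarrow> k < j" using m that by auto
    then show ?thesis using that(1) pow_mod[of "ns j"] q4 by (auto simp: a_def split: if_splits)
  qed
  have \<delta>pow: "\<delta> i ^ n = (- 1) ^ (n div 2) * (if odd n then \<delta> i else 1)" if "m = 2" "i \<in> I" for i n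
  proof -
    have "\<delta> i ^ (2 * (n div 2)) = (- 1) ^ (n div 2)"
      using \<delta>(4)[OF that] by (simp add: power_mult power2_eq_square)
    moreover have "\<delta> i ^ n = \<delta> i ^ (2 * (n div 2) + (if odd n then 1 else 0))"
      by (rule arg_cong[where f = "\<lambda>e. \<delta> i ^ e"]) simp
    ultimately show ?thesis by (simp add: power_add)
  qed
  interpret block_generators I w q \<beta> k m ns b blk r u \<delta> a
  proof unfold_locales
    show "a \<le> 1" by (simp add: a_def)
    show "m \<le> 2" using m by auto
    show "\<delta> (w i) = (- 1) ^ a * \<delta> i" if "m = 2" "i \<in> I" for i
    proof -
      have "(\<delta> i)\<^sup>2 = - 1" using \<delta>(4)[OF that] by (simp add: power2_eq_square)
      then show ?thesis using square_root_pow_mod_4[of "\<delta> i" q] q q4 \<delta>(2)[OF that(2)] that(1) by (auto simp: a_def)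
    qed
    show "\<delta> i ^ (a * ns j) = norm_sign a (ns j) * (if j \<le> k then \<delta> i else 1)" if "m = 2" "i \<in> I" "j \<in> {1..m}" for i j
      using \<delta>pow[OF that(1,2), of "ns j"] parity[OF that(1,3)] by (cases "a = 0") (auto simp: norm_sign_def a_def)
  qed (use ru \<delta> in auto)
  show ?thesis
  proof (rule complement_exists)
    show "m \<ge> 1" using m by auto
    assume *: "m = 2" "ns 1 = ns 2" "cycle_sign 1 = cycle_sign 2"
    then have 12: "1 \<in> {1..m}" "2 \<in> {1..m}" by auto
    have "1 \<le> k \<longleftrightarrow> 2 \<le> k" using *(3) by (auto simp: cycle_sign_def split: if_splits)
    then show "\<beta> (b 1) = \<beta> (b 2) \<and> r (b 1) = r (b 2) \<and> u (b 1) = u (b 2) \<and> \<delta> (b 1) = \<delta> (b 2)"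
      using sym[OF 12 *(2,3)] ru(9)[of 1 2] \<delta>(3)[OF 12(2)] 12 *(2) by auto
  qed
qed

section \<open>Symplectic matrices with signed indices\<close>

definition signed_index :: "nat \<Rightarrow> nat \<Rightarrow> int" where
  "signed_index n x = (if x < n then int x + 1 else - (int (x - n) + 1))"

lemma signed_index_mem: "x < 2 * n \<Longrightarrow> signed_index n x \<in> signed_indices n"
  by (auto simp: signed_index_def signed_indices_def)

lemma mat_pos_less: "i \<in> signed_indices n \<Longrightarrow> mat_pos n i < 2 * n"
  by (auto simp: mat_pos_def signed_indices_def)

lemma mat_pos_signed_index [simp]: "x < 2 * n \<Longrightarrow> mat_pos n (signed_index n x) = x"
  by (auto simp: signed_index_def mat_pos_def)

lemma signed_index_mat_pos [simp]: "i \<in> signed_indices n \<Longrightarrow> signed_index n (mat_pos n i) = i"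
  by (auto simp: signed_index_def mat_pos_def signed_indices_def)

lemma mat_pos_eq_iff:
  "i \<in> signed_indices n \<Longrightarrow> j \<in> signed_indices n \<Longrightarrow> mat_pos n i = mat_pos n j \<longleftrightarrow> i = j"
  by (metis signed_index_mat_pos)

lemma signed_indices_cases:
  assumes "i \<in> signed_indices n"
  obtains x where "x < n" "i = int x + 1" "mat_pos n i = x" "sgn i = 1"
    | x where "x < n" "i = - (int x + 1)" "mat_pos n i = n + x" "sgn i = - 1"
proof (cases "i > 0")
  case True
  show thesis by (rule that(1)[of "nat i - 1"]) (use assms True in \<open>auto simp: signed_indices_def mat_pos_def\<close>)
next
  case False
  show thesis by (rule that(2)[of "nat (- i) - 1"]) (use assms False in \<open>auto simp: signed_indices_def mat_pos_def\<close>)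
qed

lemma bij_mat_pos: "bij_betw (mat_pos n) (signed_indices n) {0..<2 * n}"
  by (rule bij_betw_byWitness[of _ "signed_index n"]) (auto simp: mat_pos_less signed_index_mem)

lemma finite_signed_indices [simp]: "finite (signed_indices n)"
  using bij_betw_finite[OF bij_mat_pos] by simp

lemma signed_indices_neg [simp]: "- i \<in> signed_indices n \<longleftrightarrow> i \<in> signed_indices n"
  by (auto simp: signed_indices_def)

lemma zero_signed_indices [simp]: "0 \<notin> signed_indices n"
  by (simp add: signed_indices_def)

lemma signed_indices_neq [simp]: "i \<in> signed_indices n \<Longrightarrow> - i \<noteq> i" "i \<in> signed_indices n \<Longrightarrow> i \<noteq> - i"
  by (auto simp: signed_indices_def)

definition entry :: "nat \<Rightarrow> 'a mat \<Rightarrow> int \<Rightarrow> int \<Rightarrow> 'a" where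
  "entry n A i j = A $$ (mat_pos n i, mat_pos n j)"

definition signed_matrix :: "nat \<Rightarrow> (int \<Rightarrow> int \<Rightarrow> 'a) \<Rightarrow> 'a mat" where
  "signed_matrix n f = mat (2 * n) (2 * n) (\<lambda>(x, y). f (signed_index n x) (signed_index n y))"

lemma signed_matrix_carrier [simp]: "signed_matrix n f \<in> carrier_mat (2 * n) (2 * n)"
  by (simp add: signed_matrix_def)

lemma entry_matrix [simp]:
  "i \<in> signed_indices n \<Longrightarrow> j \<in> signed_indices n \<Longrightarrow> entry n (signed_matrix n f) i j = f i j"
  by (simp add: entry_def signed_matrix_def mat_pos_less)

lemma matrix_eqI:
  assumes "A \<in> carrier_mat (2 * n) (2 * n)" "B \<in> carrier_mat (2 * n) (2 * n)"
    and "\<And>i j. i \<in> signed_indices n \<Longrightarrow> j \<in> signed_indices n \<Longrightarrow> entry n A i j = entry n B i j"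
  shows "A = B"
proof (rule eq_matI)
  fix x y assume "x < dim_row B" "y < dim_col B"
  then have "x < 2 * n" "y < 2 * n" using assms by auto
  then show "A $$ (x, y) = B $$ (x, y)"
    using assms(3)[of "signed_index n x" "signed_index n y"] by (simp add: entry_def signed_index_mem)
qed (use assms in auto)

lemma entry_mult:
  assumes "A \<in> carrier_mat (2 * n) (2 * n)" "B \<in> carrier_mat (2 * n) (2 * n)"
    and "i \<in> signed_indices n" "j \<in> signed_indices n"
  shows "entry n (A * B) i j = (\<Sum>k\<in>signed_indices n. entry n A i k * entry n B k j)"
proof -
  have "entry n (A * B) i j = (\<Sum>x\<in>{0..<2 * n}. A $$ (mat_pos n i, x) * B $$ (x, mat_pos n j))"
    using assms mat_pos_less[OF assms(3)] mat_pos_less[OF assms(4)]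
    by (simp add: entry_def scalar_prod_def)
  also have "\<dots> = (\<Sum>k\<in>signed_indices n. A $$ (mat_pos n i, mat_pos n k) * B $$ (mat_pos n k, mat_pos n j))"
    by (rule sum.reindex_bij_betw[OF bij_mat_pos, symmetric])
  finally show ?thesis by (simp add: entry_def)
qed

lemma entry_one [simp]:
  "i \<in> signed_indices n \<Longrightarrow> j \<in> signed_indices n \<Longrightarrow> entry n (1\<^sub>m (2 * n)) i j = (if i = j then 1 else 0)"
  by (simp add: entry_def mat_pos_less mat_pos_eq_iff)

lemma entry_transpose [simp]:
  "A \<in> carrier_mat (2 * n) (2 * n) \<Longrightarrow> i \<in> signed_indices n \<Longrightarrow> j \<in> signed_indices n \<Longrightarrow>
    entry n (transpose_mat A) i j = entry n A j i"
  by (simp add: entry_def mat_pos_less)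

lemma entry_uminus [simp]:
  "A \<in> carrier_mat (2 * n) (2 * n) \<Longrightarrow> i \<in> signed_indices n \<Longrightarrow> j \<in> signed_indices n \<Longrightarrow>
    entry n (- A :: 'a::ring mat) i j = - entry n A i j"
  by (simp add: entry_def mat_pos_less)

lemma entry_frob [simp]:
  "A \<in> carrier_mat (2 * n) (2 * n) \<Longrightarrow> i \<in> signed_indices n \<Longrightarrow> j \<in> signed_indices n \<Longrightarrow>
    entry n (frob q A) i j = entry n A i j ^ q"
  by (simp add: entry_def frob_def mat_pos_less)

lemma frob_carrier [simp]: "A \<in> carrier_mat r c \<Longrightarrow> frob q A \<in> carrier_mat r c"
  by (simp add: frob_def)

abbreviation sg :: "int \<Rightarrow> 'a::field" where "sg i \<equiv> of_int (sgn i)"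

lemma sg_square [simp]: "i \<in> signed_indices n \<Longrightarrow> sg i * sg i = (1::'a::field)"
  by (auto simp: signed_indices_def sgn_if)

lemma sg_nonzero [simp]: "i \<in> signed_indices n \<Longrightarrow> (sg i :: 'a::field) \<noteq> 0"
  by (auto simp: signed_indices_def sgn_if)

lemma symp_form_carrier [simp]: "symp_form n \<in> carrier_mat (2 * n) (2 * n)"
  by (auto simp: symp_form_def mult_2)

lemma symp_form_dim [simp]: "dim_row (symp_form n) = 2 * n" "dim_col (symp_form n) = 2 * n"
  using symp_form_carrier carrier_matD by blast+

lemma entry_symp_form [simp]:
  "i \<in> signed_indices n \<Longrightarrow> j \<in> signed_indices n \<Longrightarrow>
    entry n (symp_form n :: 'a::field mat) i j = (if j = - i then sg i else 0)"
  by (elim signed_indices_cases) (auto simp: entry_def symp_form_def)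

lemma sum_single:
  assumes "finite S" "x \<in> S" "\<And>k. k \<in> S \<Longrightarrow> k \<noteq> x \<Longrightarrow> f k = (0::'a::comm_monoid_add)"
  shows "sum f S = f x"
proof -
  have "sum f S = sum f {x}" by (rule sum.mono_neutral_right) (use assms in auto)
  then show ?thesis by simp
qed

lemma symp_form_square: "symp_form n * symp_form n = - (1\<^sub>m (2 * n) :: 'a::field mat)"
proof (rule matrix_eqI[of _ n])
  fix i j assume i: "i \<in> signed_indices n" and j: "j \<in> signed_indices n"
  have "entry n (symp_form n * symp_form n :: 'a mat) i j =
      (\<Sum>k\<in>signed_indices n. entry n (symp_form n) i k * entry n (symp_form n) k j)"
    by (rule entry_mult) (use i j in auto)
  also have "\<dots> = entry n (symp_form n) i (- i) * entry n (symp_form n) (- i) j"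
    by (rule sum_single) (use i j in auto)
  also have "\<dots> = entry n (- (1\<^sub>m (2 * n))) i j" using i j by (auto simp: sgn_minus)
  finally show "entry n (symp_form n * symp_form n :: 'a mat) i j = entry n (- (1\<^sub>m (2 * n))) i j" .
qed (auto simp: symp_form_carrier[THEN mult_carrier_mat])

lemma Sp_iff:
  "A \<in> carrier (Sp n) \<longleftrightarrow> A \<in> carrier_mat (2 * n) (2 * n) \<and> transpose_mat A * symp_form n * A = (symp_form n :: 'a::field mat)"
  (is "_ \<longleftrightarrow> ?R")
proof
  assume ?R
  then have A: "A \<in> carrier_mat (2 * n) (2 * n)" and eq: "transpose_mat A * symp_form n * A = symp_form n" by auto
  define B where "B = - (symp_form n * (transpose_mat A * symp_form n))"
  have B: "B \<in> carrier_mat (2 * n) (2 * n)"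
    using A by (auto simp: B_def intro!: mult_carrier_mat[of _ _ "2 * n"])
  have "B * A = - ((symp_form n * (transpose_mat A * symp_form n)) * A)"
    unfolding B_def using A by (intro uminus_mult_left_mat) auto
  also have "(symp_form n * (transpose_mat A * symp_form n)) * A = symp_form n * (transpose_mat A * symp_form n * A)"
    by (rule assoc_mult_mat[of _ "2 * n" "2 * n" _ "2 * n" _ "2 * n"]) (use A in \<open>auto intro!: mult_carrier_mat[of _ _ "2 * n"]\<close>)
  also have "- \<dots> = 1\<^sub>m (2 * n)" using eq by (simp add: symp_form_square)
  finally have BA: "B * A = 1\<^sub>m (2 * n)" .
  then have AB: "A * B = 1\<^sub>m (2 * n)" using mat_mult_left_right_inverse B A by blast
  have "invertible_mat A" unfolding invertible_mat_def inverts_mat_def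
    using A B AB BA by (intro conjI exI[of _ B]) auto
  then show "A \<in> carrier (Sp n)" using A eq by (simp add: Sp_def GL_def)
qed (auto simp: Sp_def GL_def)

lemma Sp_mult [simp]: "A \<otimes>\<^bsub>Sp n\<^esub> B = A * B" and Sp_one [simp]: "\<one>\<^bsub>Sp n\<^esub> = 1\<^sub>m (2 * n)"
  by (simp_all add: Sp_def GL_def)

lemma Sp_carrier: "A \<in> carrier (Sp n) \<Longrightarrow> A \<in> carrier_mat (2 * n) (2 * n)"
  by (simp add: Sp_iff)

lemma group_Sp: "group (Sp n :: 'a::field mat monoid)"
proof (rule groupI)
  let ?Q = "symp_form n :: 'a mat" and ?m = "carrier_mat (2 * n) (2 * n) :: 'a mat set"
  have cl: "X \<in> ?m \<Longrightarrow> Y \<in> ?m \<Longrightarrow> X * Y \<in> ?m" for X Y by (rule mult_carrier_mat)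
  have as: "X \<in> ?m \<Longrightarrow> Y \<in> ?m \<Longrightarrow> Z \<in> ?m \<Longrightarrow> X * Y * Z = X * (Y * Z)" for X Y Z by (rule assoc_mult_mat)
  have prod: "transpose_mat (A * B) * ?Q * (A * B) = transpose_mat B * (transpose_mat A * ?Q * A) * B"
    if "A \<in> ?m" "B \<in> ?m" for A B
    using that by (simp add: transpose_mult[of _ "2 * n" "2 * n" _ "2 * n"] as cl)
  fix x y z :: "'a mat"
  show "\<one>\<^bsub>Sp n\<^esub> \<in> carrier (Sp n)"
    by (simp add: Sp_iff left_mult_one_mat[OF symp_form_carrier] right_mult_one_mat[OF symp_form_carrier])
  assume x: "x \<in> carrier (Sp n)"
  then have xm: "x \<in> ?m" and xQ: "transpose_mat x * ?Q * x = ?Q" by (auto simp: Sp_iff)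
  show "\<one>\<^bsub>Sp n\<^esub> \<otimes>\<^bsub>Sp n\<^esub> x = x" using xm by simp
  have "invertible_mat x" using x by (simp add: Sp_def GL_def)
  then obtain B where AB: "x * B = 1\<^sub>m (2 * n)" and BA: "B * x = 1\<^sub>m (dim_row B)"
    using xm by (auto simp: invertible_mat_def inverts_mat_def)
  have Bc: "dim_col B = 2 * n" using arg_cong[OF AB, of dim_col] by simp
  have Br: "dim_row B = 2 * n" using arg_cong[OF BA, of dim_col] xm by simp
  have B: "B \<in> ?m" using Bc Br by auto
  have "transpose_mat B * ?Q * B = transpose_mat (x * B) * ?Q * (x * B)"
    using prod[OF xm B] xQ by simp
  then have "B \<in> carrier (Sp n)" using B by (simp add: Sp_iff AB)
  then show "\<exists>y\<in>carrier (Sp n). y \<otimes>\<^bsub>Sp n\<^esub> x = \<one>\<^bsub>Sp n\<^esub>" using BA Br by auto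
  assume y: "y \<in> carrier (Sp n)"
  then show "x \<otimes>\<^bsub>Sp n\<^esub> y \<in> carrier (Sp n)" using xm xQ prod[of x y] cl[of x y] by (simp add: Sp_iff)
  assume z: "z \<in> carrier (Sp n)"
  show "x \<otimes>\<^bsub>Sp n\<^esub> y \<otimes>\<^bsub>Sp n\<^esub> z = x \<otimes>\<^bsub>Sp n\<^esub> (y \<otimes>\<^bsub>Sp n\<^esub> z)"
    unfolding Sp_mult by (rule assoc_mult_mat[OF xm Sp_carrier[OF y] Sp_carrier[OF z]])
qed

definition monomial :: "nat \<Rightarrow> (int \<Rightarrow> int) \<Rightarrow> (int \<Rightarrow> 'a) \<Rightarrow> 'a::field mat" where
  "monomial n v c = signed_matrix n (\<lambda>i j. if j = v i then c i else 0)"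

lemma monomial_carrier [simp]: "monomial n v c \<in> carrier_mat (2 * n) (2 * n)"
  by (simp add: monomial_def)

lemma entry_monomial [simp]:
  "i \<in> signed_indices n \<Longrightarrow> j \<in> signed_indices n \<Longrightarrow> entry n (monomial n v c) i j = (if j = v i then c i else 0)"
  by (simp add: monomial_def)

lemma entry_monomial_mult:
  assumes "\<And>i. i \<in> signed_indices n \<Longrightarrow> v i \<in> signed_indices n" "A \<in> carrier_mat (2 * n) (2 * n)"
    "i \<in> signed_indices n" "j \<in> signed_indices n"
  shows "entry n (monomial n v c * A) i j = c i * entry n A (v i) j"
proof -
  have "entry n (monomial n v c * A) i j = (\<Sum>k\<in>signed_indices n. entry n (monomial n v c) i k * entry n A k j)"
    by (rule entry_mult) (use assms in auto)
  also have "\<dots> = entry n (monomial n v c) i (v i) * entry n A (v i) j"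
    by (rule sum_single) (use assms in auto)
  finally show ?thesis using assms by simp
qed

lemma monomial_mult:
  assumes "\<And>i. i \<in> signed_indices n \<Longrightarrow> v i \<in> signed_indices n" "\<And>i. i \<in> signed_indices n \<Longrightarrow> u i \<in> signed_indices n"
  shows "monomial n v c * monomial n u d = monomial n (u \<circ> v) (\<lambda>i. c i * d (v i))"
  by (rule matrix_eqI[of _ n]) (use assms in \<open>auto simp: entry_monomial_mult intro!: mult_carrier_mat[of _ _ "2 * n"]\<close>)

lemma monomial_cong:
  assumes "\<And>i. i \<in> signed_indices n \<Longrightarrow> v i = u i \<and> c i = d i"
  shows "monomial n v c = monomial n u d"
  by (rule matrix_eqI[of _ n]) (use assms in auto)

lemma SlD:
  assumes "v \<in> Sl n"
  shows "v permutes signed_indices n" "v i \<in> signed_indices n \<longleftrightarrow> i \<in> signed_indices n"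
    "i \<in> signed_indices n \<Longrightarrow> v (- i) = - v i"
  using assms permutes_in_image[of v "signed_indices n"] by (auto simp: Sl_def)

lemma entry_gram:
  assumes A: "A \<in> carrier_mat (2 * n) (2 * n)" and i: "i \<in> signed_indices n" and j: "j \<in> signed_indices n"
  shows "entry n (transpose_mat A * symp_form n * A) i j =
    (\<Sum>k\<in>signed_indices n. sg k * entry n A k i * entry n A (- k) (j::int) :: 'a::field)"
proof -
  have c: "transpose_mat A * symp_form n \<in> carrier_mat (2 * n) (2 * n)"
    using A by (intro mult_carrier_mat[of _ _ "2 * n"]) auto
  have "entry n (transpose_mat A * symp_form n) i k = - sg k * entry n A (- k) i" if k: "k \<in> signed_indices n" for k
  proof -
    have "entry n (transpose_mat A * symp_form n) i k =
        (\<Sum>l\<in>signed_indices n. entry n (transpose_mat A) i l * entry n (symp_form n) l k)"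
      by (rule entry_mult) (use A i k in auto)
    also have "\<dots> = entry n (transpose_mat A) i (- k) * entry n (symp_form n) (- k) k"
      by (rule sum_single) (use A i k in auto)
    finally show ?thesis using A i k by (simp add: sgn_minus)
  qed
  then have "entry n (transpose_mat A * symp_form n * A) i j =
     (\<Sum>k\<in>signed_indices n. - sg k * entry n A (- k) i * entry n A k j)"
    using entry_mult[OF c A i j] by simp
  also have "\<dots> = (\<Sum>k\<in>signed_indices n. sg k * entry n A k i * entry n A (- k) j)"
    by (rule sum.reindex_bij_witness[of _ uminus uminus]) (auto simp: sgn_minus)
  finally show ?thesis .
qed

lemma Sp_entry_iff:
  "A \<in> carrier (Sp n) \<longleftrightarrow> A \<in> carrier_mat (2 * n) (2 * n) \<and>
    (\<forall>i\<in>signed_indices n. \<forall>j\<in>signed_indices n.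
      (\<Sum>k\<in>signed_indices n. sg k * entry n A k i * entry n A (- k) j) = (if j = - i then sg i else (0::'a::field)))"
proof (cases "A \<in> carrier_mat (2 * n) (2 * n)")
  case True
  have "transpose_mat A * symp_form n * A = symp_form n \<longleftrightarrow>
    (\<forall>i\<in>signed_indices n. \<forall>j\<in>signed_indices n.
      entry n (transpose_mat A * symp_form n * A) i j = entry n (symp_form n) i j)"
    using matrix_eqI[of "transpose_mat A * symp_form n * A" n "symp_form n"] True
    by (auto intro!: mult_carrier_mat[of _ _ "2 * n"])
  then show ?thesis using True by (simp add: Sp_iff entry_gram)
qed (simp add: Sp_iff)

lemma monomial_Sp_iff:
  assumes v: "v \<in> Sl n"
  shows "monomial n v c \<in> carrier (Sp n) \<longleftrightarrow> (\<forall>i\<in>signed_indices n. c i * c (- i) * sg i = sg (v i))"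
proof -
  let ?S = "signed_indices n"
  have key: "(\<Sum>k\<in>?S. sg k * entry n (monomial n v c) k (v i) * entry n (monomial n v c) (- k) j) =
      (if j = - v i then sg i * c i * c (- i) else 0)" if "i \<in> ?S" "j \<in> ?S" for i j
  proof -
    have "(\<Sum>k\<in>?S. sg k * entry n (monomial n v c) k (v i) * entry n (monomial n v c) (- k) j) =
      sg i * entry n (monomial n v c) i (v i) * entry n (monomial n v c) (- i) j"
      using that SlD[OF v] permutes_inj[OF SlD(1)[OF v]] by (intro sum_single) (auto simp: inj_eq)
    then show ?thesis using that SlD[OF v] by auto
  qed
  have surj: "\<exists>l\<in>?S. i = v l" if "i \<in> ?S" for i
    using permutes_image[OF SlD(1)[OF v]] that by blast
  show ?thesis
  proof
    assume *: "monomial n v c \<in> carrier (Sp n)"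
    show "\<forall>i\<in>?S. c i * c (- i) * sg i = sg (v i)"
    proof
      fix i assume i: "i \<in> ?S"
      then have "v i \<in> ?S" "- v i \<in> ?S" using SlD[OF v] by auto
      then have "(\<Sum>k\<in>?S. sg k * entry n (monomial n v c) k (v i) * entry n (monomial n v c) (- k) (- v i)) =
          (if - v i = - v i then sg (v i) else 0)"
        using * unfolding Sp_entry_iff by blast
      then show "c i * c (- i) * sg i = sg (v i)"
        using key[OF i \<open>- v i \<in> ?S\<close>] by (simp add: mult_ac)
    qed
  next
    assume *: "\<forall>i\<in>?S. c i * c (- i) * sg i = sg (v i)"
    have "(\<Sum>k\<in>?S. sg k * entry n (monomial n v c) k i * entry n (monomial n v c) (- k) j) = (if j = - i then sg i else 0)"
      if "i \<in> ?S" "j \<in> ?S" for i j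
    proof -
      obtain l where "l \<in> ?S" "i = v l" using surj \<open>i \<in> ?S\<close> by blast
      then show ?thesis using key[of l j] * that by (auto simp: mult_ac)
    qed
    then show "monomial n v c \<in> carrier (Sp n)" by (simp add: Sp_entry_iff)
  qed
qed

section \<open>The center and the normalizer of the diagonal torus\<close>

lemma exists_nonunit_square: "\<exists>x::'a::alg_closed_field. x \<noteq> 0 \<and> x * x \<noteq> 1"
proof -
  have "\<exists>x::'a. poly [:1, - 1, 0, 1:] x = 0" by (rule alg_closed_imp_poly_has_root) simp
  then obtain x :: 'a where x: "1 + x * (x * x - 1) = 0" by (auto simp: algebra_simps)
  then have "x \<noteq> 0" "x * x \<noteq> 1" by auto
  then show ?thesis by blast
qed

lemma id_Sl [simp]: "id \<in> Sl n"
  by (auto simp: Sl_def permutes_id)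

lemma one_monomial: "1\<^sub>m (2 * n) = monomial n id (\<lambda>_. 1)"
  by (rule matrix_eqI[of _ n]) auto

lemma minus_one_monomial: "- 1\<^sub>m (2 * n) = monomial n id (\<lambda>_. - 1)"
  by (rule matrix_eqI[of _ n]) auto

lemma minus_one_mult: "A \<in> carrier_mat (2 * n) (2 * n) \<Longrightarrow> (- 1\<^sub>m (2 * n)) * A = (- A :: 'a::field mat)"
  unfolding minus_one_monomial by (rule matrix_eqI[of _ n]) (auto simp: entry_monomial_mult intro!: mult_carrier_mat[of _ _ "2 * n"])

lemma entry_mult_diag:
  assumes "A \<in> carrier_mat (2 * n) (2 * n)" "i \<in> signed_indices n" "j \<in> signed_indices n"
  shows "entry n (A * monomial n id d) i j = entry n A i j * d j"
proof -
  have "entry n (A * monomial n id d) i j = (\<Sum>k\<in>signed_indices n. entry n A i k * entry n (monomial n id d) k j)"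
    by (rule entry_mult) (use assms in auto)
  also have "\<dots> = entry n A i j * entry n (monomial n id d) j j"
    by (rule sum_single) (use assms in auto)
  finally show ?thesis using assms by simp
qed

definition diag_torus :: "nat \<Rightarrow> 'a::field mat set" where
  "diag_torus n = {monomial n id d | d. \<forall>i\<in>signed_indices n. d i * d (- i) = 1}"

lemma diag_torus_Sp: "diag_torus n \<subseteq> carrier (Sp n)"
  by (auto simp: diag_torus_def monomial_Sp_iff)

text \<open>
  It suffices that the field has an element \<open>x\<close> with \<open>x \<noteq> 0\<close> and \<open>x * x \<noteq> 1\<close>.
\<close>
lemma diag_torus_separates:
  assumes "i \<in> signed_indices n" "j \<in> signed_indices n" "i \<noteq> j"
  shows "\<exists>d :: int \<Rightarrow> 'a::alg_closed_field. monomial n id d \<in> diag_torus n \<and> d i \<noteq> d j"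
proof -
  obtain x :: 'a where x: "x \<noteq> 0" "x * x \<noteq> 1" using exists_nonunit_square by blast
  let ?d = "\<lambda>k. if k = i then x else if k = - i then 1 / x else 1"
  have "x \<noteq> 1 / x" "x \<noteq> 1" using x by (auto simp: field_simps)
  then have "?d i \<noteq> ?d j" using assms by auto
  moreover have "monomial n id ?d \<in> diag_torus n" unfolding diag_torus_def using x assms by force
  ultimately show ?thesis by blast
qed

definition std_coeff :: "(int \<Rightarrow> int) \<Rightarrow> int \<Rightarrow> 'a::field" where
  "std_coeff v i = (if i > 0 then 1 else sg i * sg (v i))"

lemma monomial_std_Sp:
  assumes v: "v \<in> Sl n"
  shows "monomial n v (std_coeff v) \<in> carrier (Sp n)"
proof -
  have "std_coeff v i * std_coeff v (- i) * sg i = (sg (v i) :: 'a)" if i: "i \<in> signed_indices n" for i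
  proof -
    have "i \<noteq> 0" using i by (auto simp: signed_indices_def)
    then show ?thesis using SlD(3)[OF v i] i by (cases "i > 0") (auto simp: std_coeff_def sgn_minus)
  qed
  then show ?thesis by (simp add: monomial_Sp_iff[OF v])
qed

lemma Sl_transitive:
  assumes "i \<in> signed_indices n" "j \<in> signed_indices n"
  shows "\<exists>v\<in>Sl n. v i = j"
proof
  let ?v = "\<lambda>k. if k = i then j else if k = j then i else if k = - i then - j else if k = - j then - i else k"
  have "?v permutes signed_indices n"
    by (rule involution_permutes) (use assms in auto)
  then show "?v \<in> Sl n" using assms by (auto simp: Sl_def)
  show "?v i = j" by simp
qed

text \<open>
  A central matrix is diagonal because it commutes with the diagonal torus, and scalar because it
  commutes with lifts of a transitive group of permutations.
\<close>
lemma center_Sp: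
  assumes "n \<ge> 1"
  shows "group_center (Sp n) = {1\<^sub>m (2 * n), - 1\<^sub>m (2 * n) :: 'a::alg_closed_field mat}"
proof
  show "{1\<^sub>m (2 * n), - 1\<^sub>m (2 * n)} \<subseteq> group_center (Sp n :: 'a mat monoid)"
  proof -
    have "- 1\<^sub>m (2 * n) \<in> carrier (Sp n :: 'a mat monoid)" unfolding minus_one_monomial by (simp add: monomial_Sp_iff)
    moreover have "1\<^sub>m (2 * n) \<in> carrier (Sp n :: 'a mat monoid)" unfolding one_monomial by (simp add: monomial_Sp_iff)
    moreover have "(- 1\<^sub>m (2 * n)) * A = A * (- 1\<^sub>m (2 * n) :: 'a mat)" if "A \<in> carrier (Sp n)" for A
      unfolding minus_one_monomial using Sp_carrier[OF that]
      by (intro matrix_eqI[of _ n]) (auto simp: entry_monomial_mult entry_mult_diag intro!: mult_carrier_mat[of _ _ "2 * n"])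
    ultimately show ?thesis using Sp_carrier by (fastforce simp: group_center_def)
  qed
  show "group_center (Sp n) \<subseteq> {1\<^sub>m (2 * n), - 1\<^sub>m (2 * n) :: 'a mat}"
  proof
    fix A :: "'a mat" assume "A \<in> group_center (Sp n)"
    then have A: "A \<in> carrier (Sp n)" and comm: "\<And>B. B \<in> carrier (Sp n) \<Longrightarrow> A * B = B * A"
      by (auto simp: group_center_def)
    have Am: "A \<in> carrier_mat (2 * n) (2 * n)" using A by (rule Sp_carrier)
    have off: "entry n A i j = 0" if ij: "i \<in> signed_indices n" "j \<in> signed_indices n" "i \<noteq> j" for i j
    proof -
      obtain d :: "int \<Rightarrow> 'a" where d: "monomial n id d \<in> diag_torus n" "d i \<noteq> d j" using diag_torus_separates[OF ij] by blast
      then have "A * monomial n id d = monomial n id d * A" using comm diag_torus_Sp by blast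
      then have "entry n (A * monomial n id d) i j = entry n (monomial n id d * A) i j" by simp
      then have "entry n A i j * d j = d i * entry n A i j"
        using ij Am by (simp add: entry_mult_diag entry_monomial_mult)
      then show ?thesis using d(2) by auto
    qed
    define a where "a = (\<lambda>i. entry n A i i)"
    have A_diag: "A = monomial n id a"
      by (rule matrix_eqI[OF Am]) (auto simp: off a_def)
    have const: "a i = a j" if ij: "i \<in> signed_indices n" "j \<in> signed_indices n" for i j
    proof -
      obtain v where v: "v \<in> Sl n" "v i = j" using Sl_transitive[OF ij] by blast
      let ?V = "monomial n v (std_coeff v) :: 'a mat"
      have V: "?V \<in> carrier (Sp n)" using v(1) by (rule monomial_std_Sp)
      have "entry n (A * ?V) i j = entry n (?V * A) i j" using comm[OF monomial_std_Sp[OF v(1)]] by simp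
      then have "a i * std_coeff v i = std_coeff v i * a j"
        using ij v SlD(2)[OF v(1)] by (simp add: A_diag entry_monomial_mult)
      moreover have "std_coeff v i * std_coeff v (- i) * sg i = (sg (v i) :: 'a)"
        using V ij(1) by (simp add: monomial_Sp_iff[OF v(1)])
      then have "std_coeff v i \<noteq> (0::'a)" using v(2) ij(2) by auto
      ultimately show ?thesis by simp
    qed
    have one: "1 \<in> signed_indices n" using assms by (simp add: signed_indices_def)
    have "a 1 * a (- 1) * sg 1 = sg (id 1)"
      using A one unfolding A_diag monomial_Sp_iff[OF id_Sl] by blast
    then have "a 1 * a 1 = 1" using const[of 1 "- 1"] one by simp
    then have "a 1 = 1 \<or> a 1 = - 1" by (metis square_eq_1_iff)
    moreover have "A = monomial n id (\<lambda>_. a 1)"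
      unfolding A_diag by (rule monomial_cong, rule conjI, rule refl, erule const[OF _ one])
    ultimately show "A \<in> {1\<^sub>m (2 * n), - 1\<^sub>m (2 * n)}"
      using one_monomial[of n, where 'a = 'a] minus_one_monomial[of n, where 'a = 'a] by auto
  qed
qed

text \<open>
  If a row had two nonzero entries, then all elements of the diagonal torus would agree at the
  corresponding two indices. The gram matrix shows that the permutation commutes with negation.
\<close>
lemma monomial_if_normalizes:
  fixes X :: "'a::alg_closed_field mat"
  assumes X: "X \<in> carrier (Sp n)" and norm: "\<And>t. t \<in> diag_torus n \<Longrightarrow> \<exists>t'\<in>diag_torus n. X * t = t' * X"
  shows "\<exists>v\<in>Sl n. \<exists>c. X = monomial n v c"
proof -
  let ?S = "signed_indices n"
  have Xm: "X \<in> carrier_mat (2 * n) (2 * n)" using X by (rule Sp_carrier)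
  interpret group "Sp n :: 'a mat monoid" by (rule group_Sp)
  obtain Y where Y: "Y \<in> carrier (Sp n)" "X * Y = 1\<^sub>m (2 * n)"
    using r_inv_ex[OF X] by auto
  have Ym: "Y \<in> carrier_mat (2 * n) (2 * n)" using Y(1) by (rule Sp_carrier)
  have XY: "(\<Sum>k\<in>?S. entry n X i k * entry n Y k j) = (if i = j then 1 else 0)" if "i \<in> ?S" "j \<in> ?S" for i j
    using entry_mult[OF Xm Ym that] that by (simp add: Y(2))
  have uniq: "j = l" if i: "i \<in> ?S" and jl: "j \<in> ?S" "l \<in> ?S" and nz: "entry n X i j \<noteq> 0" "entry n X i l \<noteq> 0" for i j l
  proof (rule ccontr)
    assume "j \<noteq> l"
    then obtain d :: "int \<Rightarrow> 'a" where d: "monomial n id d \<in> diag_torus n" "d j \<noteq> d l"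
      using diag_torus_separates[OF jl] by blast
    then obtain d' where "X * monomial n id d = monomial n id d' * X"
      using norm[OF d(1)] by (auto simp: diag_torus_def)
    then have eq: "entry n (X * monomial n id d) i k = entry n (monomial n id d' * X) i k" for k by simp
    have "entry n X i k * d k = d' i * entry n X i k" if "k \<in> ?S" for k
      using eq[of k] that \<open>i \<in> ?S\<close> Xm by (simp add: entry_mult_diag entry_monomial_mult)
    from this[of j] this[of l] have "d j = d' i" "d l = d' i" using jl nz by auto
    then show False using d(2) by simp
  qed
  have ex: "\<exists>j\<in>?S. entry n X i j \<noteq> 0" if i: "i \<in> ?S" for i
  proof (rule ccontr)
    assume "\<not> (\<exists>j\<in>?S. entry n X i j \<noteq> 0)"
    then have "(\<Sum>k\<in>?S. entry n X i k * entry n Y k i) = 0" by (intro sum.neutral) auto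
    then show False using XY[OF i i] by simp
  qed
  define v where "v = (\<lambda>i. if i \<in> ?S then (SOME j. j \<in> ?S \<and> entry n X i j \<noteq> 0) else i)"
  have v: "v i \<in> ?S" "entry n X i (v i) \<noteq> 0" if "i \<in> ?S" for i
    using someI_ex[of "\<lambda>j. j \<in> ?S \<and> entry n X i j \<noteq> 0"] ex[OF that] that by (auto simp: v_def)
  have zero: "entry n X i j = 0" if "i \<in> ?S" "j \<in> ?S" "j \<noteq> v i" for i j
    using uniq[OF that(1,2) v(1)[OF that(1)]] v(2)[OF that(1)] that(3) by blast
  define c where "c = (\<lambda>i. entry n X i (v i))"
  have Xmono: "X = monomial n v c"
    by (rule matrix_eqI[OF Xm]) (auto simp: zero c_def)
  have c0: "c i \<noteq> 0" if "i \<in> ?S" for i using v(2)[OF that] by (simp add: c_def)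
  have row: "c i * entry n Y (v i) j = (if i = j then 1 else 0)" if "i \<in> ?S" "j \<in> ?S" for i j
    using entry_monomial_mult[of n v Y i j c] v(1) Ym that Y(2) by (simp add: Xmono[symmetric])
  have "inj_on v ?S"
  proof (rule inj_onI)
    fix i j assume ij: "i \<in> ?S" "j \<in> ?S" "v i = v j"
    show "i = j"
    proof (rule ccontr)
      assume "i \<noteq> j"
      then have "c i * entry n Y (v j) j = 0" using row[OF ij(1,2)] ij(3) by simp
      then show False using c0[OF ij(1)] row[OF ij(2,2)] by auto
    qed
  qed
  moreover have "v ` ?S = ?S" using v(1) calculation by (intro endo_inj_surj) auto
  ultimately have "v permutes ?S" by (intro bij_imp_permutes) (auto simp: bij_betw_def v_def)
  moreover have "v (- i) = - v i" if i: "i \<in> ?S" for i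
  proof -
    have vi: "v i \<in> ?S" "v (- i) \<in> ?S" using v(1) i by auto
    have "(\<Sum>k\<in>?S. sg k * entry n X k (v i) * entry n X (- k) (v (- i))) = (if v (- i) = - v i then sg (v i) else 0)"
      using X vi unfolding Sp_entry_iff by blast
    moreover have "(\<Sum>k\<in>?S. sg k * entry n X k (v i) * entry n X (- k) (v (- i))) =
        sg i * entry n X i (v i) * entry n X (- i) (v (- i))"
    proof (rule sum_single)
      fix k assume k: "k \<in> ?S" "k \<noteq> i"
      then have "v i \<noteq> v k" using \<open>inj_on v ?S\<close> i by (auto dest: inj_onD)
      then show "sg k * entry n X k (v i) * entry n X (- k) (v (- i)) = 0" using zero[OF k(1) vi(1)] by simp
    qed (use i in auto)
    moreover have "sg i * entry n X i (v i) * entry n X (- i) (v (- i)) \<noteq> 0" using v(2)[of i] v(2)[of "- i"] i by simp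
    ultimately show ?thesis by (auto split: if_splits)
  qed
  ultimately have "v \<in> Sl n" by (simp add: Sl_def)
  then show ?thesis using Xmono by blast
qed

section \<open>Lang's theorem for the diagonal torus\<close>

text \<open>
  Lang's theorem for the diagonal torus and the Frobenius map twisted by \<open>w\<close>. If \<open>w ^^ r = id\<close>, take
  \<open>u\<close> with \<open>u i ^ (q ^ r - 1) = 1 / s i\<close>; then the product of the \<open>u ((w ^^ t) i) ^ (q ^ (r - 1 - t))\<close> over
  \<open>t < r\<close> is a solution, as the product telescopes. Choosing \<open>u (- i) = 1 / u i\<close> makes it symplectic.
\<close>
lemma (in signed_permutation) lang_diagonal:
  fixes s :: "int \<Rightarrow> 'a::alg_closed_field"
  assumes fin: "finite I" and q: "q > 1" and s0: "\<And>i. i \<in> I \<Longrightarrow> s i \<noteq> 0"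
    and s_neg: "\<And>i. i \<in> I \<Longrightarrow> s i * s (- i) = 1"
  obtains f where "\<And>i. i \<in> I \<Longrightarrow> f i \<noteq> 0" "\<And>i. i \<in> I \<Longrightarrow> f i * f (- i) = 1"
    "\<And>i. i \<in> I \<Longrightarrow> f (w i) = s i * f i ^ q"
proof -
  have "permutation w" using permutes_imp_permutation[OF fin w_permutes] .
  then obtain r where r: "w ^^ r = id" "r > 0" using permutation_is_nilpotent by blast
  have qr: "q ^ r > 1" using one_less_power[of q r] q r by simp
  have "\<exists>x::'a. x ^ (q ^ r - 1) = 1 / s i" for i by (rule nth_root_exists) (use qr in simp)
  then obtain u0 :: "int \<Rightarrow> 'a" where u0: "\<And>i. u0 i ^ (q ^ r - 1) = 1 / s i" by metis
  define u where "u = (\<lambda>i. if i > 0 then u0 i else 1 / u0 (- i))"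
  have u0_nz: "u0 i \<noteq> 0" if "i \<in> I" for i
  proof
    assume "u0 i = 0"
    then have "1 / s i = 0" using u0[of i] qr by (simp add: power_0_left)
    then show False using s0[OF that] by simp
  qed
  have u_nz: "u i \<noteq> 0" if "i \<in> I" for i using u0_nz that neg_closed by (auto simp: u_def)
  have u_pow: "u i ^ (q ^ r - 1) * s i = 1" if "i \<in> I" for i
  proof (cases "i > 0")
    case True
    then show ?thesis using u0[of i] s0[OF that] by (simp add: u_def)
  next
    case False
    then have "u i ^ (q ^ r - 1) = s (- i)" using u0[of "- i"] by (simp add: u_def power_divide)
    then show ?thesis using s_neg[OF that] by (simp add: mult.commute)
  qed
  have u_neg: "u i * u (- i) = 1" if "i \<in> I" for i
    using u0_nz that neg_closed zero_notin by (cases "i > 0"; cases "i = 0") (auto simp: u_def)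
  define A where "A = (\<lambda>i t. u ((w ^^ t) i) ^ (q ^ (r - t)))"
  define f where "f = (\<lambda>i. \<Prod>t<r. u ((w ^^ t) i) ^ (q ^ (r - Suc t)))"
  have wI: "(w ^^ t) i \<in> I" if "i \<in> I" for t i using that by (induction t) auto
  have wneg: "(w ^^ t) (- i) = - (w ^^ t) i" if "i \<in> I" for t i
    using that by (induction t) (auto simp: w_neg wI)
  show thesis
  proof (rule that)
    show "f i \<noteq> 0" if "i \<in> I" for i using that by (simp add: f_def u_nz wI)
    show "f i * f (- i) = 1" if "i \<in> I" for i
      using that by (simp add: f_def wneg u_neg wI flip: prod.distrib power_mult_distrib)
    fix i assume i: "i \<in> I"
    have f_pow: "f i ^ q = (\<Prod>t<r. A i t)"
    proof -
      have "(u ((w ^^ t) i) ^ (q ^ (r - Suc t))) ^ q = A i t" if "t < r" for t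
      proof -
        have "r - t = Suc (r - Suc t)" using that by simp
        then have "q ^ (r - t) = q ^ (r - Suc t) * q" by simp
        then show ?thesis by (simp only: A_def power_mult)
      qed
      then show ?thesis unfolding f_def prod_power_distrib by (intro prod.cong) auto
    qed
    have f_w: "f (w i) = (\<Prod>t<r. A i (Suc t))"
      by (simp add: f_def A_def funpow_swap1)
    have "A i 0 * f (w i) = (\<Prod>t<Suc r. A i t)" unfolding f_w by (rule prod.lessThan_Suc_shift[symmetric])
    also have "\<dots> = f i ^ q * A i r" by (simp add: f_pow)
    finally have "u i ^ (q ^ r) * f (w i) = f i ^ q * u i" using r by (simp add: A_def)
    moreover have "u i ^ (q ^ r) = u i * u i ^ (q ^ r - 1)"     proof -
      have "q ^ r = Suc (q ^ r - 1)" using qr by simp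
      then show ?thesis by (metis power_Suc)
    qed
    ultimately have "u i ^ (q ^ r - 1) * f (w i) = f i ^ q" using u_nz[OF i] by simp
    then have "(u i ^ (q ^ r - 1) * s i) * f (w i) = s i * f i ^ q" by (simp only: mult_ac)
    then show "f (w i) = s i * f i ^ q" by (simp only: u_pow[OF i] mult_1)
  qed
qed

section \<open>The projective symplectic group and its Frobenius map\<close>

lemma (in group) center_normal: "group_center G \<lhd> G"
proof (rule normal_invI)
  show "subgroup (group_center G) G"
  proof (rule subgroupI)
    show "group_center G \<subseteq> carrier G" "group_center G \<noteq> {}" by (auto simp: group_center_def)
    show "inv a \<in> group_center G" if "a \<in> group_center G" for a
    proof -
      have a: "a \<in> carrier G" "\<And>x. x \<in> carrier G \<Longrightarrow> a \<otimes> x = x \<otimes> a" using that by (auto simp: group_center_def)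
      have "inv a \<otimes> x = x \<otimes> inv a" if x: "x \<in> carrier G" for x
      proof -
        have "inv a \<otimes> (a \<otimes> x) \<otimes> inv a = inv a \<otimes> (x \<otimes> a) \<otimes> inv a" using a(2)[OF x] by simp
        then show ?thesis using a(1) x by (simp add: m_assoc)
      qed
      then show ?thesis using a(1) by (simp add: group_center_def)
    qed
    show "a \<otimes> b \<in> group_center G" if "a \<in> group_center G" "b \<in> group_center G" for a b
    proof -
      have a: "a \<in> carrier G" "\<And>x. x \<in> carrier G \<Longrightarrow> a \<otimes> x = x \<otimes> a"
        and b: "b \<in> carrier G" "\<And>x. x \<in> carrier G \<Longrightarrow> b \<otimes> x = x \<otimes> b" using that by (auto simp: group_center_def)
      have "a \<otimes> b \<otimes> x = x \<otimes> (a \<otimes> b)" if x: "x \<in> carrier G" for x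
      proof -
        have "a \<otimes> b \<otimes> x = a \<otimes> (x \<otimes> b)" using a(1) b(1) x by (simp add: m_assoc b(2)[OF x])
        also have "\<dots> = x \<otimes> a \<otimes> b" using a(1) b(1) x by (simp add: m_assoc[symmetric] a(2)[OF x])
        finally show ?thesis using a(1) b(1) x by (simp add: m_assoc)
      qed
      then show ?thesis using a(1) b(1) by (simp add: group_center_def)
    qed
  qed
  show "x \<otimes> h \<otimes> inv x \<in> group_center G" if "x \<in> carrier G" "h \<in> group_center G" for x h
  proof -
    have comm: "h \<otimes> x = x \<otimes> h" and h: "h \<in> carrier G" using that unfolding group_center_def by blast+
    have "x \<otimes> h \<otimes> inv x = h" unfolding comm[symmetric] using that(1) h by (simp add: m_assoc)
    then show ?thesis using that by simp
  qed
qed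

lemma group_hom_PSp_proj: "group_hom (Sp n :: 'a::field mat monoid) (PSp n) (PSp_proj n)"
proof -
  interpret group "Sp n :: 'a mat monoid" by (rule group_Sp)
  interpret normal "group_center (Sp n)" "Sp n :: 'a mat monoid" by (rule center_normal)
  have "PSp_proj n \<in> hom (Sp n :: 'a mat monoid) (PSp n)"
    using r_coset_hom_Mod by (simp add: PSp_proj_def[abs_def] PSp_def)
  moreover have "group (PSp n :: 'a mat set monoid)" using factorgroup_is_group by (simp add: PSp_def)
  ultimately show ?thesis by (simp add: group_hom_def group_hom_axioms_def)
qed

lemma carrier_PSp: "carrier (PSp n) = PSp_proj n ` carrier (Sp n)"
  by (auto simp: PSp_def FactGroup_def RCOSETS_def PSp_proj_def)

lemma PSp_proj_eq:
  fixes A :: "'a::alg_closed_field mat"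
  assumes "n \<ge> 1" "A \<in> carrier (Sp n)"
  shows "PSp_proj n A = {A, - A}"
  using Sp_carrier[OF assms(2)] minus_one_mult[OF Sp_carrier[OF assms(2)]]
  by (auto simp: PSp_proj_def center_Sp[OF assms(1)] r_coset_def)

lemma uminus_Sp:
  assumes "A \<in> carrier (Sp n)"
  shows "- A \<in> carrier (Sp n :: 'a::field mat monoid)"
proof -
  interpret group "Sp n :: 'a mat monoid" by (rule group_Sp)
  have "- 1\<^sub>m (2 * n) \<in> carrier (Sp n :: 'a mat monoid)" unfolding minus_one_monomial by (simp add: monomial_Sp_iff)
  then show ?thesis using m_closed[OF _ assms] minus_one_mult[OF Sp_carrier[OF assms]] by fastforce
qed

lemma PSp_proj_eq_iff:
  fixes A :: "'a::alg_closed_field mat"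
  assumes "n \<ge> 1" "A \<in> carrier (Sp n)" "B \<in> carrier (Sp n)"
  shows "PSp_proj n A = PSp_proj n B \<longleftrightarrow> A = B \<or> A = - B"
proof -
  have "- (- A) = A" "- (- B) = B" by auto
  then show ?thesis using assms by (auto simp: PSp_proj_eq doubleton_eq_iff)
qed

lemma T0_eq: "T0 n = PSp_proj n ` (diag_torus n :: 'a::field mat set)"
proof -
  have fb: "four_block_mat (mat_diag n d) (0\<^sub>m n n) (0\<^sub>m n n) (mat_diag n e) =
      monomial n id (\<lambda>i. if i > 0 then d (mat_pos n i) else e (mat_pos n i - n))" for d e :: "nat \<Rightarrow> 'a"
  proof (rule matrix_eqI[of _ n])
    show "four_block_mat (mat_diag n d) (0\<^sub>m n n) (0\<^sub>m n n) (mat_diag n e) \<in> carrier_mat (2 * n) (2 * n)"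
      by (simp add: mult_2)
    fix i j assume ij: "i \<in> signed_indices n" "j \<in> signed_indices n"
    then show "entry n (four_block_mat (mat_diag n d) (0\<^sub>m n n) (0\<^sub>m n n) (mat_diag n e)) i j =
      entry n (monomial n id (\<lambda>i. if i > 0 then d (mat_pos n i) else e (mat_pos n i - n))) i j"
      unfolding entry_monomial[OF ij] unfolding entry_def
      by (elim signed_indices_cases) (auto simp: mat_diag_def)
  qed simp
  have "{four_block_mat (mat_diag n d) (0\<^sub>m n n) (0\<^sub>m n n) (mat_diag n (\<lambda>i. inverse (d i))) | d :: nat \<Rightarrow> 'a.
        \<forall>i < n. d i \<noteq> 0} = diag_torus n"
  proof (intro equalityI subsetI)
    fix x assume "x \<in> {four_block_mat (mat_diag n d) (0\<^sub>m n n) (0\<^sub>m n n) (mat_diag n (\<lambda>i. inverse (d i))) | d :: nat \<Rightarrow> 'a.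
        \<forall>i < n. d i \<noteq> 0}"
    then obtain d :: "nat \<Rightarrow> 'a" where d: "\<forall>i < n. d i \<noteq> 0"
      "x = monomial n id (\<lambda>i. if i > 0 then d (mat_pos n i) else inverse (d (mat_pos n i - n)))"
      using fb by auto
    have "(if i > 0 then d (mat_pos n i) else inverse (d (mat_pos n i - n))) *
        (if - i > 0 then d (mat_pos n (- i)) else inverse (d (mat_pos n (- i) - n))) = 1"
      if "i \<in> signed_indices n" for i
      using that d(1) by (auto simp: mat_pos_def signed_indices_def nat_diff_split)
    then show "x \<in> diag_torus n" unfolding diag_torus_def d(2) by blast
  next
    fix x :: "'a mat" assume "x \<in> diag_torus n"
    then obtain c where c: "\<forall>i\<in>signed_indices n. c i * c (- i) = 1" "x = monomial n id c" by (auto simp: diag_torus_def)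
    define d where "d = (\<lambda>l. c (int l + 1))"
    have dn: "\<forall>l<n. d l \<noteq> 0"
    proof (intro allI impI)
      fix l assume "l < n"
      then have "int l + 1 \<in> signed_indices n" by (auto simp: signed_indices_def)
      then show "d l \<noteq> 0" using c(1) by (force simp: d_def)
    qed
    have "x = monomial n id (\<lambda>i. if i > 0 then d (mat_pos n i) else inverse (d (mat_pos n i - n)))"
      unfolding c(2)
    proof (rule monomial_cong, intro conjI)
      fix i assume i: "i \<in> signed_indices n"
      then have cc: "c i * c (- i) = 1" using c(1) by blast
      show "c i = (if i > 0 then d (mat_pos n i) else inverse (d (mat_pos n i - n)))"
        using i
      proof (cases rule: signed_indices_cases)
        case (1 x)
        then show ?thesis by (simp add: d_def)
      next
        case (2 x)
        have "c (- i) = d x" using 2(2) by (simp add: d_def add.commute)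
        then have "c i = inverse (d x)" using cc by (metis inverse_unique mult.commute)
        then show ?thesis using 2 by simp
      qed
    qed simp
    then show "x \<in> {four_block_mat (mat_diag n d) (0\<^sub>m n n) (0\<^sub>m n n) (mat_diag n (\<lambda>i. inverse (d i))) | d :: nat \<Rightarrow> 'a.
        \<forall>i < n. d i \<noteq> 0}" unfolding fb[of d "\<lambda>l. inverse (d l)", symmetric] using dn by blast
  qed
  then show ?thesis by (simp only: T0_def)
qed

locale frobenius_power =
  fixes q :: nat and p_type :: "'a::alg_closed_field itself"
  assumes q_pow: "\<exists>e\<ge>1. q = CHAR('a) ^ e" and prime_char: "prime CHAR('a)"
begin

lemma q_gt_1: "q > 1"
proof -
  obtain e where "e \<ge> 1" "q = CHAR('a) ^ e" using q_pow by blast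
  moreover have "CHAR('a) > 1" using prime_char by (rule prime_gt_1_nat)
  ultimately show ?thesis using one_less_power[of "CHAR('a)" e] by simp
qed

lemma frob_sum: "(sum f S :: 'a) ^ q = (\<Sum>x\<in>S. f x ^ q)"
  using q_pow freshmans_dream_sum'[OF prime_char] by blast

lemma minus_one_q: "(- 1 :: 'a) ^ q = - 1"
proof -
  obtain e where "q = CHAR('a) ^ e" using q_pow by blast
  then have "(1 + - 1 :: 'a) ^ q = 1 ^ q + (- 1) ^ q" by (intro freshmans_dream'[OF prime_char])
  then show ?thesis using q_gt_1 by (simp add: power_0_left eq_neg_iff_add_eq_0 add.commute)
qed

lemma uminus_q: "(- x :: 'a) ^ q = - (x ^ q)"
  by (subst power_minus) (simp add: minus_one_q)

lemma sg_q: "(sg i :: 'a) ^ q = sg i"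
  using q_gt_1 minus_one_q by (auto simp: sgn_if)

lemma frob_mult:
  assumes "A \<in> carrier_mat (2 * n) (2 * n)" "B \<in> carrier_mat (2 * n) (2 * n)"
  shows "frob q (A * B :: 'a mat) = frob q A * frob q B"
proof (rule matrix_eqI[of _ n])
  show c: "frob q (A * B) \<in> carrier_mat (2 * n) (2 * n)" "frob q A * frob q B \<in> carrier_mat (2 * n) (2 * n)"
    using assms by (auto intro!: mult_carrier_mat[of _ _ "2 * n"] frob_carrier)
  fix i j assume ij: "i \<in> signed_indices n" "j \<in> signed_indices n"
  have "A * B \<in> carrier_mat (2 * n) (2 * n)" using assms by (rule mult_carrier_mat)
  then show "entry n (frob q (A * B)) i j = entry n (frob q A * frob q B) i j"
    using entry_mult[OF assms ij] entry_mult[OF frob_carrier[OF assms(1)] frob_carrier[OF assms(2)] ij] assms ij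
    by (simp add: frob_sum power_mult_distrib)
qed

lemma frob_uminus:
  assumes "A \<in> carrier_mat (2 * n) (2 * n)"
  shows "frob q (- A :: 'a mat) = - frob q A"
  by (rule matrix_eqI[of _ n]) (use assms in \<open>auto simp: uminus_q\<close>)

lemma frob_monomial: "frob q (monomial n v c :: 'a mat) = monomial n v (\<lambda>i. c i ^ q)"
  by (rule matrix_eqI[of _ n]) (use q_gt_1 in auto)

lemma frob_Sp:
  assumes A: "A \<in> carrier (Sp n)"
  shows "frob q (A :: 'a mat) \<in> carrier (Sp n)"
  unfolding Sp_entry_iff
proof (intro conjI ballI)
  have Am: "A \<in> carrier_mat (2 * n) (2 * n)" using A by (rule Sp_carrier)
  then show "frob q A \<in> carrier_mat (2 * n) (2 * n)" by simp
  fix i j assume ij: "i \<in> signed_indices n" "j \<in> signed_indices n"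
  have "(\<Sum>k\<in>signed_indices n. sg k * entry n (frob q A) k i * entry n (frob q A) (- k) j) =
      (\<Sum>k\<in>signed_indices n. sg k * entry n A k i * entry n A (- k) j) ^ q"
    using Am ij by (simp add: frob_sum power_mult_distrib sg_q)
  also have "\<dots> = (if j = - i then sg i else 0) ^ q" using A ij unfolding Sp_entry_iff by simp
  also have "\<dots> = (if j = - i then sg i else 0)" using q_gt_1 by (simp add: sg_q)
  finally show "(\<Sum>k\<in>signed_indices n. sg k * entry n (frob q A) k i * entry n (frob q A) (- k) j) =
      (if j = - i then sg i else 0)" .
qed

lemma PSp_frob_proj:
  assumes "n \<ge> 1" "A \<in> carrier (Sp n)"
  shows "PSp_frob q (PSp_proj n A) = PSp_proj n (frob q (A :: 'a mat))"
  using assms frob_uminus[OF Sp_carrier[OF assms(2)]] by (simp add: PSp_frob_def PSp_proj_eq frob_Sp)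

end

section \<open>Reduction to equivariant monomial matrices\<close>

lemma monomial_eq_iff:
  assumes "\<And>i. i \<in> signed_indices n \<Longrightarrow> v i \<in> signed_indices n" "\<And>i. i \<in> signed_indices n \<Longrightarrow> c i \<noteq> 0"
  shows "monomial n v c = monomial n u d \<longleftrightarrow> (\<forall>i\<in>signed_indices n. v i = u i \<and> c i = d i)"
proof
  assume eq: "monomial n v c = monomial n u d"
  show "\<forall>i\<in>signed_indices n. v i = u i \<and> c i = d i"
  proof
    fix i assume i: "i \<in> signed_indices n"
    have "entry n (monomial n v c) i (v i) = entry n (monomial n u d) i (v i)" using eq by simp
    then show "v i = u i \<and> c i = d i" using assms i by (auto split: if_splits)
  qed
qed (rule monomial_cong, blast)

lemma monomial_diag_torus:
  assumes v: "v \<in> Sl n" and t: "t \<in> diag_torus n"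
  shows "\<exists>t'\<in>diag_torus n. monomial n v c * t = t' * monomial n v c"
    and "\<exists>t'\<in>diag_torus n. t * monomial n v c = monomial n v c * t'"
proof -
  obtain d where d: "\<forall>i\<in>signed_indices n. d i * d (- i) = 1" "t = monomial n id d"
    using t by (auto simp: diag_torus_def)
  have vI: "v i \<in> signed_indices n \<longleftrightarrow> i \<in> signed_indices n" for i using SlD(2)[OF v] .
  have "monomial n id (d \<circ> v) \<in> diag_torus n"
    unfolding diag_torus_def using d(1) SlD[OF v] by force
  moreover have "monomial n v c * t = monomial n id (d \<circ> v) * monomial n v c"
    unfolding d(2) by (subst (1 2) monomial_mult) (auto simp: vI mult.commute)
  ultimately show "\<exists>t'\<in>diag_torus n. monomial n v c * t = t' * monomial n v c" by blast
  define v' where "v' = inv_into UNIV v"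
  have v': "v (v' i) = i" "v' (v i) = i" for i
    using SlD(1)[OF v] by (auto simp: v'_def permutes_inverses)
  have v'I: "v' i \<in> signed_indices n \<longleftrightarrow> i \<in> signed_indices n" for i using vI[of "v' i"] v' by simp
  have "v' (- i) = - v' i" if "i \<in> signed_indices n" for i
    using SlD(3)[OF v, of "v' i"] v'I that v' by metis
  then have "monomial n id (d \<circ> v') \<in> diag_torus n"
    unfolding diag_torus_def using d(1) v'I by force
  moreover have "t * monomial n v c = monomial n v c * monomial n id (d \<circ> v')"
    unfolding d(2) by (subst (1 2) monomial_mult) (auto simp: vI v' mult.commute)
  ultimately show "\<exists>t'\<in>diag_torus n. t * monomial n v c = monomial n v c * t'" by blast
qed

text \<open>
  The matrix \<open>\<gamma>\<close> conjugates the torus \<open>conj_torus\<close> to the diagonal one; \<open>to_std\<close> and \<open>from_std\<close> are the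
  two directions of this conjugation on matrices.
\<close>
locale twisted_torus = frobenius_power q "TYPE('a)"
  for q :: nat and n :: nat and \<gamma> :: "'a::alg_closed_field mat" and w :: "int \<Rightarrow> int" and c0 :: "int \<Rightarrow> 'a" +
  assumes n1: "n \<ge> 1" and \<gamma>: "\<gamma> \<in> carrier (Sp n)" and w: "w \<in> Sl n"
    and frob_\<gamma>: "frob q \<gamma> = monomial n w c0 * \<gamma>"
begin

sublocale P: group_hom "Sp n :: 'a mat monoid" "PSp n" "PSp_proj n"
  by (rule group_hom_PSp_proj)

abbreviation S where "S \<equiv> Sp n :: 'a mat monoid"
abbreviation J where "J \<equiv> signed_indices n"
abbreviation M where "M \<equiv> monomial n w c0"

definition from_std :: "'a mat \<Rightarrow> 'a mat" where "from_std X = inv\<^bsub>S\<^esub> \<gamma> \<otimes>\<^bsub>S\<^esub> X \<otimes>\<^bsub>S\<^esub> \<gamma>"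
definition to_std :: "'a mat \<Rightarrow> 'a mat" where "to_std A = \<gamma> \<otimes>\<^bsub>S\<^esub> A \<otimes>\<^bsub>S\<^esub> inv\<^bsub>S\<^esub> \<gamma>"
definition conj_torus where "conj_torus = inv\<^bsub>PSp n\<^esub> (PSp_proj n \<gamma>) <#\<^bsub>PSp n\<^esub> T0 n #>\<^bsub>PSp n\<^esub> PSp_proj n \<gamma>"

lemma mult_S: "A * B = A \<otimes>\<^bsub>S\<^esub> B" by simp

declare Sp_mult [simp del] Sp_one [simp del]

lemma from_std_closed [simp]: "X \<in> carrier S \<Longrightarrow> from_std X \<in> carrier S"
  using \<gamma> by (simp add: from_std_def)

lemma to_std_closed [simp]: "X \<in> carrier S \<Longrightarrow> to_std X \<in> carrier S"
  using \<gamma> by (simp add: to_std_def)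

lemma to_from_std [simp]: "X \<in> carrier S \<Longrightarrow> to_std (from_std X) = X"
  using \<gamma> by (simp add: to_std_def from_std_def P.G.m_assoc)

lemma from_to_std [simp]: "X \<in> carrier S \<Longrightarrow> from_std (to_std X) = X"
  using \<gamma> by (simp add: to_std_def from_std_def P.G.m_assoc)

lemma to_std_mult: "A \<in> carrier S \<Longrightarrow> B \<in> carrier S \<Longrightarrow> to_std (A \<otimes>\<^bsub>S\<^esub> B) = to_std A \<otimes>\<^bsub>S\<^esub> to_std B"
  using \<gamma> by (simp add: to_std_def P.G.m_assoc)

lemma from_std_mult: "A \<in> carrier S \<Longrightarrow> B \<in> carrier S \<Longrightarrow> from_std (A \<otimes>\<^bsub>S\<^esub> B) = from_std A \<otimes>\<^bsub>S\<^esub> from_std B"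
  using \<gamma> by (simp add: from_std_def P.G.m_assoc)

lemma to_std_inv: "A \<in> carrier S \<Longrightarrow> to_std (inv\<^bsub>S\<^esub> A) = inv\<^bsub>S\<^esub> (to_std A)"
  using \<gamma> by (simp add: to_std_def P.G.inv_mult_group P.G.m_assoc)

lemma to_std_uminus: assumes "A \<in> carrier S" shows "to_std (- A) = - to_std A"
proof -
  let ?z = "- 1\<^sub>m (2 * n) :: 'a mat"
  have z: "?z \<in> group_center S" by (simp add: center_Sp[OF n1])
  then have zS: "?z \<in> carrier S" and zc: "\<And>x. x \<in> carrier S \<Longrightarrow> \<gamma> \<otimes>\<^bsub>S\<^esub> ?z = ?z \<otimes>\<^bsub>S\<^esub> \<gamma>"
    using \<gamma> by (auto simp: group_center_def)
  have zm: "- B = ?z \<otimes>\<^bsub>S\<^esub> B" if "B \<in> carrier S" for B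
    using minus_one_mult[OF Sp_carrier[OF that]] by (simp add: Sp_mult)
  have "to_std (?z \<otimes>\<^bsub>S\<^esub> A) = (\<gamma> \<otimes>\<^bsub>S\<^esub> ?z) \<otimes>\<^bsub>S\<^esub> A \<otimes>\<^bsub>S\<^esub> inv\<^bsub>S\<^esub> \<gamma>"
    unfolding to_std_def using assms \<gamma> zS by (simp add: P.G.m_assoc)
  also have "\<dots> = ?z \<otimes>\<^bsub>S\<^esub> to_std A" unfolding zc[OF \<gamma>] to_std_def using assms \<gamma> zS by (simp add: P.G.m_assoc)
  finally show ?thesis using zm[OF assms] zm[OF to_std_closed[OF assms]] by simp
qed

lemma inv_cancel_S: "s \<in> carrier S \<Longrightarrow> x \<in> carrier S \<Longrightarrow> inv\<^bsub>S\<^esub> s \<otimes>\<^bsub>S\<^esub> (s \<otimes>\<^bsub>S\<^esub> x) = x"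
  "s \<in> carrier S \<Longrightarrow> x \<in> carrier S \<Longrightarrow> s \<otimes>\<^bsub>S\<^esub> (inv\<^bsub>S\<^esub> s \<otimes>\<^bsub>S\<^esub> x) = x"
  by simp_all

lemma diag_torus_S: "t \<in> diag_torus n \<Longrightarrow> t \<in> carrier S"
  using diag_torus_Sp by blast

lemma diag_torus_uminus: "t \<in> diag_torus n \<Longrightarrow> - t \<in> (diag_torus n :: 'a mat set)"
proof -
  assume "t \<in> diag_torus n"
  then obtain d where d: "\<forall>i\<in>J. d i * d (- i) = 1" "t = monomial n id d" by (auto simp: diag_torus_def)
  have "- t = monomial n id (\<lambda>i. - d i)" unfolding d(2) by (rule matrix_eqI[of _ n]) auto
  then show ?thesis unfolding diag_torus_def using d(1) by force
qed

lemma conj_torus_eq: "conj_torus = (\<lambda>t. PSp_proj n (from_std t)) ` diag_torus n"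
proof -
  have "PSp_proj n (from_std t) = inv\<^bsub>PSp n\<^esub> (PSp_proj n \<gamma>) \<otimes>\<^bsub>PSp n\<^esub> PSp_proj n t \<otimes>\<^bsub>PSp n\<^esub> PSp_proj n \<gamma>"
    if "t \<in> diag_torus n" for t
    using diag_torus_S[OF that] \<gamma> by (simp add: from_std_def)
  then show ?thesis by (auto simp: conj_torus_def T0_eq l_coset_def r_coset_def)
qed

lemma conj_torus_mem: assumes A: "A \<in> carrier S" shows "PSp_proj n A \<in> conj_torus \<longleftrightarrow> to_std A \<in> diag_torus n"
proof
  assume "PSp_proj n A \<in> conj_torus"
  then obtain t where t: "t \<in> diag_torus n" "PSp_proj n A = PSp_proj n (from_std t)" unfolding conj_torus_eq by blast
  have tS: "t \<in> carrier S" using diag_torus_S t by blast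
  then have "A = from_std t \<or> A = - from_std t" using PSp_proj_eq_iff[OF n1 A from_std_closed] t(2) by blast
  then have "to_std A = t \<or> to_std A = - t" using to_std_uminus[OF from_std_closed[OF tS]] tS by auto
  then show "to_std A \<in> diag_torus n" using t(1) diag_torus_uminus by auto
next
  assume "to_std A \<in> diag_torus n"
  then show "PSp_proj n A \<in> conj_torus" unfolding conj_torus_eq using from_to_std[OF A] by (metis image_eqI)
qed

lemma conj_torus_carrier: "conj_torus \<subseteq> carrier (PSp n)"
  unfolding conj_torus_eq using diag_torus_S by auto

lemma conj_torus_elim: assumes "y \<in> conj_torus" obtains B where "B \<in> carrier S" "to_std B \<in> diag_torus n" "y = PSp_proj n B"
proof -
  obtain t where t: "t \<in> diag_torus n" "y = PSp_proj n (from_std t)" using assms unfolding conj_torus_eq by blast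
  then show thesis using that[of "from_std t"] diag_torus_S by auto
qed

text \<open>
  All matrices over a coset of the center lie in the torus if one does, so the condition in the
  projective group is one on matrices.
\<close>
lemma normalizer_mem:
  assumes A: "A \<in> carrier S"
  shows "PSp_proj n A \<in> normalizer (PSp n) conj_torus \<longleftrightarrow> (\<exists>v\<in>Sl n. \<exists>c. to_std A = monomial n v c)"
proof -
  let ?x = "PSp_proj n A"
  have xN: "?x \<in> normalizer (PSp n) conj_torus \<longleftrightarrow> (\<lambda>y. ?x \<otimes>\<^bsub>PSp n\<^esub> y \<otimes>\<^bsub>PSp n\<^esub> inv\<^bsub>PSp n\<^esub> ?x) ` conj_torus = conj_torus"
  proof -
    have "?x <#\<^bsub>PSp n\<^esub> conj_torus #>\<^bsub>PSp n\<^esub> inv\<^bsub>PSp n\<^esub> ?x = (\<lambda>y. ?x \<otimes>\<^bsub>PSp n\<^esub> y \<otimes>\<^bsub>PSp n\<^esub> inv\<^bsub>PSp n\<^esub> ?x) ` conj_torus"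
      by (auto simp: l_coset_def r_coset_def)
    then show ?thesis using A conj_torus_carrier by (simp add: normalizer_def stabilizer_def)
  qed
  show ?thesis
  proof
    assume "?x \<in> normalizer (PSp n) conj_torus"
    then have N: "(\<lambda>y. ?x \<otimes>\<^bsub>PSp n\<^esub> y \<otimes>\<^bsub>PSp n\<^esub> inv\<^bsub>PSp n\<^esub> ?x) ` conj_torus = conj_torus" using xN by simp
    show "\<exists>v\<in>Sl n. \<exists>c. to_std A = monomial n v c"
    proof (rule monomial_if_normalizes)
      show "to_std A \<in> carrier S" using A by simp
      fix t :: "'a mat" assume t: "t \<in> diag_torus n"
      have tS: "t \<in> carrier S" using diag_torus_S t by blast
      let ?t' = "to_std A \<otimes>\<^bsub>S\<^esub> t \<otimes>\<^bsub>S\<^esub> inv\<^bsub>S\<^esub> (to_std A)"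
      have "PSp_proj n (from_std t) \<in> conj_torus" unfolding conj_torus_eq using t by blast
      then have "?x \<otimes>\<^bsub>PSp n\<^esub> PSp_proj n (from_std t) \<otimes>\<^bsub>PSp n\<^esub> inv\<^bsub>PSp n\<^esub> ?x \<in> conj_torus" using N by blast
      moreover have "PSp_proj n (A \<otimes>\<^bsub>S\<^esub> from_std t \<otimes>\<^bsub>S\<^esub> inv\<^bsub>S\<^esub> A) =
          ?x \<otimes>\<^bsub>PSp n\<^esub> PSp_proj n (from_std t) \<otimes>\<^bsub>PSp n\<^esub> inv\<^bsub>PSp n\<^esub> ?x" using A tS by simp
      ultimately have "PSp_proj n (A \<otimes>\<^bsub>S\<^esub> from_std t \<otimes>\<^bsub>S\<^esub> inv\<^bsub>S\<^esub> A) \<in> conj_torus" by (simp only:)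
      then have "to_std (A \<otimes>\<^bsub>S\<^esub> from_std t \<otimes>\<^bsub>S\<^esub> inv\<^bsub>S\<^esub> A) \<in> diag_torus n" by (rule conj_torus_mem[THEN iffD1, rotated]) (use A tS in simp)
      then have "?t' \<in> diag_torus n" using A tS by (simp add: to_std_mult to_std_inv)
      moreover have "to_std A * t = ?t' * to_std A" using A tS by (simp add: mult_S P.G.m_assoc)
      ultimately show "\<exists>t'\<in>diag_torus n. to_std A * t = t' * to_std A" by blast
    qed
  next
    assume "\<exists>v\<in>Sl n. \<exists>c. to_std A = monomial n v c"
    then obtain v c where v: "v \<in> Sl n" "to_std A = monomial n v c" by blast
    have conj1: "to_std A \<otimes>\<^bsub>S\<^esub> t \<otimes>\<^bsub>S\<^esub> inv\<^bsub>S\<^esub> (to_std A) \<in> diag_torus n" if t: "t \<in> diag_torus n" for t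
    proof -
      obtain t' where t': "t' \<in> diag_torus n" "to_std A \<otimes>\<^bsub>S\<^esub> t = t' \<otimes>\<^bsub>S\<^esub> to_std A"
        using monomial_diag_torus(1)[OF v(1) t, of c] v(2) by (auto simp: mult_S)
      then have "to_std A \<otimes>\<^bsub>S\<^esub> t \<otimes>\<^bsub>S\<^esub> inv\<^bsub>S\<^esub> (to_std A) = t'" using A diag_torus_S by (simp add: P.G.m_assoc)
      then show ?thesis using t'(1) by simp
    qed
    have conj2: "inv\<^bsub>S\<^esub> (to_std A) \<otimes>\<^bsub>S\<^esub> t \<otimes>\<^bsub>S\<^esub> to_std A \<in> diag_torus n" if t: "t \<in> diag_torus n" for t
    proof -
      obtain t' where t': "t' \<in> diag_torus n" "t \<otimes>\<^bsub>S\<^esub> to_std A = to_std A \<otimes>\<^bsub>S\<^esub> t'"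
        using monomial_diag_torus(2)[OF v(1) t, of c] v(2) by (auto simp: mult_S)
      then have "inv\<^bsub>S\<^esub> (to_std A) \<otimes>\<^bsub>S\<^esub> t \<otimes>\<^bsub>S\<^esub> to_std A = t'" using A diag_torus_S t by (simp add: P.G.m_assoc)
      then show ?thesis using t'(1) by simp
    qed
    have "(\<lambda>y. ?x \<otimes>\<^bsub>PSp n\<^esub> y \<otimes>\<^bsub>PSp n\<^esub> inv\<^bsub>PSp n\<^esub> ?x) ` conj_torus = conj_torus"
    proof (intro equalityI subsetI)
      fix y assume "y \<in> (\<lambda>y. ?x \<otimes>\<^bsub>PSp n\<^esub> y \<otimes>\<^bsub>PSp n\<^esub> inv\<^bsub>PSp n\<^esub> ?x) ` conj_torus"
      then obtain B where B: "B \<in> carrier S" "to_std B \<in> diag_torus n"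
        "y = ?x \<otimes>\<^bsub>PSp n\<^esub> PSp_proj n B \<otimes>\<^bsub>PSp n\<^esub> inv\<^bsub>PSp n\<^esub> ?x" by (auto elim!: conj_torus_elim)
      then have y: "y = PSp_proj n (A \<otimes>\<^bsub>S\<^esub> B \<otimes>\<^bsub>S\<^esub> inv\<^bsub>S\<^esub> A)" using A by simp
      have "to_std (A \<otimes>\<^bsub>S\<^esub> B \<otimes>\<^bsub>S\<^esub> inv\<^bsub>S\<^esub> A) \<in> diag_torus n" using A B conj1 by (simp add: to_std_mult to_std_inv)
      then show "y \<in> conj_torus" unfolding y by (rule conj_torus_mem[THEN iffD2, rotated]) (use A B in simp)
    next
      fix y assume "y \<in> conj_torus"
      then obtain B where B: "B \<in> carrier S" "to_std B \<in> diag_torus n" "y = PSp_proj n B" by (rule conj_torus_elim)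
      let ?B = "inv\<^bsub>S\<^esub> A \<otimes>\<^bsub>S\<^esub> B \<otimes>\<^bsub>S\<^esub> A"
      have "PSp_proj n ?B \<in> conj_torus" using A B conj2 by (simp add: conj_torus_mem to_std_mult to_std_inv del: P.hom_mult)
      moreover have "y = ?x \<otimes>\<^bsub>PSp n\<^esub> PSp_proj n ?B \<otimes>\<^bsub>PSp n\<^esub> inv\<^bsub>PSp n\<^esub> ?x"
        using A B by (simp add: P.H.m_assoc)
      ultimately show "y \<in> (\<lambda>y. ?x \<otimes>\<^bsub>PSp n\<^esub> y \<otimes>\<^bsub>PSp n\<^esub> inv\<^bsub>PSp n\<^esub> ?x) ` conj_torus" by blast
    qed
    then show "?x \<in> normalizer (PSp n) conj_torus" using xN by simp
  qed
qed

lemma Sp_fin_carrier: "A \<in> Sp_fin n q \<Longrightarrow> A \<in> carrier S"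
  by (simp add: Sp_fin_def)

lemma torus_fin: "conj_torus \<inter> PSp_fin n q = PSp_proj n ` {A \<in> Sp_fin n q. to_std A \<in> diag_torus n}"
  unfolding PSp_fin_def using conj_torus_mem Sp_fin_carrier by auto

lemma normalizer_fin:
  "normalizer (PSp n) conj_torus \<inter> PSp_fin n q = PSp_proj n ` {A \<in> Sp_fin n q. \<exists>v\<in>Sl n. \<exists>c. to_std A = monomial n v c}"
  unfolding PSp_fin_def using normalizer_mem Sp_fin_carrier by auto

lemma M_eq: "M = frob q \<gamma> \<otimes>\<^bsub>S\<^esub> inv\<^bsub>S\<^esub> \<gamma>"
proof -
  have "frob q \<gamma> * inv\<^bsub>S\<^esub> \<gamma> = M * (\<gamma> * inv\<^bsub>S\<^esub> \<gamma>)"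
    unfolding frob_\<gamma> using Sp_carrier[OF \<gamma>] Sp_carrier[OF P.G.inv_closed[OF \<gamma>]]
    by (intro assoc_mult_mat[of _ "2 * n" "2 * n" _ "2 * n" _ "2 * n"]) auto
  also have "\<gamma> * inv\<^bsub>S\<^esub> \<gamma> = 1\<^sub>m (2 * n)" using P.G.r_inv[OF \<gamma>] by (simp add: Sp_mult Sp_one)
  finally show ?thesis by (simp add: Sp_mult right_mult_one_mat[OF monomial_carrier])
qed

lemma M_S: "M \<in> carrier S"
  unfolding M_eq using frob_Sp[OF \<gamma>] \<gamma> by simp

lemma frob_hom: "group_hom S S (frob q)"
  using frob_Sp frob_mult[OF Sp_carrier Sp_carrier] P.G.is_group
  by (auto simp: group_hom_def group_hom_axioms_def hom_def Sp_mult)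

text \<open>
  In the standard position, the Frobenius map is followed by conjugation with the inverse of \<open>M\<close>.
\<close>
lemma frob_down:
  assumes X: "X \<in> carrier S"
  shows "frob q (from_std X) = from_std X \<longleftrightarrow> frob q X \<otimes>\<^bsub>S\<^esub> M = M \<otimes>\<^bsub>S\<^esub> X"
proof -
  interpret F: group_hom S S "frob q" by (rule frob_hom)
  have fX: "frob q X \<in> carrier S" using X by simp
  have "frob q (from_std X) = inv\<^bsub>S\<^esub> (frob q \<gamma>) \<otimes>\<^bsub>S\<^esub> frob q X \<otimes>\<^bsub>S\<^esub> frob q \<gamma>"
    using X \<gamma> by (simp add: from_std_def)
  also have "frob q \<gamma> = M \<otimes>\<^bsub>S\<^esub> \<gamma>" using frob_\<gamma> by (simp add: Sp_mult)
  also have "inv\<^bsub>S\<^esub> (M \<otimes>\<^bsub>S\<^esub> \<gamma>) \<otimes>\<^bsub>S\<^esub> frob q X \<otimes>\<^bsub>S\<^esub> (M \<otimes>\<^bsub>S\<^esub> \<gamma>) = from_std (inv\<^bsub>S\<^esub> M \<otimes>\<^bsub>S\<^esub> (frob q X \<otimes>\<^bsub>S\<^esub> M))"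
    using M_S \<gamma> fX by (simp add: from_std_def P.G.inv_mult_group P.G.m_assoc)
  finally have "frob q (from_std X) = from_std X \<longleftrightarrow> from_std (inv\<^bsub>S\<^esub> M \<otimes>\<^bsub>S\<^esub> (frob q X \<otimes>\<^bsub>S\<^esub> M)) = from_std X" by simp
  also have "\<dots> \<longleftrightarrow> inv\<^bsub>S\<^esub> M \<otimes>\<^bsub>S\<^esub> (frob q X \<otimes>\<^bsub>S\<^esub> M) = X"
    using to_from_std[of X] to_from_std[of "inv\<^bsub>S\<^esub> M \<otimes>\<^bsub>S\<^esub> (frob q X \<otimes>\<^bsub>S\<^esub> M)"] X fX M_S by (metis P.G.inv_closed P.G.m_closed)
  also have "\<dots> \<longleftrightarrow> frob q X \<otimes>\<^bsub>S\<^esub> M = M \<otimes>\<^bsub>S\<^esub> X"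
    using M_S X fX by (metis P.G.inv_closed P.G.m_closed inv_cancel_S)
  finally show ?thesis .
qed

end

context twisted_torus begin

lemma c0_props: assumes "i \<in> J" shows "c0 i * c0 (- i) * sg i = sg (w i)" "c0 i \<noteq> 0"
proof -
  show *: "c0 i * c0 (- i) * sg i = sg (w i)" using M_S assms by (simp add: monomial_Sp_iff[OF w])
  have "w i \<in> J" using assms SlD(2)[OF w] by simp
  then have "(sg (w i) :: 'a) \<noteq> 0" by simp
  then show "c0 i \<noteq> 0" using * by auto
qed

text \<open>
  A diagonal change of basis \<open>e\<close> which turns \<open>M\<close> into the permutation matrix of \<open>w\<close> and the standard form
  into the one given by \<open>\<beta>\<close>. First match the form by \<open>e0\<close>; the remaining freedom is the diagonal torus,
  where Lang's theorem applies.
\<close>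
lemma rescaling_exists:
  assumes "frobenius_twist J w q (\<beta> :: int \<Rightarrow> 'a)"
  obtains e :: "int \<Rightarrow> 'a" where "\<And>i. i \<in> J \<Longrightarrow> e i \<noteq> 0" "\<And>i. i \<in> J \<Longrightarrow> e (w i) * c0 i = e i ^ q"
    "\<And>i. i \<in> J \<Longrightarrow> e i * e (- i) * \<beta> i = sg i"
proof -
  interpret frobenius_twist J w q \<beta> by fact
  define l where "l = (\<lambda>i. sg i / \<beta> i)"
  have l0: "l i \<noteq> 0" if "i \<in> J" for i using that \<beta>_nonzero by (simp add: l_def)
  have l_neg: "l (- i) = l i" if "i \<in> J" for i using that by (simp add: l_def \<beta>_neg sgn_minus)
  have l_w: "l (w i) * (c0 i * c0 (- i)) = l i ^ q" if i: "i \<in> J" for i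
  proof -
    have "c0 i * c0 (- i) = sg (w i) * sg i"
    proof -
      have "c0 i * c0 (- i) * sg i * sg i = sg (w i) * sg i" using c0_props(1)[OF i] by simp
      then show ?thesis using sg_square[OF i, where 'a = 'a] by (simp add: mult.assoc)
    qed
    moreover have "sg (w i) * sg (w i) = (1::'a)"
    proof -
      have "w i \<in> J" using i w_closed by blast
      then show ?thesis by (rule sg_square)
    qed
    ultimately have "l (w i) * (c0 i * c0 (- i)) = sg i / \<beta> (w i)"
      by (simp add: l_def)
    then show ?thesis using i by (simp add: l_def power_divide sg_q \<beta>_w)
  qed
  define e0 where "e0 = (\<lambda>i. if i > 0 then 1 else l i)"
  have e0_nz: "e0 i \<noteq> 0" if "i \<in> J" for i using l0[OF that] by (simp add: e0_def)
  have e0_neg: "e0 i * e0 (- i) = l i" if "i \<in> J" for i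
  proof -
    have "i \<noteq> 0" using that by auto
    then show ?thesis using l_neg[OF that] by (auto simp: e0_def)
  qed
  define s where "s = (\<lambda>i. e0 i ^ q / (c0 i * e0 (w i)))"
  have s0: "s i \<noteq> 0" if "i \<in> J" for i using that e0_nz c0_props by (simp add: s_def)
  have ss: "s i * s (- i) = 1" if i: "i \<in> J" for i
  proof -
    have "s i * s (- i) = (e0 i * e0 (- i)) ^ q / ((c0 i * c0 (- i)) * (e0 (w i) * e0 (- w i)))"
      using i by (simp add: s_def w_neg power_mult_distrib)
    also have "\<dots> = l i ^ q / ((c0 i * c0 (- i)) * l (w i))" using i e0_neg by simp
    also have "\<dots> = 1" using l_w[OF i] l0[OF i] by (simp add: mult.commute)
    finally show ?thesis .
  qed
  obtain f where f: "\<And>i. i \<in> J \<Longrightarrow> f i \<noteq> 0" "\<And>i. i \<in> J \<Longrightarrow> f i * f (- i) = 1"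
    "\<And>i. i \<in> J \<Longrightarrow> f (w i) = s i * f i ^ q"
    by (rule lang_diagonal[where q = q and s = s, OF finite_signed_indices q_gt_1 s0 ss]) metis+
  show thesis
  proof (rule that[of "\<lambda>i. e0 i * f i"])
    fix i assume i: "i \<in> J"
    show "e0 i * f i \<noteq> 0" using i f e0_nz by simp
    show "e0 (w i) * f (w i) * c0 i = (e0 i * f i) ^ q"
      using f(3)[OF i] i e0_nz[of "w i"] c0_props(2)[OF i] by (simp add: s_def power_mult_distrib field_simps)
    have "e0 i * f i * (e0 (- i) * f (- i)) * \<beta> i = (e0 i * e0 (- i)) * (f i * f (- i)) * \<beta> i" by (simp only: mult_ac)
    then show "e0 i * f i * (e0 (- i) * f (- i)) * \<beta> i = sg i"
      using i f(2) e0_neg \<beta>_nonzero by (simp add: l_def)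
  qed
qed

text \<open>
  The freedom of choice for \<open>\<beta>\<close> is used twice: \<open>\<beta> = 1\<close> in characteristic 2, and a form that is the same
  on blocks of the same kind otherwise.
\<close>
theorem complement_iff_torus_complemented:
  fixes \<beta> :: "int \<Rightarrow> 'a"
  assumes tw: "frobenius_twist J w q \<beta>"
  shows "has_complement (PSp n) (conj_torus \<inter> PSp_fin n q) (normalizer (PSp n) conj_torus \<inter> PSp_fin n q) \<longleftrightarrow>
    frobenius_twist.torus_complemented J w q \<beta>"
proof -
  interpret F: frobenius_twist J w q \<beta> by fact
  obtain e :: "int \<Rightarrow> 'a" where e: "\<And>i. i \<in> J \<Longrightarrow> e i \<noteq> 0" "\<And>i. i \<in> J \<Longrightarrow> e (w i) * c0 i = e i ^ q"
    "\<And>i. i \<in> J \<Longrightarrow> e i * e (- i) * \<beta> i = sg i"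
    using rescaling_exists[OF tw] by blast
  \<comment> \<open>conjugation with the diagonal matrix of \<open>e\<close>\<close>
  define resc :: "(int \<Rightarrow> int) \<Rightarrow> (int \<Rightarrow> 'a) \<Rightarrow> int \<Rightarrow> 'a" where "resc = (\<lambda>v c i. c i * e i / e (v i))"
  define emb where "emb = (\<lambda>(v, c). monomial n v (resc v c))"
  have emb_vc: "emb (v, c) = monomial n v (resc v c)" for v c by (simp add: emb_def)
  have wJ: "w i \<in> J \<longleftrightarrow> i \<in> J" for i by simp
  have S_iff: "monomial n v (resc v c) \<in> carrier S \<longleftrightarrow> (\<forall>i\<in>J. c i * c (- i) = \<beta> i / \<beta> (v i))"
    if v: "v \<in> Sl n" for v c
  proof -
    have "resc v c i * resc v c (- i) * sg i = sg (v i) \<longleftrightarrow> c i * c (- i) = \<beta> i / \<beta> (v i)" if i: "i \<in> J" for i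
    proof -
      have vi: "v i \<in> J" "v (- i) = - v i" using SlD[OF v] i by auto
      have nz: "e i \<noteq> 0" "e (- i) \<noteq> 0" "e (v i) \<noteq> 0" "e (- v i) \<noteq> 0" "\<beta> i \<noteq> 0" "\<beta> (v i) \<noteq> 0"
        using e(1) i vi F.\<beta>_nonzero by auto
      have E: "e i * e (- i) = sg i / \<beta> i" "e (v i) * e (- v i) = sg (v i) / \<beta> (v i)"
        using e(3)[OF i] e(3)[OF vi(1)] nz by (simp_all add: field_simps)
      have sq: "sg i * sg i = (1::'a)" "sg (v i) * sg (v i) = (1::'a)" using i vi by simp_all
      have "resc v c i * resc v c (- i) * sg i = c i * c (- i) * (e i * e (- i)) / (e (v i) * e (- v i)) * sg i"
        using vi(2) by (simp add: resc_def)
      also have "\<dots> = (c i * c (- i)) * (\<beta> (v i) / \<beta> i) * (sg i * sg i) / sg (v i)"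
        unfolding E using nz by (simp add: field_simps)
      also have "\<dots> = (c i * c (- i)) * (\<beta> (v i) / \<beta> i) / sg (v i)" using sq by simp
      finally have "resc v c i * resc v c (- i) * sg i = (c i * c (- i)) * (\<beta> (v i) / \<beta> i) / sg (v i)" .
      moreover have "x / sg (v i) = sg (v i) \<longleftrightarrow> x = (1::'a)" for x
        using vi(1) sq(2) by (simp add: field_simps)
      ultimately have "resc v c i * resc v c (- i) * sg i = sg (v i) \<longleftrightarrow> (c i * c (- i)) * (\<beta> (v i) / \<beta> i) = 1"
        by (simp only:)
      also have "\<dots> \<longleftrightarrow> c i * c (- i) = \<beta> i / \<beta> (v i)" using nz by (simp add: field_simps)
      finally show ?thesis .
    qed
    then show ?thesis by (simp add: monomial_Sp_iff[OF v])
  qed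
  have frob_iff: "frob q (monomial n v (resc v c)) \<otimes>\<^bsub>S\<^esub> M = M \<otimes>\<^bsub>S\<^esub> monomial n v (resc v c) \<longleftrightarrow>
      (\<forall>i\<in>J. v (w i) = w (v i) \<and> c (w i) = c i ^ q)"
    if v: "v \<in> Sl n" and c: "\<And>i. i \<in> J \<Longrightarrow> c i \<noteq> 0" for v c
  proof -
    have vJ: "v i \<in> J \<longleftrightarrow> i \<in> J" for i using SlD(2)[OF v] .
    have "frob q (monomial n v (resc v c)) \<otimes>\<^bsub>S\<^esub> M = monomial n (w \<circ> v) (\<lambda>i. resc v c i ^ q * c0 (v i))"
      unfolding frob_monomial Sp_mult by (rule monomial_mult) (auto simp: vJ)
    moreover have "M \<otimes>\<^bsub>S\<^esub> monomial n v (resc v c) = monomial n (v \<circ> w) (\<lambda>i. c0 i * resc v c (w i))"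
      unfolding Sp_mult by (rule monomial_mult) (auto simp: vJ)
    moreover have "monomial n (w \<circ> v) (\<lambda>i. resc v c i ^ q * c0 (v i)) = monomial n (v \<circ> w) (\<lambda>i. c0 i * resc v c (w i))
       \<longleftrightarrow> (\<forall>i\<in>J. (w \<circ> v) i = (v \<circ> w) i \<and> resc v c i ^ q * c0 (v i) = c0 i * resc v c (w i))"
      by (rule monomial_eq_iff) (auto simp: vJ resc_def c e(1) c0_props)
    moreover have "resc v c i ^ q * c0 (v i) = c0 i * resc v c (w i) \<longleftrightarrow> c (w i) = c i ^ q"
      if i: "i \<in> J" and comm: "w (v i) = v (w i)" for i
    proof -
      have nz: "e i \<noteq> 0" "e (w i) \<noteq> 0" "e (v i) \<noteq> 0" "e (w (v i)) \<noteq> 0" "c0 i \<noteq> 0" "c0 (v i) \<noteq> 0"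
        using e(1) i c0_props(2) vJ by auto
      have E: "e i ^ q = e (w i) * c0 i" "e (v i) ^ q = e (w (v i)) * c0 (v i)" using e(2) i vJ by auto
      have "resc v c i ^ q * c0 (v i) = c i ^ q * e (w i) * c0 i / e (w (v i))"
        unfolding resc_def power_divide power_mult_distrib E using nz by simp
      moreover have "c0 i * resc v c (w i) = c (w i) * e (w i) * c0 i / e (w (v i))"
        by (simp add: resc_def comm)
      ultimately show ?thesis using nz by auto
    qed
    ultimately show ?thesis by auto
  qed
  have GM_iff: "(v, c) \<in> carrier F.GM \<longleftrightarrow> v \<in> Sl n \<and> (\<forall>i. i \<notin> J \<longrightarrow> c i = 1) \<and> (\<forall>i\<in>J. c i \<noteq> 0) \<and>
      emb (v, c) \<in> carrier S \<and> frob q (from_std (emb (v, c))) = from_std (emb (v, c))" for v c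
  proof (cases "v \<in> Sl n \<and> (\<forall>i\<in>J. c i \<noteq> 0)")
    case True
    then have v: "v \<in> Sl n" and c: "\<And>i. i \<in> J \<Longrightarrow> c i \<noteq> 0" by auto
    have "emb (v, c) \<in> carrier S \<Longrightarrow> frob q (from_std (emb (v, c))) = from_std (emb (v, c)) \<longleftrightarrow>
        (\<forall>i\<in>J. v (w i) = w (v i) \<and> c (w i) = c i ^ q)"
      using frob_down[of "emb (v, c)"] frob_iff[OF v c] by (simp only: emb_vc)
    moreover have "emb (v, c) \<in> carrier S \<longleftrightarrow> (\<forall>i\<in>J. c i * c (- i) = \<beta> i / \<beta> (v i))"
      using S_iff[OF v] by (simp only: emb_vc)
    ultimately show ?thesis using v c unfolding F.carrier_iff by (auto simp: Sl_def)
  next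
    case False
    then show ?thesis unfolding F.carrier_iff by (auto simp: Sl_def)
  qed
  have emb_mult: "emb (x \<otimes>\<^bsub>F.GM\<^esub> y) = emb x \<otimes>\<^bsub>S\<^esub> emb y" if "x \<in> carrier F.GM" "y \<in> carrier F.GM" for x y
  proof -
    obtain v c u d where xy: "x = (v, c)" "y = (u, d)" by (cases x; cases y)
    have v: "v \<in> Sl n" and u: "u \<in> Sl n" using that unfolding xy GM_iff by auto
    have vJ: "v i \<in> J \<longleftrightarrow> i \<in> J" "u i \<in> J \<longleftrightarrow> i \<in> J" for i using SlD(2)[OF v] SlD(2)[OF u] by auto
    have "emb x \<otimes>\<^bsub>S\<^esub> emb y = monomial n (u \<circ> v) (\<lambda>i. resc v c i * resc u d (v i))"
      unfolding xy emb_vc Sp_mult by (rule monomial_mult) (auto simp: vJ)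
    also have "\<dots> = emb (x \<otimes>\<^bsub>F.GM\<^esub> y)"
      unfolding xy F.mult_eq emb_vc by (rule monomial_cong) (auto simp: resc_def e(1) vJ)
    finally show ?thesis by simp
  qed
  define \<Phi> where "\<Phi> = (\<lambda>x. PSp_proj n (from_std (emb x)))"
  have embS: "emb x \<in> carrier S" if "x \<in> carrier F.GM" for x
    using that GM_iff by (cases x) auto
  have hom: "group_hom F.GM (PSp n) \<Phi>"
    using F.group_GM P.H.is_group embS emb_mult
    by (auto simp: group_hom_def group_hom_axioms_def hom_def \<Phi>_def from_std_mult)
  interpret \<Phi>: group_hom F.GM "PSp n" \<Phi> by (rule hom)
  have ker: "kernel F.GM (PSp n) \<Phi> = F.signs"
  proof -
    have "x \<in> carrier F.GM \<and> \<Phi> x = \<one>\<^bsub>PSp n\<^esub> \<longleftrightarrow> x \<in> F.signs" for x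
    proof -
      obtain v c where x: "x = (v, c)" by (cases x)
      have "x \<in> F.signs \<longleftrightarrow> \<Phi> x = \<one>\<^bsub>PSp n\<^esub>" if xG: "x \<in> carrier F.GM"
      proof -
        have v: "v \<in> Sl n" and c: "\<And>i. i \<in> J \<Longrightarrow> c i \<noteq> 0" "\<And>i. i \<notin> J \<Longrightarrow> c i = 1"
          using xG unfolding x GM_iff by auto
        have vJ: "v i \<in> J \<longleftrightarrow> i \<in> J" for i using SlD(2)[OF v] .
        have "\<Phi> x = \<one>\<^bsub>PSp n\<^esub> \<longleftrightarrow> PSp_proj n (from_std (emb x)) = PSp_proj n \<one>\<^bsub>S\<^esub>" by (simp add: \<Phi>_def)
        also have "\<dots> \<longleftrightarrow> from_std (emb x) = \<one>\<^bsub>S\<^esub> \<or> from_std (emb x) = - \<one>\<^bsub>S\<^esub>"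
          using embS[OF xG] by (intro PSp_proj_eq_iff[OF n1]) auto
        also have "\<dots> \<longleftrightarrow> emb x = \<one>\<^bsub>S\<^esub> \<or> emb x = - \<one>\<^bsub>S\<^esub>"
        proof -
          have "to_std \<one>\<^bsub>S\<^esub> = \<one>\<^bsub>S\<^esub>" using \<gamma> by (simp add: to_std_def)
          then have u1: "to_std (- \<one>\<^bsub>S\<^esub>) = - \<one>\<^bsub>S\<^esub>" "to_std \<one>\<^bsub>S\<^esub> = \<one>\<^bsub>S\<^esub>" using to_std_uminus[of "\<one>\<^bsub>S\<^esub>"] by auto
          have m1: "- \<one>\<^bsub>S\<^esub> \<in> carrier S" by (rule uminus_Sp) simp
          show ?thesis using u1 to_from_std[OF embS[OF xG]] from_to_std[OF m1] from_to_std[OF P.G.one_closed] by metis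
        qed
        also have "\<dots> \<longleftrightarrow> (\<forall>i\<in>J. v i = i \<and> c i = 1) \<or> (\<forall>i\<in>J. v i = i \<and> c i = - 1)"
        proof -
          have m: "emb x = monomial n id (\<lambda>_. a) \<longleftrightarrow> (\<forall>i\<in>J. v i = i \<and> c i = a)" for a
          proof -
            have "emb x = monomial n id (\<lambda>_. a) \<longleftrightarrow> (\<forall>i\<in>J. v i = id i \<and> resc v c i = a)"
              unfolding x emb_vc by (rule monomial_eq_iff) (auto simp: vJ resc_def c e(1))
            moreover have "resc v c i = c i" if "i \<in> J" "v i = i" for i using that e(1) by (simp add: resc_def)
            ultimately show ?thesis by (metis id_apply)
          qed
          have "\<one>\<^bsub>S\<^esub> = monomial n id (\<lambda>_. 1)" "- \<one>\<^bsub>S\<^esub> = monomial n id (\<lambda>_. - 1)"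
            using one_monomial[of n, where 'a = 'a] minus_one_monomial[of n, where 'a = 'a] by (simp_all add: Sp_one)
          then show ?thesis using m by simp
        qed
        also have "\<dots> \<longleftrightarrow> x \<in> F.signs"
        proof -
          have "v i = i" if "i \<notin> J" for i using SlD(1)[OF v] that by (simp add: permutes_not_in)
          then have "v = id \<longleftrightarrow> (\<forall>i\<in>J. v i = i)" by (auto simp: fun_eq_iff)
          moreover have "c = (\<lambda>_. 1) \<longleftrightarrow> (\<forall>i\<in>J. c i = 1)" "c = (\<lambda>i. if i \<in> J then - 1 else 1) \<longleftrightarrow> (\<forall>i\<in>J. c i = - 1)"
            using c(2) by (auto simp: fun_eq_iff)
          ultimately show ?thesis unfolding x F.signs_def by blast
        qed
        finally show ?thesis by simp
      qed
      then show ?thesis using F.signs_carrier by blast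
    qed
    then show ?thesis by (auto simp: kernel_def)
  qed
  have lift: "\<exists>x\<in>carrier F.GM. fst x = v \<and> emb x = to_std A" if A: "A \<in> Sp_fin n q" and v: "v \<in> Sl n" and eq: "to_std A = monomial n v c" for A v c
  proof -
    have AS: "A \<in> carrier S" using A by (rule Sp_fin_carrier)
    have vJ: "v i \<in> J \<longleftrightarrow> i \<in> J" for i using SlD(2)[OF v] .
    have cS: "monomial n v c \<in> carrier S" using to_std_closed[OF AS] eq by simp
    have c0': "c i \<noteq> 0" if "i \<in> J" for i
    proof -
      have "c i * c (- i) * sg i = sg (v i)" using cS that by (simp add: monomial_Sp_iff[OF v])
      moreover have "(sg (v i) :: 'a) \<noteq> 0"
      proof -
        have "v i \<in> J" using that vJ by blast
        then show ?thesis by (rule sg_nonzero)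
      qed
      ultimately show ?thesis by auto
    qed
    define d where "d = (\<lambda>i. if i \<in> J then c i * e (v i) / e i else 1)"
    have m: "emb (v, d) = to_std A"
      unfolding eq emb_vc by (rule monomial_cong) (auto simp: resc_def d_def e(1) vJ)
    have "(v, d) \<in> carrier F.GM"
      unfolding GM_iff m using v c0' e(1) AS A vJ by (auto simp: d_def Sp_fin_def)
    then show ?thesis using m by (intro bexI[of _ "(v, d)"]) auto
  qed
  have fin: "from_std (emb x) \<in> Sp_fin n q" if "x \<in> carrier F.GM" for x
    using that GM_iff by (cases x) (auto simp: Sp_fin_def)
  have N: "\<Phi> ` carrier F.GM = normalizer (PSp n) conj_torus \<inter> PSp_fin n q"
    unfolding normalizer_fin
  proof (intro equalityI subsetI)
    fix y assume "y \<in> \<Phi> ` carrier F.GM"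
    then obtain x where x: "x \<in> carrier F.GM" "y = \<Phi> x" by blast
    obtain v c where vc: "x = (v, c)" by (cases x)
    have "v \<in> Sl n" "to_std (from_std (emb x)) = monomial n v (resc v c)"
      using x(1) embS[OF x(1)] unfolding vc GM_iff emb_vc by auto
    then show "y \<in> PSp_proj n ` {A \<in> Sp_fin n q. \<exists>v\<in>Sl n. \<exists>c. to_std A = monomial n v c}"
      using fin[OF x(1)] x(2) unfolding \<Phi>_def by blast
  next
    fix y assume "y \<in> PSp_proj n ` {A \<in> Sp_fin n q. \<exists>v\<in>Sl n. \<exists>c. to_std A = monomial n v c}"
    then obtain A v c where A: "A \<in> Sp_fin n q" "v \<in> Sl n" "to_std A = monomial n v c" "y = PSp_proj n A" by blast
    obtain x where "x \<in> carrier F.GM" "emb x = to_std A" using lift[OF A(1-3)] by blast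
    then show "y \<in> \<Phi> ` carrier F.GM" using A(4) from_to_std[OF Sp_fin_carrier[OF A(1)]] unfolding \<Phi>_def by (metis image_eqI)
  qed
  have T: "\<Phi> ` F.torus = conj_torus \<inter> PSp_fin n q"
    unfolding torus_fin
  proof (intro equalityI subsetI)
    fix y assume "y \<in> \<Phi> ` F.torus"
    then obtain c where x: "(id, c) \<in> carrier F.GM" "y = \<Phi> (id, c)" by (auto simp: F.torus_def)
    have m: "to_std (from_std (emb (id, c))) = monomial n id (resc id c)"
      using embS[OF x(1)] by (simp add: emb_vc)
    have "monomial n id (resc id c) \<in> carrier S" using embS[OF x(1)] by (simp add: emb_vc)
    then have "\<forall>i\<in>J. resc id c i * resc id c (- i) * sg i = sg i" by (simp add: monomial_Sp_iff)
    then have "monomial n id (resc id c) \<in> diag_torus n" by (auto simp: diag_torus_def)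
    then show "y \<in> PSp_proj n ` {A \<in> Sp_fin n q. to_std A \<in> diag_torus n}"
      using fin[OF x(1)] x(2) m unfolding \<Phi>_def by auto
  next
    fix y assume "y \<in> PSp_proj n ` {A \<in> Sp_fin n q. to_std A \<in> diag_torus n}"
    then obtain A d where A: "A \<in> Sp_fin n q" "to_std A = monomial n id d" "y = PSp_proj n A" by (auto simp: diag_torus_def)
    obtain x where "x \<in> carrier F.GM" "fst x = id" "emb x = to_std A" using lift[OF A(1) id_Sl A(2)] by blast
    then show "y \<in> \<Phi> ` F.torus"
      using A(3) from_to_std[OF Sp_fin_carrier[OF A(1)]] unfolding \<Phi>_def F.torus_def by (metis (mono_tags, lifting) image_eqI mem_Collect_eq)
  qed
  show ?thesis
    using complement_via_hom[OF hom F.torus_normal] F.signs_subset_torus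
    unfolding ker N T F.torus_complemented_def by blast
qed

end

section \<open>The criterion in terms of the cyclic type\<close>

text \<open>
  The blocks are the cycles up to sign. They exhaust all indices because their lengths add up to \<open>n\<close>.
\<close>
lemma signed_cycles_from_type:
  assumes type: "has_cyclic_type n k m ns \<phi>" and \<phi>: "\<phi> \<in> Sl n"
  obtains b blk where "signed_cycles (signed_indices n) \<phi> k m ns b blk"
proof -
  let ?J = "signed_indices n"
  from type obtain iss \<psi> where len: "\<And>j. j \<in> {1..m} \<Longrightarrow> length (iss j) = ns j"
    and cyc: "\<And>j. j \<in> {1..m} \<Longrightarrow> signed_cycle n (j \<le> k) (iss j) (\<psi> j)"
    and disj: "\<And>j l. j \<in> {1..m} \<Longrightarrow> l \<in> {1..m} \<Longrightarrow> j \<noteq> l \<Longrightarrow> abs ` set (iss j) \<inter> abs ` set (iss l) = {}"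
    and \<phi>_eq: "\<phi> = foldr (\<lambda>j \<chi>. \<psi> j \<circ> \<chi>) [1..<Suc m] id"
    and ns1: "\<And>j. j \<in> {1..m} \<Longrightarrow> ns j \<ge> 1" and total: "(\<Sum>j = 1..m. ns j) = n"
    unfolding has_cyclic_type_def by blast
  define B where "B = (\<lambda>j. abs ` set (iss j))"
  have B_disj: "j = l" if "j \<in> {1..m}" "l \<in> {1..m}" "x \<in> B j" "x \<in> B l" for j l x
    using disj[OF that(1,2)] that(3,4) unfolding B_def by blast
  have \<psi>: "\<psi> j \<in> Sl n" "iss j \<noteq> []" "set (iss j) \<subseteq> ?J" "distinct (map abs (iss j))"
    "\<And>s. Suc s < length (iss j) \<Longrightarrow> \<psi> j (iss j ! s) = iss j ! Suc s"
    "\<psi> j (last (iss j)) = (if j \<le> k then - hd (iss j) else hd (iss j))"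
    "\<And>i. i \<in> ?J \<Longrightarrow> \<bar>i\<bar> \<notin> B j \<Longrightarrow> \<psi> j i = i" if "j \<in> {1..m}" for j
    using cyc[OF that] unfolding signed_cycle_def B_def by blast+
  have \<psi>_block: "\<psi> j i \<in> ?J \<and> \<bar>\<psi> j i\<bar> \<in> B j" if j: "j \<in> {1..m}" and i: "i \<in> ?J" "\<bar>i\<bar> \<in> B j" for i j
  proof
    show J: "\<psi> j i \<in> ?J" using SlD(2)[OF \<psi>(1)[OF j]] i by simp
    show "\<bar>\<psi> j i\<bar> \<in> B j"
    proof (rule ccontr)
      assume n: "\<bar>\<psi> j i\<bar> \<notin> B j"
      then have "\<psi> j (\<psi> j i) = \<psi> j i" using \<psi>(7)[OF j J] by simp
      then have "\<psi> j i = i" using permutes_inj[OF SlD(1)[OF \<psi>(1)[OF j]]] by (simp add: inj_eq)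
      then show False using n i by simp
    qed
  qed
  define F where "F = (\<lambda>js. foldr (\<lambda>j \<chi>. \<psi> j \<circ> \<chi>) js (id :: int \<Rightarrow> int))"
  have F_simps: "F [] i = i" "F (l # js) i = \<psi> l (F js i)" for l js i by (simp_all add: F_def)
  have fold: "F js i = (if j \<in> set js then \<psi> j i else i)"
    if j: "j \<in> {1..m}" and i: "i \<in> ?J" "\<bar>i\<bar> \<in> B j" and js: "distinct js" "set js \<subseteq> {1..m}" for j i js
    using js
  proof (induction js)
    case (Cons l js)
    then have IH: "F js i = (if j \<in> set js then \<psi> j i else i)" and l: "l \<in> {1..m}" "l \<notin> set js" by auto
    show ?case
    proof (cases "l = j")
      case True
      then show ?thesis using IH l by (simp add: F_simps)
    next
      case False
      have "F js i \<in> ?J" "\<bar>F js i\<bar> \<in> B j" using \<psi>_block[OF j i] i by (auto simp: IH)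
      then have "\<psi> l (F js i) = F js i" using \<psi>(7)[OF l(1), of "F js i"] B_disj[OF j l(1)] False by blast
      then show ?thesis using IH False by (auto simp: F_simps)
    qed
  qed (simp add: F_simps)
  have \<phi>\<psi>: "\<phi> i = \<psi> j i" if "j \<in> {1..m}" "i \<in> ?J" "\<bar>i\<bar> \<in> B j" for i j
  proof -
    have "j \<in> set [1..<Suc m]" using that(1) by auto
    moreover have "F [1..<Suc m] i = (if j \<in> set [1..<Suc m] then \<psi> j i else i)"
      by (rule fold[OF that distinct_upt]) auto
    ultimately have "F [1..<Suc m] i = \<psi> j i" by (simp only: if_True)
    then show ?thesis by (simp only: \<phi>_eq F_def)
  qed
  have cover: "\<exists>j\<in>{1..m}. \<bar>i\<bar> \<in> B j" if i: "i \<in> ?J" for i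
  proof -
    have Bsub: "B j \<subseteq> {1..int n}" if "j \<in> {1..m}" for j
      using \<psi>(3)[OF that] unfolding B_def signed_indices_def by auto
    have card_B: "card (B j) = ns j" if "j \<in> {1..m}" for j
      using distinct_card[OF \<psi>(4)[OF that]] len[OF that] by (simp add: B_def)
    have "card (\<Union>j\<in>{1..m}. B j) = (\<Sum>j\<in>{1..m}. card (B j))"
      by (rule card_UN_disjoint, simp, simp add: B_def, intro ballI impI, unfold B_def, rule disj)
    also have "\<dots> = (\<Sum>j\<in>{1..m}. ns j)" by (rule sum.cong) (simp_all only: card_B)
    finally have "card (\<Union>j\<in>{1..m}. B j) = (\<Sum>j\<in>{1..m}. ns j)" .
    then have "card (\<Union>j\<in>{1..m}. B j) = card {1..int n}" using total by simp
    then have "(\<Union>j\<in>{1..m}. B j) = {1..int n}"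
    proof (intro card_subset_eq)
      show "(\<Union>j\<in>{1..m}. B j) \<subseteq> {1..int n}" using Bsub by blast
    qed auto
    moreover have "\<bar>i\<bar> \<in> {1..int n}" using i by (auto simp: signed_indices_def)
    ultimately show ?thesis by blast
  qed
  define blk where "blk = (\<lambda>i. THE j. j \<in> {1..m} \<and> \<bar>i\<bar> \<in> B j)"
  have blk_eq: "blk i = j" if "j \<in> {1..m}" "\<bar>i\<bar> \<in> B j" for i j
    unfolding blk_def using that B_disj by (intro the_equality) auto
  have blk: "blk i \<in> {1..m}" "\<bar>i\<bar> \<in> B (blk i)" if "i \<in> ?J" for i
    using cover[OF that] blk_eq by auto
  define b where "b = (\<lambda>j. hd (iss j))"
  have nth: "iss j ! s \<in> ?J" "\<bar>iss j ! s\<bar> \<in> B j" if "j \<in> {1..m}" "s < ns j" for j s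
    using \<psi>(3)[OF that(1)] len[OF that(1)] that(2) by (auto simp: B_def)
  have b0: "b j = iss j ! 0" if "j \<in> {1..m}" for j using \<psi>(2)[OF that] by (simp add: b_def hd_conv_nth)
  have pow: "(\<phi> ^^ s) (b j) = iss j ! s" if j: "j \<in> {1..m}" and s: "s < ns j" for j s
    using s
  proof (induction s)
    case (Suc s)
    then show ?case using \<phi>\<psi>[OF j nth[OF j]] \<psi>(5)[OF j] len[OF j] by simp
  qed (simp add: b0[OF j])
  have "signed_cycles ?J \<phi> k m ns b blk"
  proof unfold_locales
    show "0 \<notin> ?J" by simp
    show "\<phi> permutes ?J" using SlD(1)[OF \<phi>] .
    fix i assume i: "i \<in> ?J"
    show "- i \<in> ?J" using i by simp
    show "\<phi> (- i) = - \<phi> i" using SlD(3)[OF \<phi> i] .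
    show "blk i \<in> {1..m}" using blk[OF i] by simp
    show "blk (- i) = blk i" by (simp add: blk_def)
    show "blk (\<phi> i) = blk i"
      using blk_eq[OF blk(1)[OF i], of "\<phi> i"] \<psi>_block[OF blk(1)[OF i] i blk(2)[OF i]] \<phi>\<psi>[OF blk(1)[OF i] i blk(2)[OF i]] by simp
    show "\<exists>s. i = (\<phi> ^^ s) (b (blk i)) \<or> i = - (\<phi> ^^ s) (b (blk i))"
    proof -
      let ?j = "blk i"
      obtain x where x: "x \<in> set (iss ?j)" "\<bar>i\<bar> = \<bar>x\<bar>" using blk(2)[OF i] by (auto simp: B_def)
      then obtain s where "s < ns ?j" "x = iss ?j ! s" using len[OF blk(1)[OF i]] by (auto simp: in_set_conv_nth)
      then have "x = (\<phi> ^^ s) (b ?j)" using pow[OF blk(1)[OF i]] by simp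
      then show ?thesis using x(2) by (auto simp: abs_eq_iff)
    qed
  next
    fix j assume j: "j \<in> {1..m}"
    show "b j \<in> ?J" using nth(1)[OF j, of 0] ns1[OF j] b0[OF j] by simp
    show "blk (b j) = j" using blk_eq[OF j] nth(2)[OF j, of 0] ns1[OF j] b0[OF j] by simp
    show "ns j \<ge> 1" using ns1[OF j] .
    have n: "ns j = Suc (ns j - 1)" "ns j - 1 < ns j" using ns1[OF j] by auto
    have "(\<phi> ^^ ns j) (b j) = \<phi> (iss j ! (ns j - 1))" using pow[OF j n(2)] by (subst n(1)) simp
    also have "\<dots> = \<psi> j (last (iss j))"
      using \<phi>\<psi>[OF j nth[OF j n(2)]] len[OF j] \<psi>(2)[OF j] by (simp add: last_conv_nth)
    finally show "(\<phi> ^^ ns j) (b j) = (if j \<le> k then - b j else b j)" using \<psi>(6)[OF j] by (simp add: b_def)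
    fix s assume s: "0 < s" "s < ns j"
    have "map abs (iss j) ! s \<noteq> map abs (iss j) ! 0"
      using \<psi>(4)[OF j] len[OF j] s by (subst nth_eq_iff_index_eq) auto
    then show "\<bar>(\<phi> ^^ s) (b j)\<bar> \<noteq> \<bar>b j\<bar>"
      using pow[OF j s(2)] b0[OF j] len[OF j] s \<psi>(2)[OF j] by simp
  qed
  then show thesis by (rule that)
qed

lemma type_arithmetic:
  fixes q k m :: nat
  assumes q: "odd q" and k: "k \<le> m"
  shows "m = 2 \<and> (\<forall>j\<in>{1..m}. q ^ ns j mod 4 = 1 \<longleftrightarrow> k < j) \<longleftrightarrow>
    (m = 2 \<and> k = 2 \<and> odd (ns 1) \<and> odd (ns 2) \<and> q mod 4 = 3) \<or>
    (m = 2 \<and> k = 1 \<and> odd (ns 1) \<and> even (ns 2) \<and> q mod 4 = 3) \<or>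
    (m = 2 \<and> k = 0 \<and> even (ns 1) \<and> even (ns 2) \<and> q mod 4 = 3) \<or>
    (m = 2 \<and> k = 0 \<and> q mod 4 = 1)"
proof (cases "m = 2")
  case True
  have q4: "q mod 4 = 1 \<or> q mod 4 = 3" using q by presburger
  note pow_mod = odd_power_mod_4[OF q]
  have "{1..m} = {1, 2}" using True by auto
  then have "(\<forall>j\<in>{1..m}. q ^ ns j mod 4 = 1 \<longleftrightarrow> k < j) \<longleftrightarrow>
      ((\<not> (q mod 4 = 3 \<and> odd (ns 1))) \<longleftrightarrow> k < 1) \<and> ((\<not> (q mod 4 = 3 \<and> odd (ns 2))) \<longleftrightarrow> k < 2)"
    by (simp add: pow_mod)
  moreover have "k = 0 \<or> k = 1 \<or> k = 2" using k True by auto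
  ultimately show ?thesis using q4 True by (elim disjE) auto
qed simp

theorem mainTheorem3:
  fixes p q n k m :: nat
    and ns :: "nat \<Rightarrow> nat"
    and Tbar :: "'a::alg_closed_field mat set set"
  assumes "prime p"
    and "alg_closure_of_Fp TYPE('a) p"
    and "\<exists>e\<ge>1. q = p ^ e"
    and "n \<ge> 1"
    and "is_maximal_torus (PSp n) (regular_PSp n) Tbar"
    and "PSp_frob q ` Tbar = Tbar"
    and "torus_has_type n q Tbar k m ns"
  shows "has_complement (PSp n) (Tbar \<inter> PSp_fin n q) (normalizer (PSp n) Tbar \<inter> PSp_fin n q) \<longleftrightarrow>
           p = 2 \<or>
           m = 1 \<or>
           (m = 2 \<and> k = 2 \<and> odd (ns 1) \<and> odd (ns 2) \<and> q mod 4 = 3) \<or>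
           (m = 2 \<and> k = 1 \<and> odd (ns 1) \<and> even (ns 2) \<and> q mod 4 = 3) \<or>
           (m = 2 \<and> k = 0 \<and> even (ns 1) \<and> even (ns 2) \<and> q mod 4 = 3) \<or>
           (m = 2 \<and> k = 0 \<and> q mod 4 = 1)"
proof -
  let ?J = "signed_indices n" and ?S = "Sp n :: 'a mat monoid"
  have char: "CHAR('a) = p" using assms(2) by (simp add: alg_closure_of_Fp_def)
  interpret Q: frobenius_power q "TYPE('a)" by unfold_locales (use assms(1,3) char in auto)
  interpret P: group_hom ?S "PSp n" "PSp_proj n" by (rule group_hom_PSp_proj)
  obtain g \<phi> where g: "g \<in> carrier (PSp n)" "Tbar = inv\<^bsub>PSp n\<^esub> g <#\<^bsub>PSp n\<^esub> T0 n #>\<^bsub>PSp n\<^esub> g"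
    and ind: "induces_perm n (PSp_frob q g \<otimes>\<^bsub>PSp n\<^esub> inv\<^bsub>PSp n\<^esub> g) \<phi>" and type: "has_cyclic_type n k m ns \<phi>"
    using assms(7) unfolding torus_has_type_def by blast
  obtain \<gamma> where \<gamma>: "\<gamma> \<in> carrier ?S" "g = PSp_proj n \<gamma>" using g(1) unfolding carrier_PSp by blast
  have fS: "frob q \<gamma> \<in> carrier ?S" using Q.frob_Sp[OF \<gamma>(1)] .
  let ?X = "frob q \<gamma> \<otimes>\<^bsub>?S\<^esub> inv\<^bsub>?S\<^esub> \<gamma>"
  have XS: "?X \<in> carrier ?S" using fS \<gamma>(1) by blast
  have "PSp_frob q g \<otimes>\<^bsub>PSp n\<^esub> inv\<^bsub>PSp n\<^esub> g = PSp_proj n ?X"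
    using fS \<gamma> Q.PSp_frob_proj[OF assms(4) \<gamma>(1)] by (simp del: Sp_mult)
  then obtain A where \<phi>: "\<phi> \<in> Sl n" and A: "A \<in> carrier ?S" "PSp_proj n ?X = PSp_proj n A"
    and pat: "\<And>i j. i \<in> ?J \<Longrightarrow> j \<in> ?J \<Longrightarrow> A $$ (mat_pos n i, mat_pos n j) \<noteq> 0 \<longleftrightarrow> j = \<phi> i"
    using ind unfolding induces_perm_def by auto
  define c0 where "c0 = (\<lambda>i. entry n ?X i (\<phi> i))"
  have "?X = A \<or> ?X = - A" using PSp_proj_eq_iff[OF assms(4) XS A(1)] A(2) by blast
  then have pat': "entry n ?X i j = 0" if "i \<in> ?J" "j \<in> ?J" "j \<noteq> \<phi> i" for i j
    using pat[OF that(1,2)] that Sp_carrier[OF A(1)] by (auto simp: entry_def[symmetric] simp del: Sp_mult)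
  have X_mono: "?X = monomial n \<phi> c0"
    by (rule matrix_eqI[OF Sp_carrier[OF XS]]) (auto simp: c0_def pat' simp del: Sp_mult)
  have "?X \<otimes>\<^bsub>?S\<^esub> \<gamma> = frob q \<gamma>" using fS \<gamma>(1) by (simp add: P.G.m_assoc del: Sp_mult Sp_one)
  then have frob_\<gamma>: "frob q \<gamma> = monomial n \<phi> c0 * \<gamma>" unfolding X_mono by simp
  interpret U: twisted_torus q n \<gamma> \<phi> c0
    by unfold_locales (use assms(4) \<gamma>(1) \<phi> frob_\<gamma> in auto)
  have TbT: "U.conj_torus = Tbar" unfolding U.conj_torus_def g(2) \<gamma>(2) by simp
  obtain b blk where cycles: "signed_cycles ?J \<phi> k m ns b blk"
    using signed_cycles_from_type[OF type \<phi>] .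
  interpret C: signed_cycles ?J \<phi> k m ns b blk by fact
  show ?thesis
  proof (cases "p = 2")
    case True
    have "(of_nat 2 :: 'a) = 0" using char True by (metis of_nat_CHAR)
    then have two: "(1::'a) = - 1" by (simp add: eq_neg_iff_add_eq_0)
    have tw: "frobenius_twist ?J \<phi> q (\<lambda>_. 1 :: 'a)"
      by unfold_locales (use two Q.minus_one_q in auto)
    interpret F: frobenius_twist ?J \<phi> q "\<lambda>_. 1 :: 'a" by fact
    have "F.torus_complemented" using F.complement_char_2[OF two] by simp
    then show ?thesis using U.complement_iff_torus_complemented[OF tw] True TbT by simp
  next
    case False
    have odd_char: "(1::'a) \<noteq> - 1"
    proof
      assume "(1::'a) = - 1"
      then have "(of_nat 2 :: 'a) = 0" by (simp add: eq_neg_iff_add_eq_0)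
      then have "p dvd 2" using char by (simp add: of_nat_eq_0_iff_char_dvd del: of_nat_numeral)
      then show False using False assms(1) primes_dvd_imp_eq two_is_prime_nat by blast
    qed
    have "odd p" using assms(1) False prime_odd_nat prime_ge_2_nat by (metis le_neq_implies_less)
    then have q: "odd q" using assms(3) by auto
    obtain \<beta> :: "int \<Rightarrow> 'a" where
      \<beta>: "\<forall>i\<in>?J. \<beta> i \<noteq> 0 \<and> \<beta> (- i) = - \<beta> i \<and> \<beta> (\<phi> i) = \<beta> i ^ q" and
      sym: "\<forall>j\<in>{1..m}. \<forall>l\<in>{1..m}. ns j = ns l \<and> C.cycle_sign j = C.cycle_sign l \<longrightarrow> \<beta> (b j) = \<beta> (b l)"
      using C.normalized_form[where 'a = 'a, OF q Q.q_gt_1] by blast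
    have tw: "frobenius_twist ?J \<phi> q \<beta>"
      by unfold_locales (use \<beta> Q.minus_one_q in auto)
    interpret B: signed_blocks ?J \<phi> q \<beta> k m ns b blk
      by (intro signed_blocks.intro tw cycles)
    have "(\<Sum>j = 1..m. ns j) = n" "k \<le> m" using type unfolding has_cyclic_type_def by blast+
    then have "m \<noteq> 0" using assms(4) by (cases "m = 0") auto
    have "B.torus_complemented \<longleftrightarrow> m = 1 \<or> m = 2 \<and> (\<forall>j\<in>{1..m}. q ^ ns j mod 4 = 1 \<longleftrightarrow> k < j)"
    proof
      assume "B.torus_complemented"
      then show "m = 1 \<or> m = 2 \<and> (\<forall>j\<in>{1..m}. q ^ ns j mod 4 = 1 \<longleftrightarrow> k < j)"
        using B.complement_necessary[OF odd_char q] \<open>m \<noteq> 0\<close> by (cases "m = 1") auto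
    next
      assume "m = 1 \<or> m = 2 \<and> (\<forall>j\<in>{1..m}. q ^ ns j mod 4 = 1 \<longleftrightarrow> k < j)"
      then show "B.torus_complemented"
        using B.complement_sufficient[OF odd_char q Q.q_gt_1] sym by blast
    qed
    then show ?thesis
      using U.complement_iff_torus_complemented[OF tw] type_arithmetic[OF q \<open>k \<le> m\<close>, of ns] False TbT by simp
  qed
qed

end
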